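(* Suppose that $v_\pm>0$, $u_->0$, $\theta_\pm>0$ and let $\delta^B=|(u_+-u_-,\theta_+-\theta_-)|$. If $u_+\le0$, then the boundary layer problem (BL) has no solution. If $u_+>0$, then there exists a suitably small constant $\delta>0$ such that if $0<\delta^B\le\delta$, then the following hold. Case I (supersonic, $M_+>1$). There is no solution to (BL) (equivalently, to its reduced form (BL$'$)). Case II (transonic, $M_+=1$). Then $(u_+,\theta_+)$ is a saddle-knot point of (BL$'$). Precisely, there exists a unique trajectory $\Gamma$ tangent to the line $$\mu u_+(U^B-u_+)-\kappa(\gamma-1)(\Theta^B-\theta_+)=0$$ at the point $(u_+,\theta_+)$. For each $(u_-,\theta_-)\in\Gamma$ there exists a unique solution $(U^B,\Theta^B)$ satisfying $$\left|\frac{d^n}{d\xi^n}(U^B-u_+,\Theta^B-\theta_+)\right|\le C\frac{(\delta^B)^n}{(1+\delta^B\xi)^n},\qquad n=0,1,2,\dots,\ \xi\in\mathbb R_+.$$ Case III (subsonic, $M_+<1$). Then the equilibrium point $(u_+,\theta_+)$ is a saddle point of (BL$'$). Precisely, there exists a center-stable manifold $\mathcal M$ tangent to the line $$(1+a_2c_2u_+)(U^B-u_+)-a_2(\Theta^B-\theta_+)=0$$ on the opposite directions at the point $(u_+,\theta_+)$. Here $c_2$ is the positive solution of $$y^2+\left(\frac{M_+^2\gamma-1}{M_+^2R\gamma}-\frac{\mu}{\kappa(\gamma-1)}\right)y-\frac{\mu}{M_+^2R\gamma\kappa}=0$$ and $a_2=-\frac{R}{\mu(\lambda_J^1-\lambda_J^2)}$,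 where $\lambda_J^1>0$, $\lambda_J^2<0$ are the two eigenvalues of the matrix $J$. Only when $(u_-,\theta_-)\in\mathcal M$ does there exist a unique solution $(U^B,\Theta^B)\subset\mathcal M$ satisfying $$\left|\frac{d^n}{d\xi^n}(U^B-u_+,\Theta^B-\theta_+)\right|\le C\delta^Be^{-c\xi},\qquad n=0,1,2,\dots,\ \xi\in\mathbb R_+.$$
   Context: Constants: $R>0$, $\gamma>1$, $\mu>0$, $\kappa>0$. $C,c$ denote positive generic constants. $M_+=|u_+|/\sqrt{R\gamma\theta_+}$ is the Mach number of the right end state, $p_+=R\theta_+/v_+$, and $\sigma_-=-u_-/v_-<0$. Boundary layer problem (BL): find $(V^B,U^B,\Theta^B)(\xi)$, $\xi\ge0$, with $V^B>0$, such that, with $'=d/d\xi$ and $P^B=R\Theta^B/V^B$, $$\begin{cases}-\sigma_-(V^B)'-(U^B)'=0,\\ -\sigma_-(U^B)'+(P^B)'=\mu\left(\frac{(U^B)'}{V^B}\right)',\\ -\sigma_-\left(\frac{R}{\gamma-1}\Theta^B+\frac{(U^B)^2}{2}\right)'+(P^BU^B)'=\kappa\left(\frac{(\Theta^B)'}{V^B}\right)'+\mu\left(\frac{U^B(U^B)'}{V^B}\right)',\end{cases}\qquad\xi>0,$$ $(V^B,U^B,\Theta^B)(0)=(v_-,u_-,\theta_-)$, $(V^B,U^B,\Theta^B)(+\infty)=(v_+,u_+,\theta_+)$. Integrating over $(\xi,+\infty)$, this reduces to the relations $-\sigma_-=\frac{u_-}{v_-}=\frac{U^B}{V^B}=\frac{u_+}{v_+}$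 together with $$(U^B)'=-\frac{\sigma_-}{\mu}V^B(U^B-u_+)+\frac R\mu\left(\Theta^B-\frac{\theta_+}{v_+}V^B\right),$$ $$(\Theta^B)'=-\frac{R\sigma_-V^B}{\kappa(\gamma-1)}(\Theta^B-\theta_+)+\frac{p_+}{\kappa}V^B(U^B-u_+)+\frac{\sigma_-V^B}{2\kappa}(U^B-u_+)^2,$$ $(U^B,\Theta^B)(0)=(u_-,\theta_-)$, $(U^B,\Theta^B)(+\infty)=(u_+,\theta_+)$. For $u_+>0$, eliminating $V^B=v_+U^B/u_+$ and writing $\bar U^B=U^B-u_+$, $\bar\Theta^B=\Theta^B-\theta_+$, one obtains the reduced autonomous form (BL$'$): $$\begin{pmatrix}\bar U^B\\ \bar\Theta^B\end{pmatrix}'=J\begin{pmatrix}\bar U^B\\ \bar\Theta^B\end{pmatrix}+\begin{pmatrix}F_1\\ F_2\end{pmatrix},\qquad J=\begin{pmatrix}\frac{u_+^2-R\theta_+}{\mu u_+}&\frac R\mu\\[2mm] \frac{R\theta_+}{\kappa}&\frac{Ru_+}{\kappa(\gamma-1)}\end{pmatrix},$$ $$F_1=\frac1\mu(\bar U^B)^2,\qquad F_2=\left(\frac{R\theta_+}{\kappa u_+}-\frac{u_+}{2\kappa}\right)(\bar U^B)^2+\frac{R}{\kappa(\gamma-1)}\bar U^B\bar\Theta^B-\frac1{2\kappa}(\bar U^B)^3,$$ with $(\bar U^B,\bar\Theta^B)(0)=(u_--u_+,\theta_--\theta_+)$ and $(\bar U^B,\bar\Theta^B)(+\infty)=(0,0)$.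 In Cases II and III, "solution" means a solution of (BL$'$), and trajectories and manifolds are understood in a small neighbourhood of $(u_+,\theta_+)$; $\Gamma$ and $\mathcal M$ consist of points whose trajectories converge to $(u_+,\theta_+)$ as $\xi\to+\infty$.
   Formalization: In Case II the printed tangent line is the unstable eigendirection of J at M_+=1, to which no trajectory converging to (u_+,θ_+) is tangent; it is replaced by the kernel line (γ-1)u_+(U^B-u_+)+Rγ(Θ^B-θ_+)=0. *)

theory Defs
  imports "HOL-Analysis.Analysis"
begin

text \<open>Left and right end states carry the suffixes \<open>m\<close> and \<open>p\<close>. Points of the
  \<open>(U, \<Theta>)\<close>-plane are vectors in \<open>real^2\<close>, so that \<open>norm\<close> is the Euclidean norm.\<close>

abbreviation pt :: "real \<Rightarrow> real \<Rightarrow> real^2" where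
  "pt u \<theta> \<equiv> vector [u, \<theta>]"

definition mach :: "real \<Rightarrow> real \<Rightarrow> real \<Rightarrow> real \<Rightarrow> real" where
  "mach R \<gamma> u \<theta> = \<bar>u\<bar> / sqrt (R * \<gamma> * \<theta>)"

text \<open>Classical solutions of the boundary layer problem: continuous up to the boundary \<open>\<xi> = 0\<close>,
  and regular enough for every derivative in the system to exist for \<open>\<xi> > 0\<close>. The values of the
  functions at negative arguments are irrelevant.\<close>

definition bl_solution ::
  "real \<Rightarrow> real \<Rightarrow> real \<Rightarrow> real \<Rightarrow> real \<times> real \<times> real \<Rightarrow> real \<times> real \<times> real \<Rightarrow>
   (real \<Rightarrow> real) \<Rightarrow> (real \<Rightarrow> real) \<Rightarrow> (real \<Rightarrow> real) \<Rightarrow> bool" where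
  "bl_solution R \<gamma> \<mu> \<kappa> = (\<lambda>(vm, um, \<theta>m) (vp, up, \<theta>p) V U \<Theta>.
     let \<sigma> = - um / vm; P = (\<lambda>\<xi>. R * \<Theta> \<xi> / V \<xi>) in
       continuous_on {0..} V \<and> continuous_on {0..} U \<and> continuous_on {0..} \<Theta> \<and>
       (\<forall>\<xi>\<ge>0. V \<xi> > 0) \<and>
       (\<forall>\<xi>>0. V differentiable (at \<xi>) \<and> U differentiable (at \<xi>) \<and> \<Theta> differentiable (at \<xi>) \<and>
              deriv U differentiable (at \<xi>) \<and> deriv \<Theta> differentiable (at \<xi>)) \<and>
       (\<forall>\<xi>>0. - \<sigma> * deriv V \<xi> - deriv U \<xi> = 0) \<and>
       (\<forall>\<xi>>0. - \<sigma> * deriv U \<xi> + deriv P \<xi> = \<mu> * deriv (\<lambda>s. deriv U s / V s) \<xi>) \<and>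
       (\<forall>\<xi>>0. - \<sigma> * deriv (\<lambda>s. R / (\<gamma> - 1) * \<Theta> s + (U s)\<^sup>2 / 2) \<xi> + deriv (\<lambda>s. P s * U s) \<xi> =
              \<kappa> * deriv (\<lambda>s. deriv \<Theta> s / V s) \<xi> + \<mu> * deriv (\<lambda>s. U s * deriv U s / V s) \<xi>) \<and>
       V 0 = vm \<and> U 0 = um \<and> \<Theta> 0 = \<theta>m \<and>
       (V \<longlongrightarrow> vp) at_top \<and> (U \<longlongrightarrow> up) at_top \<and> (\<Theta> \<longlongrightarrow> \<theta>p) at_top)"

text \<open>The reduced autonomous problem, written in the unknown \<open>W = (U, \<Theta>)\<close>.\<close>

definition red_J :: "real \<Rightarrow> real \<Rightarrow> real \<Rightarrow> real \<Rightarrow> real \<Rightarrow> real \<Rightarrow> real^2^2" where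
  "red_J R \<gamma> \<mu> \<kappa> up \<theta>p = vector
     [vector [(up\<^sup>2 - R * \<theta>p) / (\<mu> * up), R / \<mu>],
      vector [R * \<theta>p / \<kappa>, R * up / (\<kappa> * (\<gamma> - 1))]]"

definition red_F :: "real \<Rightarrow> real \<Rightarrow> real \<Rightarrow> real \<Rightarrow> real \<Rightarrow> real \<Rightarrow> real^2 \<Rightarrow> real^2" where
  "red_F R \<gamma> \<mu> \<kappa> up \<theta>p z = vector
     [1 / \<mu> * (z$1)\<^sup>2,
      (R * \<theta>p / (\<kappa> * up) - up / (2 * \<kappa>)) * (z$1)\<^sup>2
        + R / (\<kappa> * (\<gamma> - 1)) * z$1 * z$2 - 1 / (2 * \<kappa>) * (z$1)^3]"

definition red_field :: "real \<Rightarrow> real \<Rightarrow> real \<Rightarrow> real \<Rightarrow> real \<Rightarrow> real \<Rightarrow> real^2 \<Rightarrow> real^2" where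
  "red_field R \<gamma> \<mu> \<kappa> up \<theta>p w =
     red_J R \<gamma> \<mu> \<kappa> up \<theta>p *v (w - pt up \<theta>p) + red_F R \<gamma> \<mu> \<kappa> up \<theta>p (w - pt up \<theta>p)"

text \<open>Solution on the half-line of \<open>W' = f W\<close> running from \<open>wm\<close> to \<open>wp\<close>.\<close>

definition connects :: "(real^2 \<Rightarrow> real^2) \<Rightarrow> real^2 \<Rightarrow> real^2 \<Rightarrow> (real \<Rightarrow> real^2) \<Rightarrow> bool" where
  "connects f wm wp W \<longleftrightarrow>
     continuous_on {0..} W \<and> (\<forall>\<xi>>0. (W has_vector_derivative f (W \<xi>)) (at \<xi>)) \<and>
     W 0 = wm \<and> (W \<longlongrightarrow> wp) at_top"

abbreviation red_solution ::
  "real \<Rightarrow> real \<Rightarrow> real \<Rightarrow> real \<Rightarrow> real \<times> real \<Rightarrow> real \<times> real \<Rightarrow> (real \<Rightarrow> real^2) \<Rightarrow> bool" where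
  "red_solution R \<gamma> \<mu> \<kappa> lft rgt W \<equiv>
     connects (red_field R \<gamma> \<mu> \<kappa> (fst rgt) (snd rgt)) (pt (fst lft) (snd lft))
       (pt (fst rgt) (snd rgt)) W"

text \<open>\<open>W\<close> is smooth on the closed half-line (one-sided derivatives at \<open>0\<close>), and
  \<open>B n\<close> bounds the norm of the \<open>n\<close>-th derivative of \<open>W - wp\<close>, which is \<open>D n\<close>.\<close>

definition derivs_bounded_by ::
  "(real \<Rightarrow> real^2) \<Rightarrow> real^2 \<Rightarrow> (nat \<Rightarrow> real \<Rightarrow> real) \<Rightarrow> bool" where
  "derivs_bounded_by W wp B \<longleftrightarrow> (\<exists>D :: nat \<Rightarrow> real \<Rightarrow> real^2.
     (\<forall>\<xi>\<ge>0. D 0 \<xi> = W \<xi> - wp) \<and>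
     (\<forall>n. \<forall>\<xi>\<ge>0. (D n has_vector_derivative D (Suc n) \<xi>) (at \<xi> within {0..})) \<and>
     (\<forall>n. \<forall>\<xi>\<ge>0. norm (D n \<xi>) \<le> B n \<xi>))"

definition eigenvalues :: "real^2^2 \<Rightarrow> real set" where
  "eigenvalues A = {l. \<exists>v. v \<noteq> 0 \<and> A *v v = l *\<^sub>R v}"

definition saddle_point :: "(real^2 \<Rightarrow> real^2) \<Rightarrow> real^2 \<Rightarrow> bool" where
  "saddle_point f p \<longleftrightarrow> f p = 0 \<and>
     (\<exists>A l1 l2. (f has_derivative (\<lambda>v. A *v v)) (at p) \<and>
        eigenvalues A = {l1, l2} \<and> l2 < 0 \<and> 0 < l1)"

text \<open>A saddle-knot (saddle-node): the linearisation has a zero and a nonzero eigenvalue, and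
  the quadratic part of \<open>f\<close> along the kernel, projected along the range, does not vanish (\<open>r\<close> and
  \<open>l\<close> are right and left null vectors).\<close>

definition saddle_knot :: "(real^2 \<Rightarrow> real^2) \<Rightarrow> real^2 \<Rightarrow> bool" where
  "saddle_knot f p \<longleftrightarrow> f p = 0 \<and>
     (\<exists>A k. (f has_derivative (\<lambda>v. A *v v)) (at p) \<and> eigenvalues A = {0, k} \<and> k \<noteq> 0 \<and>
        (\<exists>l r b. l \<noteq> 0 \<and> l v* A = 0 \<and> r \<noteq> 0 \<and> A *v r = 0 \<and> b \<noteq> 0 \<and>
           ((\<lambda>t. (l \<bullet> f (p + t *\<^sub>R r)) / t\<^sup>2) \<longlongrightarrow> b) (at 0)))"

definition solves_in :: "(real^2 \<Rightarrow> real^2) \<Rightarrow> (real^2) set \<Rightarrow> real set \<Rightarrow> (real \<Rightarrow> real^2) \<Rightarrow> bool" where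
  "solves_in f N I w \<longleftrightarrow>
     (\<forall>\<xi>\<in>I. (w has_vector_derivative f (w \<xi>)) (at \<xi>) \<and> w \<xi> \<in> N)"

text \<open>\<open>\<Gamma>\<close> is the orbit in \<open>N\<close> of a solution that cannot be continued inside \<open>N\<close> and that
  converges to \<open>p\<close> as \<open>\<xi>\<close> tends to plus infinity.\<close>

definition converging_trajectory ::
  "(real^2 \<Rightarrow> real^2) \<Rightarrow> (real^2) set \<Rightarrow> real^2 \<Rightarrow> (real^2) set \<Rightarrow> bool" where
  "converging_trajectory f N p \<Gamma> \<longleftrightarrow> (\<exists>I w.
     open I \<and> is_interval I \<and> \<not> bdd_above I \<and> solves_in f N I w \<and>
     (\<forall>I' w'. open I' \<and> is_interval I' \<and> I \<subseteq> I' \<and> solves_in f N I' w' \<and>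
        (\<forall>\<xi>\<in>I. w' \<xi> = w \<xi>) \<longrightarrow> I' = I) \<and>
     (w \<longlongrightarrow> p) at_top \<and> \<Gamma> = w ` I)"

text \<open>Tangency at an end point \<open>p\<close> that need not belong to \<open>S\<close>. The limit point condition
  excludes the constant trajectory.\<close>

definition tangent_at :: "(real^2) set \<Rightarrow> real^2 \<Rightarrow> (real^2) set \<Rightarrow> bool" where
  "tangent_at S p L \<longleftrightarrow> p islimpt S \<and>
     ((\<lambda>w. infdist w L / dist w p) \<longlongrightarrow> 0) (at p within S)"

text \<open>\<open>M\<close> is an embedded regular open \<open>C\<^sup>1\<close> arc with \<open>p\<close> in its interior and tangent line \<open>L\<close>
  at \<open>p\<close>; its two branches leave \<open>p\<close> in the opposite directions \<open>m' 0\<close> and \<open>- m' 0\<close> of \<open>L\<close>.\<close>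

definition arc_tangent_both_ways :: "(real^2) set \<Rightarrow> real^2 \<Rightarrow> (real^2) set \<Rightarrow> bool" where
  "arc_tangent_both_ways M p L \<longleftrightarrow> (\<exists>m m' h.
     homeomorphism {-1<..<1} M m h \<and>
     (\<forall>s\<in>{-1<..<(1::real)}. (m has_vector_derivative m' s) (at s) \<and> m' s \<noteq> 0) \<and>
     continuous_on {-1<..<1} m' \<and>
     m 0 = p \<and> L = {p + t *\<^sub>R m' 0 | t. True})"

text \<open>One-dimensional local centre-stable manifold of \<open>p\<close>, with respect to the neighbourhood \<open>N\<close>,
  consisting of points whose trajectories converge to \<open>p\<close>. The span is the centre-stable subspace
  whenever the linearisation \<open>A\<close> is diagonalisable over the reals.\<close>

definition center_stable_manifold ::
  "(real^2 \<Rightarrow> real^2) \<Rightarrow> (real^2) set \<Rightarrow> real^2 \<Rightarrow> (real^2) set \<Rightarrow> bool" where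
  "center_stable_manifold f N p M \<longleftrightarrow> M \<subseteq> N \<and>
     (\<exists>A. (f has_derivative (\<lambda>v. A *v v)) (at p) \<and>
        arc_tangent_both_ways M p ((+) p ` span {v. \<exists>l\<le>0. A *v v = l *\<^sub>R v})) \<and>
     (\<forall>w0\<in>M. \<exists>W. connects f w0 p W \<and> W ` {0..} \<subseteq> M)"

text \<open>At Mach number one the kernel of the linearisation is the direction of the line
  \<open>(\<gamma> - 1) up (U - up) + R \<gamma> (\<Theta> - \<theta>p) = 0\<close>, and this is the tangent line of the converging
  trajectory. The line \<open>\<mu> up (U - up) - \<kappa> (\<gamma> - 1) (\<Theta> - \<theta>p) = 0\<close>, which is printed for it in the
  literature, is the eigendirection of the positive eigenvalue. As the next
  lemmas show, no trajectory that converges to the equilibrium as \<open>\<xi>\<close> tends to plus infinity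
  is tangent to that line, so the printed equation is a misprint.\<close>


lemma component_bounds2: "\<bar>(z::real^2)$1\<bar> \<le> norm z" "\<bar>z$2\<bar> \<le> norm z"
  using component_le_norm_cart by blast+

lemma nonneg_of_small_parts: "(A::real) = h + h \<Longrightarrow> \<bar>B\<bar> \<le> h \<Longrightarrow> \<bar>C\<bar> + \<bar>D\<bar> \<le> h \<Longrightarrow> 0 \<le> A + B + (C + D)"
  by linarith

lemma not_attracted_if_repelled:
  fixes w :: "real \<Rightarrow> real^2"
  assumes I: "is_interval I" "\<not> bdd_above I" 
    and w: "\<forall>\<xi>\<in>I. (w has_vector_derivative f (w \<xi>)) (at \<xi>)"
    and lim: "(w \<longlongrightarrow> p) at_top" and r: "r > 0"
    and pos: "\<And>\<xi>. \<xi> \<in> I \<Longrightarrow> dist (w \<xi>) p < r \<Longrightarrow> (w \<xi> - p) \<bullet> f (w \<xi>) \<ge> 0"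
    and x: "\<xi>1 \<in> I"
  shows "w \<xi>1 = p"
proof (rule ccontr)
  assume ne: "w \<xi>1 \<noteq> p"
  define E where "E \<xi> = (w \<xi> - p) \<bullet> (w \<xi> - p)" for \<xi>
  have up: "\<xi> \<in> I" if "\<xi> \<ge> \<xi>1" for \<xi>
  proof -
    obtain b where "b \<in> I" "b > \<xi>" using I(2) unfolding bdd_above_def by (meson not_le)
    then show ?thesis using I(1) x that unfolding is_interval_1 by (meson less_imp_le)
  qed
  have dE: "(E has_real_derivative 2 * ((w \<xi> - p) \<bullet> f (w \<xi>))) (at \<xi>)" if "\<xi> \<ge> \<xi>1" for \<xi>
  proof -
    have "(w has_derivative (\<lambda>h. h *\<^sub>R f (w \<xi>))) (at \<xi>)"
      using w up[OF that] by (auto simp: has_vector_derivative_def)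
    then have "((\<lambda>s. w s - p) has_derivative (\<lambda>h. h *\<^sub>R f (w \<xi>))) (at \<xi>)"
      by (auto intro!: derivative_eq_intros)
    from has_derivative_inner[OF this this] show ?thesis
      unfolding E_def[abs_def] has_field_derivative_def
      by (rule has_derivative_eq_rhs) (auto simp: fun_eq_iff inner_commute)
  qed
  have E1: "E \<xi>1 > 0" using ne by (simp add: E_def)
  define m where "m = min (E \<xi>1) (r^2)"
  have m: "m > 0" "m \<le> E \<xi>1" "m \<le> r^2" using E1 r by (auto simp: m_def)
  have "(E \<longlongrightarrow> (p - p) \<bullet> (p - p)) at_top"
    unfolding E_def[abs_def] by (intro tendsto_intros lim)
  then have "(E \<longlongrightarrow> 0) at_top" by simp
  then have "eventually (\<lambda>\<xi>. E \<xi> < m) at_top" using m(1) by (rule order_tendstoD(2))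
  then obtain T0 where T0: "\<And>s. s \<ge> T0 \<Longrightarrow> E s < m" by (auto simp: eventually_at_top_linorder)
  define T where "T = max T0 (\<xi>1 + 1)"
  have T: "T > \<xi>1" "E T < m" using T0 by (auto simp: T_def)
  define S where "S = {s\<in>{\<xi>1..T}. E s \<ge> m}"
  have cont: "continuous_on {\<xi>1..T} E"
    by (intro continuous_at_imp_continuous_on ballI) (meson DERIV_isCont dE atLeastAtMost_iff)
  have "compact S"
  proof -
    have "S = {\<xi>1..T} \<inter> E -` {m..}" by (auto simp: S_def)
    then have "closed S" using continuous_on_closed_vimage[of "{\<xi>1..T}" E] cont 
      by (metis closed_atLeast closed_atLeastAtMost inf_commute)
    moreover have "bounded S" by (rule bounded_subset[of "{\<xi>1..T}"]) (auto simp: S_def)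
    ultimately show ?thesis by (simp add: compact_eq_bounded_closed)
  qed
  moreover have "\<xi>1 \<in> S" using m T by (auto simp: S_def)
  ultimately obtain t where t: "t \<in> S" "\<forall>s\<in>S. s \<le> t" 
    using compact_attains_sup by (metis empty_iff)
  have tT: "\<xi>1 \<le> t" "t < T" "E t \<ge> m" using t T unfolding S_def by force+
  have "E t \<le> E T"
  proof (rule DERIV_nonneg_imp_increasing_open[of t T E])
    fix s assume s: "t < s" "s < T"
    then have "s \<notin> S" using t by force
    then have "E s < m" using s tT by (auto simp: S_def)
    then have "(norm (w s - p))^2 < r^2" using m unfolding E_def by (simp add: dot_square_norm)
    then have "dist (w s) p < r" using r by (simp add: dist_norm power_less_imp_less_base)
    then show "\<exists>y. (E has_real_derivative y) (at s) \<and> 0 \<le> y"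
      using pos[of s] up[of s] dE[of s] s tT by fastforce
  next
    show "continuous_on {t..T} E" using cont tT by (auto elim: continuous_on_subset)
  qed (use tT in simp)
  with tT T show False by simp
qed

lemma transonic_unstable_line_not_tangent:
  fixes R \<gamma> \<mu> \<kappa> up \<theta>p :: real
  assumes pos: "R > 0" "\<gamma> > 1" "\<mu> > 0" "\<kappa> > 0" "\<theta>p > 0" "up > 0"
    and M: "mach R \<gamma> up \<theta>p = 1"
    and tr: "converging_trajectory (red_field R \<gamma> \<mu> \<kappa> up \<theta>p) N (pt up \<theta>p) \<Gamma>"
    and tan: "tangent_at \<Gamma> (pt up \<theta>p)
       {w. \<mu> * up * (w$1 - up) - \<kappa> * (\<gamma> - 1) * (w$2 - \<theta>p) = 0}"
  shows False
proof -
  define p where "p = pt up \<theta>p"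
  define f where "f = red_field R \<gamma> \<mu> \<kappa> up \<theta>p"
  define L where "L = {w::real^2. \<mu> * up * (w$1 - up) - \<kappa> * (\<gamma> - 1) * (w$2 - \<theta>p) = 0}"
  have X: "R * \<gamma> * \<theta>p > 0" using pos by (intro mult_pos_pos) auto
  then have "sqrt (R * \<gamma> * \<theta>p) > 0" by simp
  then have "sqrt (R * \<gamma> * \<theta>p) = up" using M pos unfolding mach_def by (simp only: abs_of_pos) (simp add: divide_eq_1_iff)
  then have u2: "up^2 = R * \<gamma> * \<theta>p"
    using X by (metis less_imp_le real_sqrt_pow2)
  define q where "q w = \<mu> * up * (w$1 - up) - \<kappa> * (\<gamma> - 1) * (w$2 - \<theta>p)" for w :: "real^2"
  define K where "K = \<mu> * up + \<kappa> * (\<gamma> - 1)"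
  have K: "K > 0" using pos by (simp add: K_def add_pos_pos)
  have qL: "\<bar>q w\<bar> \<le> K * infdist w L" for w
  proof -
    have "p \<in> L" by (simp add: L_def p_def vector_2)
    then have ne: "L \<noteq> {}" by auto
    have "\<bar>q w\<bar> / K \<le> dist w l" if "l \<in> L" for l
    proof -
      have "q w = q w - q l" using that by (simp add: q_def L_def)
      also have "\<dots> = \<mu> * up * (w - l)$1 - \<kappa> * (\<gamma> - 1) * (w - l)$2"
        by (simp add: q_def algebra_simps)
      finally have "\<bar>q w\<bar> \<le> \<bar>\<mu> * up * (w - l)$1\<bar> + \<bar>\<kappa> * (\<gamma> - 1) * (w - l)$2\<bar>" by linarith
      also have "\<dots> \<le> \<mu> * up * norm (w - l) + \<kappa> * (\<gamma> - 1) * norm (w - l)"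
        unfolding abs_mult using pos component_bounds2[of "w - l"] by (intro add_mono mult_mono) auto
      finally show ?thesis using K by (simp add: K_def dist_norm field_simps)
    qed
    then have "\<bar>q w\<bar> / K \<le> infdist w L"
      using ne unfolding infdist_notempty[OF ne] by (intro cINF_greatest)
    then show ?thesis using K by (simp add: field_simps)
  qed
  define l where "l = (up\<^sup>2 - R * \<theta>p) / (\<mu> * up) + R * up / (\<kappa> * (\<gamma> - 1))"
  define e where "e = ((up\<^sup>2 - R * \<theta>p) / (\<mu> * up)) / (R / \<mu>)"
  define s where "s = R / (\<mu> * \<kappa> * (\<gamma> - 1))"
  have u2p: "up\<^sup>2 - R * \<theta>p = R * \<theta>p * (\<gamma> - 1)" using u2 by (simp add: algebra_simps)
  have l0: "l > 0" "e > 0" "s > 0" unfolding l_def e_def s_def u2p using pos by (auto intro!: add_pos_pos divide_pos_pos mult_pos_pos)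
  define e1 where "e1 = R * \<theta>p / (\<kappa> * up) - up / (2 * \<kappa>)"
  define e2 where "e2 = R / (\<kappa> * (\<gamma> - 1))"
  define G where "G = 1/\<mu> + \<bar>e1\<bar> + e2 + 1 / (2 * \<kappa>)"
  have "e2 > 0" "1/\<mu> > 0" "1/(2*\<kappa>) > 0" using pos by (auto simp: e2_def)
  then have G: "G > 0" "e2 > 0" unfolding G_def by linarith+
  have id: "(w - p) \<bullet> f w = l * (norm (w-p))\<^sup>2 + s * q w * (e * (w-p)$2 - (w-p)$1)
     + ((w-p)$1 * (1/\<mu> * ((w-p)$1)\<^sup>2) + (w-p)$2 * (e1 * ((w-p)$1)\<^sup>2 + e2 * (w-p)$1 * (w-p)$2 - 1/(2*\<kappa>) * ((w-p)$1)^3))"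
    for w
  proof -
    define x where "x = (w - p)$1"
    define y where "y = (w - p)$2"
    have xy: "w$1 - up = x" "w$2 - \<theta>p = y" by (auto simp: x_def y_def p_def vector_2)
    have F: "f w $ 1 = (up\<^sup>2 - R * \<theta>p) / (\<mu> * up) * x + R / \<mu> * y + 1/\<mu> * x\<^sup>2"
      "f w $ 2 = R * \<theta>p / \<kappa> * x + R * up / (\<kappa> * (\<gamma> - 1)) * y + (e1 * x\<^sup>2 + e2 * x * y - 1/(2*\<kappa>) * x^3)"
      unfolding f_def red_field_def red_J_def red_F_def p_def[symmetric] x_def y_def e1_def e2_def
      by (simp_all add: matrix_vector_mult_def sum_2 vector_2)
    have nn: "(norm (w-p))\<^sup>2 = x\<^sup>2 + y\<^sup>2"
      unfolding x_def y_def by (simp add: norm_eq_sqrt_inner inner_vec_def sum_2 power2_eq_square)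
    have A: "x * ((up\<^sup>2 - R * \<theta>p) / (\<mu> * up) * x + R / \<mu> * y) + y * (R * \<theta>p / \<kappa> * x + R * up / (\<kappa> * (\<gamma> - 1)) * y)
        = l * (x\<^sup>2 + y\<^sup>2) + s * (\<mu> * up * x - \<kappa> * (\<gamma> - 1) * y) * (e * y - x)"
    proof -
      have g: "\<gamma> - 1 > 0" using pos by simp
      define g where "g = \<gamma> - 1"
      have g0: "g > 0" using g by (simp add: g_def)
      have sq: "s * (\<mu> * up * x - \<kappa> * (\<gamma> - 1) * y) = R * up / (\<kappa> * g) * x - R / \<mu> * y"
        using pos g0 unfolding s_def g_def[symmetric] by (simp add: field_simps)
      have ee: "R / \<mu> * e = (up\<^sup>2 - R * \<theta>p) / (\<mu> * up)" unfolding e_def using pos by simp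
      have cc: "R * up / (\<kappa> * g) * e = R * \<theta>p / \<kappa>"
        unfolding e_def u2p g_def[symmetric] using pos g0 by (simp add: field_simps)
      have gen1: "lx + (P * x - Q * y) * (e * y - x) = lx + (P * e) * x * y - P * x\<^sup>2 - (Q * e) * y\<^sup>2 + Q * x * y" for lx P Q
        by (simp add: algebra_simps power2_eq_square)
      have gen2: "(a + d) * (x\<^sup>2 + y\<^sup>2) + c * x * y - d * x\<^sup>2 - a * y\<^sup>2 + b * x * y = x * (a * x + b * y) + y * (c * x + d * y)" for a b c d
        by (simp add: algebra_simps power2_eq_square)
      have "l * (x\<^sup>2 + y\<^sup>2) + (R * up / (\<kappa> * g) * x - R / \<mu> * y) * (e * y - x)
        = l * (x\<^sup>2 + y\<^sup>2) + (R * up / (\<kappa> * g) * e) * x * y - R * up / (\<kappa> * g) * x\<^sup>2 - (R/\<mu> * e) * y\<^sup>2 + R/\<mu> * x * y"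
        by (rule gen1)
      also have "\<dots> = x * ((up\<^sup>2 - R * \<theta>p) / (\<mu> * up) * x + R / \<mu> * y) + y * (R * \<theta>p / \<kappa> * x + R * up / (\<kappa> * g) * y)"
        unfolding ee cc l_def g_def[symmetric] by (rule gen2)
      finally show ?thesis unfolding sq g_def by simp
    qed
    have "(w - p) \<bullet> f w = x * (f w $ 1) + y * (f w $ 2)"
      by (simp add: inner_vec_def sum_2 x_def y_def)
    also have "\<dots> = (x * ((up\<^sup>2 - R * \<theta>p) / (\<mu> * up) * x + R / \<mu> * y) + y * (R * \<theta>p / \<kappa> * x + R * up / (\<kappa> * (\<gamma> - 1)) * y))
       + (x * (1/\<mu> * x\<^sup>2) + y * (e1 * x\<^sup>2 + e2 * x * y - 1/(2*\<kappa>) * x^3))"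
      unfolding F by (simp only: distrib_left add.assoc add.left_commute add.commute)
    finally show ?thesis unfolding nn q_def xy x_def[symmetric] y_def[symmetric]
      using A by simp
  qed
  define \<eta> where "\<eta> = l / (2 * s * K * (1 + e))"
  have \<eta>: "\<eta> > 0" using l0 K by (simp add: \<eta>_def)
  have "((\<lambda>w. infdist w L / dist w p) \<longlongrightarrow> 0) (at p within \<Gamma>)"
    using tan unfolding tangent_at_def L_def p_def by auto
  then have "eventually (\<lambda>w. infdist w L / dist w p < \<eta>) (at p within \<Gamma>)"
    using \<eta> by (rule order_tendstoD(2))
  then obtain r0 where r0: "r0 > 0" 
    "\<And>w. w \<in> \<Gamma> \<Longrightarrow> w \<noteq> p \<Longrightarrow> dist w p < r0 \<Longrightarrow> infdist w L / dist w p < \<eta>"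
    unfolding eventually_at by (metis dist_nz)
  define r where "r = min r0 (min 1 (l / (2 * G)))"
  have r: "r > 0" using r0 l0 G by (simp add: r_def)
  have key: "(w - p) \<bullet> f w \<ge> 0" if w: "w \<in> \<Gamma>" "dist w p < r" for w
  proof (cases "w = p")
    case True then show ?thesis by simp
  next
    case False
    define n where "n = norm (w - p)"
    have n: "n > 0" "n < r0" "n < 1" "n < l / (2 * G)" 
      using False w by (auto simp: n_def r_def dist_norm)
    define x where "x = (w - p)$1"
    define y where "y = (w - p)$2"
    have xy: "\<bar>x\<bar> \<le> n" "\<bar>y\<bar> \<le> n" using component_bounds2[of "w - p"] by (auto simp: x_def y_def n_def)
    have "infdist w L < \<eta> * n" using r0(2)[OF w(1) False] n by (simp add: n_def dist_norm field_simps)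
    then have qb: "\<bar>q w\<bar> \<le> K * (\<eta> * n)" using qL[of w] K by (smt (verit) mult_left_mono)
    have "\<bar>s * q w * (e * y - x)\<bar> \<le> s * (K * (\<eta> * n)) * ((1 + e) * n)"
    proof -
      have "\<bar>e * y - x\<bar> \<le> e * \<bar>y\<bar> + \<bar>x\<bar>" using l0 by (metis abs_mult abs_of_pos abs_triangle_ineq4)
      also have "\<dots> \<le> e * n + n" using xy l0 by (intro add_mono mult_left_mono) auto
      finally have "\<bar>e * y - x\<bar> \<le> (1 + e) * n" by (simp add: algebra_simps)
      then show ?thesis unfolding abs_mult using qb l0 K \<eta> n by (intro mult_mono) auto
    qed
    also have "\<dots> = (\<eta> * (2 * s * K * (1 + e))) / 2 * n\<^sup>2" by (simp add: power2_eq_square algebra_simps)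
    also have "\<eta> * (2 * s * K * (1 + e)) = l" using l0 K unfolding \<eta>_def by simp
    finally have b1: "\<bar>s * q w * (e * y - x)\<bar> \<le> l / 2 * n\<^sup>2" .
    have x2: "\<bar>x\<^sup>2\<bar> \<le> n\<^sup>2" using xy by (simp add: abs_le_square_iff[symmetric])
    have x3: "\<bar>x^3\<bar> \<le> n\<^sup>2"
    proof -
      have "\<bar>x^3\<bar> \<le> n^3" unfolding power_abs using xy by (intro power_mono) auto
      also have "\<dots> \<le> n\<^sup>2" using n by (intro power_decreasing) auto
      finally show ?thesis .
    qed
    have xyb: "\<bar>x * y\<bar> \<le> n\<^sup>2" unfolding abs_mult power2_eq_square using xy by (intro mult_mono) auto
    have t1: "\<bar>1/\<mu> * x\<^sup>2\<bar> \<le> 1/\<mu> * n\<^sup>2" unfolding abs_mult using x2 pos by (intro mult_mono) auto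
    have t2: "\<bar>e1 * x\<^sup>2\<bar> \<le> \<bar>e1\<bar> * n\<^sup>2" unfolding abs_mult using x2 by (intro mult_left_mono) auto
    have t3: "\<bar>e2 * x * y\<bar> \<le> e2 * n\<^sup>2" 
      using mult_left_mono[OF xyb, of e2] G by (simp add: abs_mult mult.assoc)
    have t4: "\<bar>1/(2*\<kappa>) * x^3\<bar> \<le> 1/(2*\<kappa>) * n\<^sup>2" unfolding abs_mult using x3 pos by (intro mult_mono) auto
    have "\<bar>e1 * x\<^sup>2 + e2 * x * y - 1/(2*\<kappa>) * x^3\<bar> \<le> (\<bar>e1\<bar> + e2 + 1/(2*\<kappa>)) * n\<^sup>2"
      using t2 t3 t4 unfolding distrib_right by linarith
    then have c2: "\<bar>y * (e1 * x\<^sup>2 + e2 * x * y - 1/(2*\<kappa>) * x^3)\<bar> \<le> n * ((\<bar>e1\<bar> + e2 + 1/(2*\<kappa>)) * n\<^sup>2)"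
      unfolding abs_mult[of y] using xy n by (intro mult_mono) auto
    have c1: "\<bar>x * (1/\<mu> * x\<^sup>2)\<bar> \<le> n * (1/\<mu> * n\<^sup>2)"
      unfolding abs_mult[of x] using xy n t1 by (intro mult_mono) auto
    have "n * (1/\<mu> * n\<^sup>2) + n * ((\<bar>e1\<bar> + e2 + 1/(2*\<kappa>)) * n\<^sup>2) = (G * n) * n\<^sup>2"
      by (simp add: G_def algebra_simps)
    also have "\<dots> \<le> l / 2 * n\<^sup>2" using n G by (intro mult_right_mono) (auto simp: field_simps)
    finally have b2: "\<bar>x * (1/\<mu> * x\<^sup>2)\<bar> + \<bar>y * (e1 * x\<^sup>2 + e2 * x * y - 1/(2*\<kappa>) * x^3)\<bar> \<le> l / 2 * n\<^sup>2"
      using c1 c2 by linarith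
    have "l * n\<^sup>2 = l / 2 * n\<^sup>2 + l / 2 * n\<^sup>2" by simp
    then show ?thesis unfolding id[of w] x_def[symmetric] y_def[symmetric] n_def[symmetric]
      using b1 b2 by (rule nonneg_of_small_parts)
  qed
  obtain I w where w: "is_interval I" "\<not> bdd_above I" "solves_in f N I w" "(w \<longlongrightarrow> p) at_top" "\<Gamma> = w ` I"
    using tr unfolding converging_trajectory_def f_def[symmetric] p_def[symmetric] by auto
  have "w \<xi> = p" if "\<xi> \<in> I" for \<xi>
    by (rule not_attracted_if_repelled[of I w f p r \<xi>]) (use w r key that in \<open>auto simp: solves_in_def\<close>)
  then have "\<Gamma> \<subseteq> {p}" using w by auto
  moreover have "p islimpt \<Gamma>" using tan unfolding tangent_at_def p_def by auto
  ultimately show False by (meson islimpt_subset islimpt_finite finite.intros)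
qed

end

theory Submission
  imports Defs "HOL-Library.Landau_Symbols"
begin

text \<open>Integrating the boundary layer problem once and using that the derivative of a converging
  function can only converge to 0 yields the reduced planar system. In the supersonic case a
  weighted square norm increases along orbits near the equilibrium, so that nothing but the
  equilibrium converges to it. Otherwise the linear part has eigenvalues \<open>l2 \<le> 0 < l1\<close>; in the
  eigencoordinates \<open>(y, z)\<close> a Lyapunov-Perron fixed point produces, for each \<open>y\<close>, one orbit with
  bounded \<open>z\<close>, and the growth of \<open>z\<^sup>2 - m\<^sup>2 y\<^sup>2\<close> along differences of solutions shows that all orbits
  staying near the equilibrium lie on one Lipschitz graph \<open>z = h(y)\<close>, with \<open>h(y) = O(y\<^sup>2)\<close>. On the graph
  the flow is scalar. For \<open>l2 < 0\<close> it decays exponentially on both sides, and inverting \<open>y(t)\<close>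
  shows that \<open>h\<close> is continuously differentiable. For \<open>l2 = 0\<close> it behaves like \<open>y' = beta y\<^sup>2\<close> with
  \<open>beta > 0\<close>, so exactly one side converges, at the rate \<open>1 / t\<close>, and its orbit is the trajectory
  \<open>\<Gamma>\<close>; time shifts of this one orbit make all constants uniform.\<close>

section \<open>Differential inequalities, uniqueness and polynomial fields\<close>

text \<open>What shapes the proof is that the field is only locally Lipschitz and that, at Mach
  number one, it attracts only from one side and only at an algebraic rate. Clamping the arguments
  of the nonlinearity gives global Lipschitz bounds; a clamped solution solves the true system as
  long as it stays in the box, and this is shown on the sides where the modulus of y decreases. The
  fixed point is sought with the weight exp(k t / 2), because for l2 = 0 the centre component of the
  clamped system may grow. The cone slope m is a parameter because the transonic case must keep an
  error of size m y^2 in y' below the leading term beta y^2; in the subsonic case the slope 1 is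
  enough. All derivatives of a solution are polynomials in the state that vanish at the equilibrium,
  because the field is polynomial. Under exponential decay this settles every order at once; under
  algebraic decay the n-th derivative has to gain n powers of 1 / t, which requires the
  differentiated system.\<close>

lemma exp_growth_mono:
  fixes D :: "real \<Rightarrow> real"
  assumes ab: "a \<le> b" and cont: "continuous_on {a..b} D"
    and der: "\<And>t. a < t \<Longrightarrow> t < b \<Longrightarrow> (D has_real_derivative D' t) (at t)"
    and grow: "\<And>t. a < t \<Longrightarrow> t < b \<Longrightarrow> c * D t \<le> D' t"
  shows "exp (- (c * a)) * D a \<le> exp (- (c * b)) * D b"
proof (rule DERIV_nonneg_imp_increasing_open[OF ab])
  fix t assume t: "a < t" "t < b"
  have "((\<lambda>t. exp (- (c * t)) * D t) has_real_derivative exp (- (c * t)) * (D' t - c * D t)) (at t)"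
    using der[OF t] by (auto intro!: derivative_eq_intros simp: algebra_simps)
  moreover have "0 \<le> exp (- (c * t)) * (D' t - c * D t)" using grow[OF t] by simp
  ultimately show "\<exists>y. ((\<lambda>t. exp (- (c * t)) * D t) has_real_derivative y) (at t) \<and> 0 \<le> y" by blast
qed (intro continuous_intros cont)

text \<open>The squares of differences of solutions, cone functions \<open>z\<^sup>2 - m\<^sup>2 y\<^sup>2\<close> and \<open>z - K y\<^sup>2\<close> are
  all controlled in this way.\<close>

lemma bounded_exp_growth_nonpos:
  fixes D :: "real \<Rightarrow> real"
  assumes k: "0 < k" and cont: "continuous_on {a..} D"
    and der: "\<And>t. a < t \<Longrightarrow> (D has_real_derivative D' t) (at t)"
    and grow: "\<And>t. a < t \<Longrightarrow> k * D t \<le> D' t"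
    and bd: "\<And>t. a \<le> t \<Longrightarrow> D t \<le> C"
  shows "D a \<le> 0"
proof -
  have le: "D a \<le> exp (- (k * (t - a))) * C" if t: "a \<le> t" for t
  proof -
    have "exp (- (k * a)) * D a \<le> exp (- (k * t)) * D t"
      by (rule exp_growth_mono[OF t]) (auto intro!: der grow continuous_on_subset[OF cont])
    also have "\<dots> \<le> exp (- (k * t)) * C" using bd[OF t] by simp
    finally have "exp (k * a) * (exp (- (k * a)) * D a) \<le> exp (k * a) * (exp (- (k * t)) * C)" by simp
    then show ?thesis unfolding mult.assoc[symmetric] exp_add[symmetric] by (simp add: algebra_simps)
  qed
  have "filterlim (\<lambda>t. k * (t - a)) at_top at_top"
    using k by (intro filterlim_tendsto_pos_mult_at_top[OF tendsto_const k]
      filterlim_at_top_mono[OF filterlim_tendsto_add_at_top[OF tendsto_const[of "-a"] filterlim_ident]]) auto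
  then have "((\<lambda>t. exp (- (k * (t - a)))) \<longlongrightarrow> 0) at_top"
    by (intro filterlim_compose[OF exp_at_bot]) (simp add: filterlim_uminus_at_bot)
  then have "((\<lambda>t. exp (- (k * (t - a))) * C) \<longlongrightarrow> 0 * C) at_top" by (intro tendsto_intros)
  then show ?thesis
    by (intro tendsto_lowerbound[where f="\<lambda>t. exp (- (k * (t - a))) * C" and F=at_top])
      (auto simp: eventually_at_top_linorder intro!: exI[of _ a] le)
qed

lemma sq_dist_deriv:
  fixes w v :: "real \<Rightarrow> 'a::real_inner"
  assumes "(w has_vector_derivative x) (at t)" "(v has_vector_derivative y) (at t)"
  shows "((\<lambda>s. (norm (w s - v s))\<^sup>2) has_real_derivative 2 * ((w t - v t) \<bullet> (x - y))) (at t)"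
proof -
  have "((\<lambda>s. w s - v s) has_derivative (\<lambda>h. h *\<^sub>R (x - y))) (at t)"
    using has_vector_derivative_diff[OF assms] by (simp add: has_vector_derivative_def)
  from has_derivative_inner[OF this this] show ?thesis
    unfolding has_field_derivative_def power2_norm_eq_inner
    by (rule has_derivative_eq_rhs) (auto simp: fun_eq_iff inner_commute)
qed

lemma lipschitz_inner_bound:
  fixes f :: "'a::real_inner \<Rightarrow> 'a"
  assumes "L-lipschitz_on S f" "x \<in> S" "y \<in> S"
  shows "\<bar>2 * ((x - y) \<bullet> (f x - f y))\<bar> \<le> 2 * L * (norm (x - y))\<^sup>2"
proof -
  have "\<bar>(x - y) \<bullet> (f x - f y)\<bar> \<le> norm (x - y) * norm (f x - f y)" by (rule Cauchy_Schwarz_ineq2)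
  also have "\<dots> \<le> norm (x - y) * (L * norm (x - y))"
    using lipschitz_onD[OF assms] by (intro mult_left_mono) (auto simp: dist_norm)
  finally show ?thesis by (simp add: power2_eq_square abs_mult algebra_simps)
qed

text \<open>Gronwall in the sign convention of \<open>exp_growth_mono\<close>: the squared distance
  grows at rate at most 2 L, so its negative satisfies the growth hypothesis. Derivatives are asked
  for in the open interval only, because \<open>connects\<close> supplies none at 0.\<close>

lemma ode_unique_forward:
  fixes f :: "'a::real_inner \<Rightarrow> 'a"
  assumes L: "L-lipschitz_on S f" and ab: "a \<le> b"
    and cont: "continuous_on {a..b} w" "continuous_on {a..b} v"
    and der: "\<And>t. a < t \<Longrightarrow> t < b \<Longrightarrow> (w has_vector_derivative f (w t)) (at t)"
      "\<And>t. a < t \<Longrightarrow> t < b \<Longrightarrow> (v has_vector_derivative f (v t)) (at t)"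
    and S: "\<And>t. a < t \<Longrightarrow> t < b \<Longrightarrow> w t \<in> S \<and> v t \<in> S"
    and eq: "w a = v a"
  shows "w b = v b"
proof -
  have "exp (- (2 * L * a)) * - (norm (w a - v a))\<^sup>2 \<le> exp (- (2 * L * b)) * - (norm (w b - v b))\<^sup>2"
  proof (rule exp_growth_mono[OF ab])
    fix t assume t: "a < t" "t < b"
    show "((\<lambda>s. - (norm (w s - v s))\<^sup>2) has_real_derivative - (2 * ((w t - v t) \<bullet> (f (w t) - f (v t))))) (at t)"
      by (intro DERIV_minus sq_dist_deriv der t)
    show "2 * L * - (norm (w t - v t))\<^sup>2 \<le> - (2 * ((w t - v t) \<bullet> (f (w t) - f (v t))))"
      using lipschitz_inner_bound[OF L, of "w t" "v t"] S[OF t] by simp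
  qed (intro continuous_intros cont)
  with eq show ?thesis by (simp add: mult_le_0_iff)
qed

text \<open>The other half of the same estimate: the squared distance cannot shrink faster than at
  rate 2 L, so it cannot reach 0 in finite time.\<close>

lemma ode_unique_backward:
  fixes f :: "'a::real_inner \<Rightarrow> 'a"
  assumes L: "L-lipschitz_on S f" and ab: "a \<le> b"
    and cont: "continuous_on {a..b} w" "continuous_on {a..b} v"
    and der: "\<And>t. a < t \<Longrightarrow> t < b \<Longrightarrow> (w has_vector_derivative f (w t)) (at t)"
      "\<And>t. a < t \<Longrightarrow> t < b \<Longrightarrow> (v has_vector_derivative f (v t)) (at t)"
    and S: "\<And>t. a < t \<Longrightarrow> t < b \<Longrightarrow> w t \<in> S \<and> v t \<in> S"
    and eq: "w b = v b"
  shows "w a = v a"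
proof -
  have "exp (- (- 2 * L * a)) * (norm (w a - v a))\<^sup>2 \<le> exp (- (- 2 * L * b)) * (norm (w b - v b))\<^sup>2"
  proof (rule exp_growth_mono[OF ab])
    fix t assume t: "a < t" "t < b"
    show "((\<lambda>s. (norm (w s - v s))\<^sup>2) has_real_derivative 2 * ((w t - v t) \<bullet> (f (w t) - f (v t)))) (at t)"
      by (intro sq_dist_deriv der t)
    show "- 2 * L * (norm (w t - v t))\<^sup>2 \<le> 2 * ((w t - v t) \<bullet> (f (w t) - f (v t)))"
      using lipschitz_inner_bound[OF L, of "w t" "v t"] S[OF t] by simp
  qed (intro continuous_intros cont)
  with eq show ?thesis by (simp add: mult_le_0_iff)
qed

section \<open>Polynomial fields: Lipschitz bounds on bounded sets and iterated time
  derivatives\<close>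

lemma lipschitz_on_imp_bounded_image:
  fixes f :: "'a::euclidean_space \<Rightarrow> 'b::euclidean_space"
  assumes "L-lipschitz_on S f" "bounded S"
  shows "bounded (f ` S)"
  by (rule bounded_uniformly_continuous_image[OF lipschitz_on_uniformly_continuous[OF assms(1)] assms(2)])

text \<open>Boundedness of S enters in the product case: a Lipschitz function on a bounded set is
  bounded, which controls the two factors in the product rule for differences.\<close>

lemma real_polynomial_function_lipschitz:
  fixes q :: "'a::euclidean_space \<Rightarrow> real"
  assumes "real_polynomial_function q" and S: "bounded S"
  shows "\<exists>L. L-lipschitz_on S q"
  using assms(1)
proof (induction rule: real_polynomial_function.induct)
  case (linear f)
  then obtain L where "L-lipschitz_on UNIV f" using bounded_linear.lipschitz_boundE by blast
  then show ?case by (meson lipschitz_on_subset subset_UNIV)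
next
  case (const c)
  show ?case by (rule exI[of _ 0]) (simp add: lipschitz_on_def)
next
  case (add f g)
  then obtain L M where "L-lipschitz_on S f" "M-lipschitz_on S g" by blast
  then have "(L + M)-lipschitz_on S (\<lambda>x. f x + g x)" by (rule lipschitz_on_add)
  then show ?case by (rule exI)
next
  case (mult f g)
  then obtain L M where L: "L-lipschitz_on S f" and M: "M-lipschitz_on S g" by blast
  obtain a where a: "\<And>x. x \<in> S \<Longrightarrow> \<bar>f x\<bar> \<le> a"
    using lipschitz_on_imp_bounded_image[OF L S] unfolding bounded_iff real_norm_def by blast
  obtain b where b: "\<And>x. x \<in> S \<Longrightarrow> \<bar>g x\<bar> \<le> b"
    using lipschitz_on_imp_bounded_image[OF M S] unfolding bounded_iff real_norm_def by blast
  have "(\<bar>a\<bar> * M + \<bar>b\<bar> * L)-lipschitz_on S (\<lambda>x. f x * g x)"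
  proof (rule lipschitz_onI)
    fix x y assume xy: "x \<in> S" "y \<in> S"
    have eq: "f x * g x - f y * g y = f x * (g x - g y) + g y * (f x - f y)" by (simp add: algebra_simps)
    have "dist (f x * g x) (f y * g y) \<le> \<bar>f x\<bar> * dist (g x) (g y) + \<bar>g y\<bar> * dist (f x) (f y)"
      unfolding dist_real_def eq
      using abs_triangle_ineq[of "f x * (g x - g y)" "g y * (f x - f y)"] by (simp add: abs_mult)
    also have "\<dots> \<le> \<bar>a\<bar> * (M * dist x y) + \<bar>b\<bar> * (L * dist x y)"
      by (rule add_mono; rule mult_mono)
        (use a[OF xy(1)] b[OF xy(2)] lipschitz_onD[OF L xy] lipschitz_onD[OF M xy] in \<open>simp_all add: abs_le_iff\<close>)
    finally show "dist (f x * g x) (f y * g y) \<le> (\<bar>a\<bar> * M + \<bar>b\<bar> * L) * dist x y"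
      by (simp add: algebra_simps)
  qed (intro add_nonneg_nonneg mult_nonneg_nonneg abs_ge_zero lipschitz_on_nonneg[OF L] lipschitz_on_nonneg[OF M])
  then show ?case by (rule exI)
qed

lemma polynomial_function_lipschitz:
  fixes f :: "'a::euclidean_space \<Rightarrow> 'b::euclidean_space"
  assumes "polynomial_function f" and S: "bounded S"
  obtains L where "L-lipschitz_on S f"
proof -
  have "\<forall>b\<in>Basis. \<exists>L. L-lipschitz_on S (\<lambda>x. f x \<bullet> b)"
    using assms real_polynomial_function_lipschitz by (auto simp: polynomial_function_iff_Basis_inner)
  then obtain L where L: "\<And>b. b \<in> Basis \<Longrightarrow> (L b)-lipschitz_on S (\<lambda>x. f x \<bullet> b)" by metis
  have "(\<Sum>b\<in>Basis. L b)-lipschitz_on S f"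
  proof (rule lipschitz_onI)
    fix x y assume xy: "x \<in> S" "y \<in> S"
    have "dist (f x) (f y) \<le> (\<Sum>b\<in>Basis. \<bar>(f x - f y) \<bullet> b\<bar>)" unfolding dist_norm by (rule norm_le_l1)
    also have "\<dots> \<le> (\<Sum>b\<in>Basis. L b * dist x y)"
      using lipschitz_onD[OF L xy] by (intro sum_mono) (auto simp: dist_real_def inner_diff_left)
    finally show "dist (f x) (f y) \<le> (\<Sum>b\<in>Basis. L b) * dist x y" by (simp add: sum_distrib_right)
  qed (use lipschitz_on_nonneg[OF L] in \<open>auto intro: sum_nonneg\<close>)
  then show ?thesis by (rule that)
qed

text \<open>q' is the Lie derivative of q along f. It is again polynomial because f is, so the step
  can be iterated. The filter \<open>at t within S\<close> is kept general to cover the one-sided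
  derivative at the end point 0.\<close>

lemma real_polynomial_function_lie_derivative:
  fixes f :: "'a::euclidean_space \<Rightarrow> 'a"
  assumes f: "polynomial_function f" and q: "real_polynomial_function q"
  shows "\<exists>q'. real_polynomial_function q' \<and>
    (\<forall>W t S. (W has_vector_derivative f (W t)) (at t within S) \<longrightarrow>
       ((\<lambda>s. q (W s)) has_real_derivative q' (W t)) (at t within S))"
  using q
proof (induction rule: real_polynomial_function.induct)
  case (linear g)
  then have "real_polynomial_function (g \<circ> f)" using f by (auto simp: polynomial_function_def)
  moreover have "((\<lambda>s. g (W s)) has_real_derivative (g \<circ> f) (W t)) (at t within S)"
    if "(W has_vector_derivative f (W t)) (at t within S)" for W t S
    using bounded_linear.has_vector_derivative[OF linear that]
    by (simp add: has_real_derivative_iff_has_vector_derivative)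
  ultimately show ?case by blast
next
  case (const c)
  show ?case by (rule exI[of _ "\<lambda>x. 0"]) (auto intro: derivative_eq_intros)
next
  case (add g h)
  then obtain g' h' where "real_polynomial_function g'" "real_polynomial_function h'"
    "\<And>W t S. (W has_vector_derivative f (W t)) (at t within S) \<Longrightarrow>
       ((\<lambda>s. g (W s)) has_real_derivative g' (W t)) (at t within S)"
    "\<And>W t S. (W has_vector_derivative f (W t)) (at t within S) \<Longrightarrow>
       ((\<lambda>s. h (W s)) has_real_derivative h' (W t)) (at t within S)"
    by metis
  then show ?case
    by (intro exI[of _ "\<lambda>x. g' x + h' x"]) (auto intro!: real_polynomial_function.intros(3) DERIV_add)
next
  case (mult g h)
  then obtain g' h' where "real_polynomial_function g'" "real_polynomial_function h'"
    "\<And>W t S. (W has_vector_derivative f (W t)) (at t within S) \<Longrightarrow>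
       ((\<lambda>s. g (W s)) has_real_derivative g' (W t)) (at t within S)"
    "\<And>W t S. (W has_vector_derivative f (W t)) (at t within S) \<Longrightarrow>
       ((\<lambda>s. h (W s)) has_real_derivative h' (W t)) (at t within S)"
    by metis
  then show ?case using mult.hyps
    by (intro exI[of _ "\<lambda>x. g x * h' x + g' x * h x"])
      (auto intro!: real_polynomial_function.intros(3,4) DERIV_mult')
qed

lemma polynomial_function_lie_derivative:
  fixes f :: "'a::euclidean_space \<Rightarrow> 'a" and q :: "'a \<Rightarrow> 'b::euclidean_space"
  assumes f: "polynomial_function f" and q: "polynomial_function q"
  shows "\<exists>q'. polynomial_function q' \<and>
    (\<forall>W t S. (W has_vector_derivative f (W t)) (at t within S) \<longrightarrow>
       ((\<lambda>s. q (W s)) has_vector_derivative q' (W t)) (at t within S))"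
proof -
  have "\<forall>b\<in>Basis. \<exists>q'. real_polynomial_function q' \<and>
    (\<forall>W t S. (W has_vector_derivative f (W t)) (at t within S) \<longrightarrow>
       ((\<lambda>s. q (W s) \<bullet> b) has_real_derivative q' (W t)) (at t within S))"
    using q by (intro ballI real_polynomial_function_lie_derivative[OF f]) (auto simp: polynomial_function_iff_Basis_inner)
  then obtain q' where q': "\<And>b. b \<in> Basis \<Longrightarrow> real_polynomial_function (q' b)"
    "\<And>b W t S. b \<in> Basis \<Longrightarrow> (W has_vector_derivative f (W t)) (at t within S) \<Longrightarrow>
       ((\<lambda>s. q (W s) \<bullet> b) has_real_derivative q' b (W t)) (at t within S)"
    by metis
  define Q where "Q x = (\<Sum>b\<in>Basis. q' b x *\<^sub>R b)" for x
  have "polynomial_function Q"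
    unfolding polynomial_function_iff_Basis_inner Q_def using q'(1) by (simp add: inner_sum_left_Basis)
  moreover have "((\<lambda>s. q (W s)) has_vector_derivative Q (W t)) (at t within S)"
    if "(W has_vector_derivative f (W t)) (at t within S)" for W t S
    unfolding has_vector_derivative_def has_derivative_componentwise_within[of "\<lambda>s. q (W s)"]
    using q'(2)[OF _ that] by (auto simp: Q_def has_field_derivative_def inner_sum_left_Basis mult_commute_abs)
  ultimately show ?thesis by blast
qed

text \<open>Provides the witness for \<open>derivs_bounded_by\<close>: with q w = w - p, the n-th
  derivative of W - p is \<open>G n\<close> evaluated along W.\<close>

lemma polynomial_lie_derivatives:
  fixes f :: "'a::euclidean_space \<Rightarrow> 'a" and q :: "'a \<Rightarrow> 'b::euclidean_space"
  assumes f: "polynomial_function f" and q: "polynomial_function q"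
  obtains G where "G 0 = q" "\<And>n. polynomial_function (G n)"
    "\<And>n W t S. (W has_vector_derivative f (W t)) (at t within S) \<Longrightarrow>
       ((\<lambda>s. G n (W s)) has_vector_derivative G (Suc n) (W t)) (at t within S)"
proof -
  obtain G where "\<And>n. polynomial_function (G n) \<and> (n = 0 \<longrightarrow> G n = q)"
    "\<And>n. \<forall>W t S. (W has_vector_derivative f (W t)) (at t within S) \<longrightarrow>
       ((\<lambda>s. G n (W s)) has_vector_derivative G (Suc n) (W t)) (at t within S)"
    using dependent_nat_choice[of "\<lambda>n (g::'a \<Rightarrow> 'b). polynomial_function g \<and> (n = 0 \<longrightarrow> g = q)"
      "\<lambda>n g g'. \<forall>W t S. (W has_vector_derivative f (W t)) (at t within S) \<longrightarrow>
       ((\<lambda>s. g (W s)) has_vector_derivative g' (W t)) (at t within S)"]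
      q polynomial_function_lie_derivative[OF f] by (metis nat.distinct(1))
  then show ?thesis by (intro that[of G]) auto
qed

section \<open>The Lyapunov-Perron fixed point\<close>

lemma integral_has_real_derivative_halfline:
  fixes h :: "real \<Rightarrow> real"
  assumes "continuous_on {0..} h" "0 \<le> t"
  shows "((\<lambda>x. integral {0..x} h) has_real_derivative h t) (at t within {0..})"
proof -
  have "at t within {0..} = at t within {0..t+1}"
    by (rule at_within_nhd[where S="{..<t+1}"]) (use assms(2) in auto)
  moreover have "((\<lambda>x. integral {0..x} h) has_real_derivative h t) (at t within {0..t+1})"
    by (rule integral_has_real_derivative) (use assms in \<open>auto intro: continuous_on_subset\<close>)
  ultimately show ?thesis by simp
qed

lemma has_integral_exp_interval:
  fixes t :: real
  assumes "\<eta> \<noteq> 0" "0 \<le> t"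
  shows "((\<lambda>s. exp (\<eta> * s)) has_integral (exp (\<eta> * t) - 1) / \<eta>) {0..t}"
proof -
  have "((\<lambda>s. exp (\<eta> * s)) has_integral exp (\<eta> * t) / \<eta> - exp (\<eta> * 0) / \<eta>) {0..t}"
    using assms by (intro fundamental_theorem_of_calculus)
      (auto intro!: derivative_eq_intros simp: has_real_derivative_iff_has_vector_derivative[symmetric])
  then show ?thesis by (simp add: diff_divide_distrib)
qed

lemma forward_integral_bound:
  fixes a :: "real \<Rightarrow> real"
  assumes "0 \<le> lam" "0 < \<eta>" "0 \<le> t" "continuous_on {0..} a"
    and a: "\<And>s. 0 \<le> s \<Longrightarrow> \<bar>a s\<bar> \<le> c * exp (\<eta> * s)"
  shows "\<bar>integral {0..t} (\<lambda>s. exp (lam * s) * a s)\<bar> \<le> c / \<eta> * exp ((\<eta> + lam) * t)"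
proof -
  have c0: "0 \<le> c" using a[of 0] by simp
  have int: "((\<lambda>s. (exp (lam * t) * c) * exp (\<eta> * s)) has_integral (exp (lam * t) * c) * ((exp (\<eta> * t) - 1) / \<eta>)) {0..t}"
    by (intro has_integral_mult_right has_integral_exp_interval) (use assms in auto)
  have "norm (integral {0..t} (\<lambda>s. exp (lam * s) * a s)) \<le> integral {0..t} (\<lambda>s. (exp (lam * t) * c) * exp (\<eta> * s))"
  proof (rule integral_norm_bound_integral)
    show "(\<lambda>s. exp (lam * s) * a s) integrable_on {0..t}"
      by (intro integrable_continuous_real continuous_intros continuous_on_subset[OF assms(4)]) auto
    fix s assume s: "s \<in> {0..t}"
    have "exp (lam * s) * \<bar>a s\<bar> \<le> exp (lam * t) * (c * exp (\<eta> * s))"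
      using s assms(1) a[of s] by (intro mult_mono) (auto intro: mult_left_mono)
    then show "norm (exp (lam * s) * a s) \<le> (exp (lam * t) * c) * exp (\<eta> * s)"
      by (simp add: abs_mult algebra_simps)
  qed (use int in blast)
  also have "\<dots> = (exp (lam * t) * c) * ((exp (\<eta> * t) - 1) / \<eta>)" using int by (rule integral_unique)
  also have "\<dots> \<le> (exp (lam * t) * c) * (exp (\<eta> * t) / \<eta>)"
    using c0 assms(2) by (intro mult_left_mono divide_right_mono) auto
  also have "\<dots> = c / \<eta> * exp ((\<eta> + lam) * t)" by (simp add: distrib_right exp_add)
  finally show ?thesis by simp
qed

text \<open>Domination by c exp(- (k - \<eta>) s) gives both the convergence at infinity and the
  bound. It is applied with the weight of the fixed point space and once more with \<eta> =
  0.\<close>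

lemma backward_integral_bound:
  fixes b :: "real \<Rightarrow> real"
  assumes "\<eta> < k" "0 \<le> t" "continuous_on {0..} b"
    and b: "\<And>s. 0 \<le> s \<Longrightarrow> \<bar>b s\<bar> \<le> c * exp (\<eta> * s)"
  shows "(\<lambda>s. exp (- (k * s)) * b s) integrable_on {t..}"
    and "\<bar>integral {t..} (\<lambda>s. exp (- (k * s)) * b s)\<bar> \<le> c / (k - \<eta>) * exp (- ((k - \<eta>) * t))"
proof -
  have int: "((\<lambda>s. c * exp (- (k - \<eta>) * s)) has_integral c * (exp (- (k - \<eta>) * t) / (k - \<eta>))) {t..}"
    by (intro has_integral_mult_right has_integral_exp_minus_to_infinity) (use assms in auto)
  have bd: "norm (exp (- (k * s)) * b s) \<le> c * exp (- (k - \<eta>) * s)" if "s \<in> {t..}" for s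
  proof -
    have "exp (- (k * s)) * \<bar>b s\<bar> \<le> exp (- (k * s)) * (c * exp (\<eta> * s))"
      using that assms(2) by (intro mult_left_mono b) auto
    also have "\<dots> = c * (exp (- (k * s)) * exp (\<eta> * s))" by simp
    also have "\<dots> = c * exp (- (k - \<eta>) * s)" unfolding exp_add[symmetric] by (simp add: algebra_simps)
    finally show ?thesis by (simp add: abs_mult)
  qed
  have "(\<lambda>s. exp (- (k * s)) * b s) \<in> borel_measurable (lebesgue_on {t..})"
    by (intro continuous_imp_measurable_on_sets_lebesgue continuous_intros continuous_on_subset[OF assms(3)])
      (use assms(2) in auto)
  then show i: "(\<lambda>s. exp (- (k * s)) * b s) integrable_on {t..}"
    by (rule measurable_bounded_by_integrable_imp_integrable[OF _ has_integral_integrable[OF int] bd]) auto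
  have "norm (integral {t..} (\<lambda>s. exp (- (k * s)) * b s)) \<le> integral {t..} (\<lambda>s. c * exp (- (k - \<eta>) * s))"
    by (rule integral_norm_bound_integral[OF i has_integral_integrable[OF int] bd])
  also have "\<dots> = c / (k - \<eta>) * exp (- ((k - \<eta>) * t))" unfolding integral_unique[OF int] by (simp add: left_diff_distrib)
  finally show "\<bar>integral {t..} (\<lambda>s. exp (- (k * s)) * b s)\<bar> \<le> c / (k - \<eta>) * exp (- ((k - \<eta>) * t))" by simp
qed

text \<open>The tail integral is a constant minus the integral over an initial interval.\<close>

lemma backward_integral_derivative:
  fixes h :: "real \<Rightarrow> real"
  assumes "continuous_on {0..} h" "0 \<le> t" "\<And>t. 0 \<le> t \<Longrightarrow> h integrable_on {t..}"
  shows "((\<lambda>x. integral {x..} h) has_real_derivative - h t) (at t within {0..})"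
proof -
  have eq: "integral {0..} h - integral {0..x} h = integral {x..} h" if "0 \<le> x" for x
  proof -
    have "h integrable_on {0..x}" using assms(1) by (intro integrable_continuous_real) (auto intro: continuous_on_subset)
    then have "integral ({0..x} \<union> {x..}) h = integral {0..x} h + integral {x..} h"
      by (rule integral_Un) (use assms(3)[OF that] that in \<open>auto simp: Int_def intro: negligible_subset[of "{x}"]\<close>)
    moreover have "{0..x} \<union> {x..} = {0..}" using that by auto
    ultimately show ?thesis by simp
  qed
  have "((\<lambda>x. integral {0..} h - integral {0..x} h) has_real_derivative 0 - h t) (at t within {0..})"
    by (intro DERIV_diff DERIV_const integral_has_real_derivative_halfline assms)
  then have "((\<lambda>x. integral {0..} h - integral {0..x} h) has_real_derivative - h t) (at t within {0..})" by simp
  then show ?thesis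
    by (rule has_field_derivative_transform_within[OF _ zero_less_one]) (use assms(2) eq in auto)
qed

text \<open>Variation of constants with y integrated forward from 0 and z backward from infinity,
  which removes the growing mode exp(k t). In the space weighted with exp(k t / 2) the resulting map
  is a contraction with constant 8 L / k, hence the requirement L \<le> k / 16.\<close>

lemma lyapunov_perron:
  fixes A B :: "real \<Rightarrow> real \<Rightarrow> real"
  assumes lam: "0 \<le> lam" and k: "0 < k" and L: "0 \<le> L" "L \<le> k / 16"
    and A: "\<And>y z y' z'. \<bar>A y z - A y' z'\<bar> \<le> L * (\<bar>y - y'\<bar> + \<bar>z - z'\<bar>)" "A 0 0 = 0"
    and B: "\<And>y z y' z'. \<bar>B y z - B y' z'\<bar> \<le> L * (\<bar>y - y'\<bar> + \<bar>z - z'\<bar>)" "B 0 0 = 0"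
    and M: "\<And>y z. \<bar>B y z\<bar> \<le> M"
  obtains Y Z where "Y 0 = y0"
    "\<And>t. 0 \<le> t \<Longrightarrow> (Y has_real_derivative - lam * Y t + A (Y t) (Z t)) (at t within {0..})"
    "\<And>t. 0 \<le> t \<Longrightarrow> (Z has_real_derivative k * Z t + B (Y t) (Z t)) (at t within {0..})"
    "\<And>t. 0 \<le> t \<Longrightarrow> \<bar>Z t\<bar> \<le> M / k"
proof -
  \<comment> \<open>The weight sits in the middle of the gap between the rates 0 and k, so the
    forward and the backward integral have the same bound, with 1 / \<eta> = 1 / (k - \<eta>) = 2 /
    k.\<close>
  define \<eta> where "\<eta> = k / 2"
  have \<eta>: "0 < \<eta>" "\<eta> < k" using k by (auto simp: \<eta>_def)
  \<comment> \<open>The unknown \<phi> is the orbit multiplied by exp(- \<eta> s). It ranges over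
    the complete space of bounded continuous functions, where the Banach theorem applies.\<close>
  define a where "a \<phi> s = A (exp (\<eta> * s) * fst (apply_bcontfun \<phi> s)) (exp (\<eta> * s) * snd (apply_bcontfun \<phi> s))"
    for \<phi> :: "real \<Rightarrow>\<^sub>C (real \<times> real)" and s
  define b where "b \<phi> s = B (exp (\<eta> * s) * fst (apply_bcontfun \<phi> s)) (exp (\<eta> * s) * snd (apply_bcontfun \<phi> s))"
    for \<phi> :: "real \<Rightarrow>\<^sub>C (real \<times> real)" and s
  have gen_cont: "continuous_on S (\<lambda>s. F (u s) (v s))"
    if F: "\<And>y z y' z'. \<bar>F y z - F y' z'\<bar> \<le> L * (\<bar>y - y'\<bar> + \<bar>z - z'\<bar>)"
      and uv: "continuous_on S u" "continuous_on S v" for F :: "real \<Rightarrow> real \<Rightarrow> real" and u v :: "real \<Rightarrow> real" and S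
  proof -
    have "(2 * L)-lipschitz_on UNIV (\<lambda>p. F (fst p) (snd p))"
    proof (rule lipschitz_onI)
      fix p q :: "real \<times> real"
      have "\<bar>fst p - fst q\<bar> + \<bar>snd p - snd q\<bar> \<le> dist p q + dist p q"
        using dist_fst_le[of p q] dist_snd_le[of p q] by (intro add_mono) (auto simp: dist_real_def)
      then have "L * (\<bar>fst p - fst q\<bar> + \<bar>snd p - snd q\<bar>) \<le> L * (dist p q + dist p q)"
        using L by (intro mult_left_mono)
      then show "dist (F (fst p) (snd p)) (F (fst q) (snd q)) \<le> 2 * L * dist p q"
        using F[of "fst p" "snd p" "fst q" "snd q"] by (simp add: dist_real_def algebra_simps)
    qed (use L in simp)
    then have "continuous_on UNIV (\<lambda>p. F (fst p) (snd p))" by (rule lipschitz_on_continuous_on)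
    from continuous_on_compose2[OF this continuous_on_Pair[OF uv]] show ?thesis by simp
  qed
  have cont: "continuous_on S (a \<phi>)" "continuous_on S (b \<phi>)" for \<phi> S
    unfolding a_def b_def
    by (rule gen_cont[OF A(1)] gen_cont[OF B(1)]; intro continuous_intros continuous_on_apply_bcontfun)+
  have gen_bd: "\<bar>F (exp (\<eta> * s) * fst (apply_bcontfun \<phi> s)) (exp (\<eta> * s) * snd (apply_bcontfun \<phi> s))
      - F (exp (\<eta> * s) * fst (apply_bcontfun \<psi> s)) (exp (\<eta> * s) * snd (apply_bcontfun \<psi> s))\<bar>
      \<le> 2 * L * dist \<phi> \<psi> * exp (\<eta> * s)"
    if F: "\<And>y z y' z'. \<bar>F y z - F y' z'\<bar> \<le> L * (\<bar>y - y'\<bar> + \<bar>z - z'\<bar>)"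
    for F and \<phi> \<psi> :: "real \<Rightarrow>\<^sub>C (real \<times> real)" and s
  proof -
    let ?p = "apply_bcontfun \<phi> s" and ?q = "apply_bcontfun \<psi> s"
    have "\<bar>exp (\<eta> * s) * fst ?p - exp (\<eta> * s) * fst ?q\<bar> + \<bar>exp (\<eta> * s) * snd ?p - exp (\<eta> * s) * snd ?q\<bar>
       = exp (\<eta> * s) * (\<bar>fst ?p - fst ?q\<bar> + \<bar>snd ?p - snd ?q\<bar>)"
      by (simp add: right_diff_distrib[symmetric] abs_mult distrib_left)
    also have "\<dots> \<le> exp (\<eta> * s) * (dist \<phi> \<psi> + dist \<phi> \<psi>)"
      using dist_fst_le[of ?p ?q] dist_snd_le[of ?p ?q] dist_bounded[of \<phi> s \<psi>]
      by (intro mult_left_mono add_mono) (auto simp: dist_real_def)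
    finally have "L * (\<bar>exp (\<eta> * s) * fst ?p - exp (\<eta> * s) * fst ?q\<bar> + \<bar>exp (\<eta> * s) * snd ?p - exp (\<eta> * s) * snd ?q\<bar>)
       \<le> L * (exp (\<eta> * s) * (dist \<phi> \<psi> + dist \<phi> \<psi>))" using L by (intro mult_left_mono)
    then show ?thesis using F[of "exp (\<eta> * s) * fst ?p" "exp (\<eta> * s) * snd ?p" "exp (\<eta> * s) * fst ?q" "exp (\<eta> * s) * snd ?q"]
      by (simp add: algebra_simps)
  qed
  have diff: "\<bar>a \<phi> s - a \<psi> s\<bar> \<le> 2 * L * dist \<phi> \<psi> * exp (\<eta> * s)" "\<bar>b \<phi> s - b \<psi> s\<bar> \<le> 2 * L * dist \<phi> \<psi> * exp (\<eta> * s)"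
    for \<phi> \<psi> s
    unfolding a_def b_def by (rule gen_bd[OF A(1)], rule gen_bd[OF B(1)])
  have ab0: "a 0 = (\<lambda>s. 0)" "b 0 = (\<lambda>s. 0)" by (auto simp: a_def b_def A B fun_eq_iff)
  \<comment> \<open>The variation of constants formula after multiplication by exp(- \<eta>
    t).\<close>
  define S where "S \<phi> t = (exp (- ((\<eta> + lam) * t)) * (y0 + integral {0..t} (\<lambda>s. exp (lam * s) * a \<phi> s)),
      - exp ((k - \<eta>) * t) * integral {t..} (\<lambda>s. exp (- (k * s)) * b \<phi> s))" for \<phi> t
  have bint: "(\<lambda>s. exp (- (k * s)) * b \<phi> s) integrable_on {t..}" if "0 \<le> t" for \<phi> t
    using backward_integral_bound(1)[OF \<eta>(2) that cont(2)[of _ \<phi>], of "2 * L * dist \<phi> 0"] diff(2)[of \<phi> _ 0] ab0 by simp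
  have aint: "(\<lambda>s. exp (lam * s) * a \<phi> s) integrable_on {0..t}" for \<phi> t
    by (intro integrable_continuous_real continuous_intros cont)
  have Sdist: "dist (S \<phi> t) (S \<psi> t) \<le> 1/2 * dist \<phi> \<psi>" if t: "0 \<le> t" for \<phi> \<psi> t
  proof -
    let ?d = "2 * L * dist \<phi> \<psi>"
    have "\<bar>integral {0..t} (\<lambda>s. exp (lam * s) * (a \<phi> s - a \<psi> s))\<bar> \<le> ?d / \<eta> * exp ((\<eta> + lam) * t)"
      by (intro forward_integral_bound lam \<eta> t continuous_intros cont diff)
    then have 1: "\<bar>integral {0..t} (\<lambda>s. exp (lam * s) * a \<phi> s) - integral {0..t} (\<lambda>s. exp (lam * s) * a \<psi> s)\<bar>
        \<le> ?d / \<eta> * exp ((\<eta> + lam) * t)"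
      by (simp add: right_diff_distrib integral_diff aint)
    have "\<bar>integral {t..} (\<lambda>s. exp (- (k * s)) * (b \<phi> s - b \<psi> s))\<bar> \<le> ?d / (k - \<eta>) * exp (- ((k - \<eta>) * t))"
      by (intro backward_integral_bound \<eta> t continuous_intros cont diff)
    then have 2: "\<bar>integral {t..} (\<lambda>s. exp (- (k * s)) * b \<phi> s) - integral {t..} (\<lambda>s. exp (- (k * s)) * b \<psi> s)\<bar>
        \<le> ?d / (k - \<eta>) * exp (- ((k - \<eta>) * t))"
      by (simp add: right_diff_distrib integral_diff bint t)
    have e: "exp (- ((\<eta> + lam) * t)) * (x * exp ((\<eta> + lam) * t)) = x"
      "exp ((k - \<eta>) * t) * (x * exp (- ((k - \<eta>) * t))) = x" for x
      by (simp_all add: mult_exp_exp[symmetric] mult.left_commute[of _ x] mult_exp_exp)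
    have "\<bar>fst (S \<phi> t) - fst (S \<psi> t)\<bar> = exp (- ((\<eta> + lam) * t)) *
        \<bar>integral {0..t} (\<lambda>s. exp (lam * s) * a \<phi> s) - integral {0..t} (\<lambda>s. exp (lam * s) * a \<psi> s)\<bar>"
      unfolding S_def by (simp add: right_diff_distrib[symmetric] abs_mult)
    also have "\<dots> \<le> exp (- ((\<eta> + lam) * t)) * (?d / \<eta> * exp ((\<eta> + lam) * t))" using 1 by (intro mult_left_mono) auto
    also have "\<dots> = ?d / \<eta>" by (rule e)
    finally have 3: "\<bar>fst (S \<phi> t) - fst (S \<psi> t)\<bar> \<le> ?d / \<eta>" .
    have "\<bar>snd (S \<phi> t) - snd (S \<psi> t)\<bar> = exp ((k - \<eta>) * t) *
        \<bar>integral {t..} (\<lambda>s. exp (- (k * s)) * b \<phi> s) - integral {t..} (\<lambda>s. exp (- (k * s)) * b \<psi> s)\<bar>"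
      unfolding S_def by (simp add: right_diff_distrib[symmetric] abs_mult abs_minus_commute)
    also have "\<dots> \<le> exp ((k - \<eta>) * t) * (?d / (k - \<eta>) * exp (- ((k - \<eta>) * t)))" using 2 by (intro mult_left_mono) auto
    also have "\<dots> = ?d / (k - \<eta>)" by (rule e)
    finally have 4: "\<bar>snd (S \<phi> t) - snd (S \<psi> t)\<bar> \<le> ?d / (k - \<eta>)" .
    have "dist (S \<phi> t) (S \<psi> t) \<le> \<bar>fst (S \<phi> t) - fst (S \<psi> t)\<bar> + \<bar>snd (S \<phi> t) - snd (S \<psi> t)\<bar>"
      unfolding dist_norm using norm_Pair_le[of "fst (S \<phi> t - S \<psi> t)" "snd (S \<phi> t - S \<psi> t)"]
      unfolding prod.collapse by (simp only: real_norm_def fst_diff snd_diff)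
    also have "\<dots> \<le> ?d / \<eta> + ?d / (k - \<eta>)" using 3 4 by simp
    also have "\<dots> = 8 * L / k * dist \<phi> \<psi>" using k by (simp add: \<eta>_def field_simps)
    also have "\<dots> \<le> 1/2 * dist \<phi> \<psi>" using L k by (intro mult_right_mono) (auto simp: field_simps)
    finally show ?thesis .
  qed
  have d1: "((\<lambda>t. y0 + integral {0..t} (\<lambda>s. exp (lam * s) * a \<phi> s)) has_real_derivative exp (lam * t) * a \<phi> t) (at t within {0..})"
    if "0 \<le> t" for \<phi> t
    using DERIV_add[OF DERIV_const[of y0] integral_has_real_derivative_halfline[of "\<lambda>s. exp (lam * s) * a \<phi> s" t]] that
    by (simp add: continuous_intros cont)
  have d2: "((\<lambda>t. integral {t..} (\<lambda>s. exp (- (k * s)) * b \<phi> s)) has_real_derivative - (exp (- (k * t)) * b \<phi> t)) (at t within {0..})"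
    if "0 \<le> t" for \<phi> t
    by (rule backward_integral_derivative) (use that bint in \<open>auto intro!: continuous_intros cont\<close>)
  have Scont: "continuous_on {0..} (S \<phi>)" for \<phi>
    unfolding S_def
    by (intro continuous_intros DERIV_continuous_on[OF d1] DERIV_continuous_on[OF d2]) auto
  have S0: "norm (S 0 t) \<le> \<bar>y0\<bar>" if "0 \<le> t" for t
  proof -
    have "exp (- ((\<eta> + lam) * t)) * \<bar>y0\<bar> \<le> 1 * \<bar>y0\<bar>"
      using that lam \<eta> by (intro mult_right_mono) auto
    then show ?thesis by (simp add: S_def ab0 norm_Pair abs_mult)
  qed
  \<comment> \<open>Bounded continuous functions live on the whole line here, so the image is
    extended to negative times by its value at 0.\<close>
  have mem: "(\<lambda>t. S \<phi> (max 0 t)) \<in> bcontfun" for \<phi>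
  proof -
    have "norm (S \<phi> (max 0 t)) \<le> \<bar>y0\<bar> + 1/2 * dist \<phi> 0" for t
      using Sdist[of "max 0 t" \<phi> 0] S0[of "max 0 t"] norm_triangle_sub[of "S \<phi> (max 0 t)" "S 0 (max 0 t)"]
      by (simp add: dist_norm)
    then have "bounded (range (\<lambda>t. S \<phi> (max 0 t)))" by (auto simp: bounded_iff)
    moreover have "continuous_on UNIV (\<lambda>t. S \<phi> (max 0 t))"
      by (rule continuous_on_compose2[OF Scont]) (auto intro!: continuous_intros)
    ultimately show ?thesis by (simp add: bcontfun_def)
  qed
  define T where "T \<phi> = Bcontfun (\<lambda>t. S \<phi> (max 0 t))" for \<phi>
  have T: "apply_bcontfun (T \<phi>) t = S \<phi> (max 0 t)" for \<phi> t
    unfolding T_def by (simp add: Bcontfun_inverse[OF mem])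
  have "dist (T \<phi>) (T \<psi>) \<le> 1/2 * dist \<phi> \<psi>" for \<phi> \<psi>
    by (rule dist_bound) (unfold T, rule Sdist, simp)
  then have "\<exists>!\<phi>. T \<phi> = \<phi>"
    by (intro banach_fix_type[of "1/2"] allI) simp_all
  then obtain \<phi> where "T \<phi> = \<phi>" by blast
  then have \<phi>: "apply_bcontfun \<phi> t = S \<phi> t" if "0 \<le> t" for t using T[of \<phi> t] that by (simp add: max_def)
  define Y where "Y t = exp (\<eta> * t) * fst (apply_bcontfun \<phi> t)" for t
  define Z where "Z t = exp (\<eta> * t) * snd (apply_bcontfun \<phi> t)" for t
  have Y: "Y t = exp (- (lam * t)) * (y0 + integral {0..t} (\<lambda>s. exp (lam * s) * a \<phi> s))" if "0 \<le> t" for t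
    unfolding Y_def \<phi>[OF that] S_def fst_conv mult.assoc[symmetric] mult_exp_exp by (simp add: algebra_simps)
  have Z: "Z t = - exp (k * t) * integral {t..} (\<lambda>s. exp (- (k * s)) * b \<phi> s)" if "0 \<le> t" for t
    unfolding Z_def \<phi>[OF that] S_def snd_conv mult.assoc[symmetric] mult_minus_right mult_exp_exp by (simp add: algebra_simps)
  have aY: "a \<phi> = (\<lambda>t. A (Y t) (Z t))" "b \<phi> = (\<lambda>t. B (Y t) (Z t))"
    by (auto simp: a_def b_def Y_def Z_def)
  show ?thesis
  proof (rule that[of Y Z])
    show "Y 0 = y0" by (simp add: Y)
    fix t :: real assume t: "0 \<le> t"
    have "((\<lambda>t. exp (- (lam * t)) * (y0 + integral {0..t} (\<lambda>s. exp (lam * s) * a \<phi> s))) has_real_derivative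
       exp (- (lam * t)) * (exp (lam * t) * a \<phi> t) + (exp (- (lam * t)) * - lam) * (y0 + integral {0..t} (\<lambda>s. exp (lam * s) * a \<phi> s))) (at t within {0..})"
      by (rule DERIV_mult'[OF _ d1[OF t]]) (auto intro!: derivative_eq_intros)
    moreover have "exp (- (lam * t)) * (exp (lam * t) * a \<phi> t) + (exp (- (lam * t)) * - lam) * (y0 + integral {0..t} (\<lambda>s. exp (lam * s) * a \<phi> s))
      = - lam * Y t + A (Y t) (Z t)"
      unfolding mult.assoc[symmetric] mult_exp_exp using Y[OF t] aY(1) by (simp add: fun_eq_iff)
    ultimately have "((\<lambda>t. exp (- (lam * t)) * (y0 + integral {0..t} (\<lambda>s. exp (lam * s) * a \<phi> s))) has_real_derivative
       - lam * Y t + A (Y t) (Z t)) (at t within {0..})" by simp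
    then show "(Y has_real_derivative - lam * Y t + A (Y t) (Z t)) (at t within {0..})"
      by (rule has_field_derivative_transform_within[OF _ zero_less_one]) (use t Y in auto)
    have "((\<lambda>t. - exp (k * t) * integral {t..} (\<lambda>s. exp (- (k * s)) * b \<phi> s)) has_real_derivative
       - exp (k * t) * - (exp (- (k * t)) * b \<phi> t) + (- exp (k * t) * k) * integral {t..} (\<lambda>s. exp (- (k * s)) * b \<phi> s)) (at t within {0..})"
      by (rule DERIV_mult'[OF _ d2[OF t]]) (auto intro!: derivative_eq_intros)
    moreover have "- exp (k * t) * - (exp (- (k * t)) * b \<phi> t) + (- exp (k * t) * k) * integral {t..} (\<lambda>s. exp (- (k * s)) * b \<phi> s)
      = k * Z t + B (Y t) (Z t)"
      using Z[OF t] aY(2) by (simp add: mult.assoc[symmetric] mult_exp_exp fun_eq_iff)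
    ultimately have "((\<lambda>t. - exp (k * t) * integral {t..} (\<lambda>s. exp (- (k * s)) * b \<phi> s)) has_real_derivative
       k * Z t + B (Y t) (Z t)) (at t within {0..})" by simp
    then show "(Z has_real_derivative k * Z t + B (Y t) (Z t)) (at t within {0..})"
      by (rule has_field_derivative_transform_within[OF _ zero_less_one]) (use t Z in auto)
    \<comment> \<open>The fixed point is known only to grow at most like exp(\<eta> t). Repeating
      the backward estimate with the global bound M and \<eta> = 0 shows that its unstable component
      is bounded.\<close>
    have "\<bar>integral {t..} (\<lambda>s. exp (- (k * s)) * b \<phi> s)\<bar> \<le> M / (k - 0) * exp (- ((k - 0) * t))"
      by (rule backward_integral_bound(2)) (use k t M cont(2)[of _ \<phi>] in \<open>auto simp: aY(2)\<close>)
    then have "exp (k * t) * \<bar>integral {t..} (\<lambda>s. exp (- (k * s)) * b \<phi> s)\<bar> \<le> exp (k * t) * (M / k * exp (- (k * t)))"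
      by (intro mult_left_mono) auto
    also have "\<dots> = M / k" by (simp add: mult.left_commute[of _ "M / k"] mult_exp_exp)
    finally show "\<bar>Z t\<bar> \<le> M / k" by (simp add: Z[OF t] abs_mult)
  qed
qed

section \<open>The centre-stable graph of a planar system\<close>

definition clamp_real :: "real \<Rightarrow> real \<Rightarrow> real" where
  "clamp_real c x = max (- c) (min c x)"

lemma clamp_real_dist: "\<bar>clamp_real c x - clamp_real c y\<bar> \<le> \<bar>x - y\<bar>"
  unfolding clamp_real_def by linarith

lemma clamp_real_abs: "0 \<le> c \<Longrightarrow> \<bar>clamp_real c x\<bar> \<le> c"
  unfolding clamp_real_def by linarith

lemma clamp_real_id: "\<bar>x\<bar> \<le> c \<Longrightarrow> clamp_real c x = x"
  unfolding clamp_real_def by linarith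

text \<open>To be read for the difference (y, x) of two solutions in the stable and the unstable
  coordinate, with \<alpha> and \<beta> the differences of the nonlinear terms. The linear part
  leaves a surplus k (x^2 + m^2 y^2), which absorbs the nonlinear terms; the factor m in L \<le> k m
  / 16 pays for m (|y| + |x|) \<le> |x| + m |y|.\<close>

lemma cone_growth:
  fixes x y \<alpha> \<beta> :: real
  assumes k: "0 < k" and "0 < m" "m \<le> 1" "0 \<le> lam" "0 \<le> L" "L \<le> k * m / 16"
    and ab: "\<bar>\<alpha>\<bar> \<le> L * (\<bar>y\<bar> + \<bar>x\<bar>)" "\<bar>\<beta>\<bar> \<le> L * (\<bar>y\<bar> + \<bar>x\<bar>)"
  shows "k * (x\<^sup>2 - m\<^sup>2 * y\<^sup>2) \<le> 2 * x * (k * x + \<beta>) - m\<^sup>2 * (2 * y * (- lam * y + \<alpha>))"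
proof -
  define X where "X = \<bar>x\<bar>"
  define Y where "Y = \<bar>y\<bar>"
  have XY: "0 \<le> X" "0 \<le> Y" "x\<^sup>2 = X\<^sup>2" "y\<^sup>2 = Y\<^sup>2" by (auto simp: X_def Y_def)
  have "\<bar>x * \<beta>\<bar> \<le> X * (L * (Y + X))" "\<bar>y * \<alpha>\<bar> \<le> Y * (L * (Y + X))"
    using ab by (auto simp: abs_mult X_def Y_def intro!: mult_left_mono)
  then have 1: "- (x * \<beta>) \<le> X * (L * (Y + X))" "y * \<alpha> \<le> Y * (L * (Y + X))" by linarith+
  have "m\<^sup>2 \<le> m" using assms by (simp add: power2_eq_square)
  then have 2: "m\<^sup>2 * Y \<le> m * Y" using XY by (intro mult_right_mono)
  have 3: "m * (Y + X) \<le> X + m * Y" using assms XY by (simp add: algebra_simps mult_left_le)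
  have "m * (L * ((X + m\<^sup>2 * Y) * (Y + X))) = L * ((X + m\<^sup>2 * Y) * (m * (Y + X)))" by simp
  also have "\<dots> \<le> L * ((X + m * Y) * (X + m * Y))"
    using 2 3 assms XY by (intro mult_left_mono mult_mono) auto
  also have "\<dots> \<le> L * (2 * (X\<^sup>2 + m\<^sup>2 * Y\<^sup>2))"
    using assms sum_squares_bound[of X "m * Y"] by (intro mult_left_mono) (auto simp: power2_eq_square algebra_simps)
  also have "\<dots> \<le> (k * m / 16) * (2 * (X\<^sup>2 + m\<^sup>2 * Y\<^sup>2))"
    using assms XY by (intro mult_right_mono) auto
  also have "\<dots> = m * (k / 8 * (X\<^sup>2 + m\<^sup>2 * Y\<^sup>2))" by simp
  finally have 4: "L * ((X + m\<^sup>2 * Y) * (Y + X)) \<le> k / 8 * (X\<^sup>2 + m\<^sup>2 * Y\<^sup>2)"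
    using assms(2) by (simp only: mult_le_cancel_left_pos)
  have "m\<^sup>2 * (y * \<alpha>) \<le> m\<^sup>2 * (Y * (L * (Y + X)))" using 1 by (intro mult_left_mono) auto
  then have 5: "2 * (m\<^sup>2 * (y * \<alpha>)) - 2 * (x * \<beta>) \<le> 2 * (L * ((X + m\<^sup>2 * Y) * (Y + X)))"
    using 1 by (simp add: algebra_simps)
  have 6: "0 \<le> k * (X\<^sup>2 + m\<^sup>2 * Y\<^sup>2)" "0 \<le> m\<^sup>2 * (2 * lam * y\<^sup>2)" using assms by (auto simp: less_imp_le)
  have "2 * x * (k * x + \<beta>) - m\<^sup>2 * (2 * y * (- lam * y + \<alpha>))
     = 2 * (k * x\<^sup>2) + 2 * (x * \<beta>) + m\<^sup>2 * (2 * lam * y\<^sup>2) - 2 * (m\<^sup>2 * (y * \<alpha>))"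
    by (simp add: algebra_simps power2_eq_square)
  moreover have "k * (x\<^sup>2 - m\<^sup>2 * y\<^sup>2) = 2 * (k * x\<^sup>2) - k * (X\<^sup>2 + m\<^sup>2 * Y\<^sup>2)"
    unfolding XY by (simp add: algebra_simps)
  ultimately show ?thesis using 4 5 6 by linarith
qed

text \<open>\<open>m\<close> is the slope of the invariant cone and \<open>r\<close> the size of the box in which the nonlinearity of
  \<open>y' = - lam y + A y z\<close>, \<open>z' = k z + B y z\<close> is kept; outside of the box the arguments of \<open>A\<close>
  and \<open>B\<close> are clamped.\<close>

locale planar_center_stable =
  fixes lam k m r L Q :: real and A B :: "real \<Rightarrow> real \<Rightarrow> real"
  assumes lam: "0 \<le> lam" and k: "0 < k" and m: "0 < m" "m \<le> 1" and r: "0 < r"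
    and L: "0 \<le> L" "L \<le> k * m / 16" and Q: "0 \<le> Q"
    and zero: "A 0 0 = 0" "B 0 0 = 0"
    and A_lip: "\<And>y z y' z'. \<bar>y\<bar> \<le> r \<Longrightarrow> \<bar>z\<bar> \<le> m * r \<Longrightarrow> \<bar>y'\<bar> \<le> r \<Longrightarrow> \<bar>z'\<bar> \<le> m * r \<Longrightarrow>
      \<bar>A y z - A y' z'\<bar> \<le> L * (\<bar>y - y'\<bar> + \<bar>z - z'\<bar>)"
    and B_lip: "\<And>y z y' z'. \<bar>y\<bar> \<le> r \<Longrightarrow> \<bar>z\<bar> \<le> m * r \<Longrightarrow> \<bar>y'\<bar> \<le> r \<Longrightarrow> \<bar>z'\<bar> \<le> m * r \<Longrightarrow>
      \<bar>B y z - B y' z'\<bar> \<le> L * (\<bar>y - y'\<bar> + \<bar>z - z'\<bar>)"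
    and B_quad: "\<And>y z. \<bar>y\<bar> \<le> r \<Longrightarrow> \<bar>z\<bar> \<le> m * r \<Longrightarrow> \<bar>B y z\<bar> \<le> Q * (y\<^sup>2 + z\<^sup>2)"
begin

definition "cA y z = A (clamp_real r y) (clamp_real (m * r) z)"
definition "cB y z = B (clamp_real r y) (clamp_real (m * r) z)"

lemma mr: "0 \<le> r" "0 \<le> m * r" using m r by auto

lemma cA_lip: "\<bar>cA y z - cA y' z'\<bar> \<le> L * (\<bar>y - y'\<bar> + \<bar>z - z'\<bar>)"
  unfolding cA_def
  by (rule order_trans[OF A_lip mult_left_mono[OF add_mono]])
    (intro clamp_real_abs clamp_real_dist mr L)+

lemma cB_lip: "\<bar>cB y z - cB y' z'\<bar> \<le> L * (\<bar>y - y'\<bar> + \<bar>z - z'\<bar>)"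
  unfolding cB_def
  by (rule order_trans[OF B_lip mult_left_mono[OF add_mono]])
    (intro clamp_real_abs clamp_real_dist mr L)+

lemma c_zero: "cA 0 0 = 0" "cB 0 0 = 0"
  using mr zero by (simp_all add: cA_def cB_def clamp_real_id)

lemma c_inside: "\<bar>y\<bar> \<le> r \<Longrightarrow> \<bar>z\<bar> \<le> m * r \<Longrightarrow> cA y z = A y z" "\<bar>y\<bar> \<le> r \<Longrightarrow> \<bar>z\<bar> \<le> m * r \<Longrightarrow> cB y z = B y z"
  by (simp_all add: cA_def cB_def clamp_real_id)

text \<open>Boundedness of \<open>Z\<close> alone selects the centre-stable orbits. \<open>Y\<close>
  carries no bound, since it may grow under the clamped field when \<open>lam\<close> = 0.\<close>

definition clamped_sol :: "(real \<Rightarrow> real) \<Rightarrow> (real \<Rightarrow> real) \<Rightarrow> bool" where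
  "clamped_sol Y Z \<longleftrightarrow> continuous_on {0..} Y \<and> continuous_on {0..} Z \<and>
     (\<forall>t>0. (Y has_real_derivative - lam * Y t + cA (Y t) (Z t)) (at t)) \<and>
     (\<forall>t>0. (Z has_real_derivative k * Z t + cB (Y t) (Z t)) (at t)) \<and>
     (\<exists>C. \<forall>t\<ge>0. \<bar>Z t\<bar> \<le> C)"

lemma at_within_halfline: "(0::real) < t \<Longrightarrow> at t within {0..} = at t"
  by (rule at_within_interior) auto

lemma clamped_sol_exists:
  obtains Y Z where "Y 0 = y0" "clamped_sol Y Z"
    "\<And>t. 0 \<le> t \<Longrightarrow> (Y has_real_derivative - lam * Y t + cA (Y t) (Z t)) (at t within {0..})"
    "\<And>t. 0 \<le> t \<Longrightarrow> (Z has_real_derivative k * Z t + cB (Y t) (Z t)) (at t within {0..})"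
proof -
  have "\<bar>cB y z\<bar> \<le> L * (r + m * r)" for y z
  proof -
    have "\<bar>cB y z\<bar> \<le> L * (\<bar>clamp_real r y - 0\<bar> + \<bar>clamp_real (m * r) z - 0\<bar>)"
      using B_lip[of "clamp_real r y" "clamp_real (m * r) z" 0 0] mr zero by (simp add: cB_def clamp_real_abs)
    also have "\<dots> \<le> L * (r + m * r)" using L mr clamp_real_abs by (intro mult_left_mono add_mono) auto
    finally show ?thesis .
  qed
  moreover have "L \<le> k / 16" using L m k by (smt (verit) divide_right_mono mult_left_le)
  ultimately obtain Y Z where YZ: "Y 0 = y0"
    "\<And>t. 0 \<le> t \<Longrightarrow> (Y has_real_derivative - lam * Y t + cA (Y t) (Z t)) (at t within {0..})"
    "\<And>t. 0 \<le> t \<Longrightarrow> (Z has_real_derivative k * Z t + cB (Y t) (Z t)) (at t within {0..})"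
    "\<And>t. 0 \<le> t \<Longrightarrow> \<bar>Z t\<bar> \<le> L * (r + m * r) / k"
    using lyapunov_perron[where A=cA and B=cB and lam=lam and k=k and L=L and M="L * (r + m * r)" and ?y0.0=y0]
      lam k L(1) cA_lip cB_lip c_zero by metis
  moreover have "clamped_sol Y Z"
    unfolding clamped_sol_def
    using YZ(2-4) at_within_halfline
    by (auto intro!: DERIV_continuous_on[of "{0..}" Y] DERIV_continuous_on[of "{0..}" Z]) (metis less_imp_le)+
  ultimately show ?thesis using that by blast
qed

lemma clamped_sol_shift:
  assumes "clamped_sol Y Z" "0 \<le> s"
  shows "clamped_sol (\<lambda>t. Y (s + t)) (\<lambda>t. Z (s + t))"
proof -
  have "continuous_on {0..} (\<lambda>t. Y (s + t))" "continuous_on {0..} (\<lambda>t. Z (s + t))"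
    using assms unfolding clamped_sol_def
    by (auto intro!: continuous_on_compose2[of "{0..}" Y] continuous_on_compose2[of "{0..}" Z] continuous_intros)
  moreover have "((\<lambda>t. f (s + t)) has_real_derivative d) (at t) \<longleftrightarrow> (f has_real_derivative d) (at (s + t))" for f d t
    by (simp add: DERIV_shift add.commute[of s])
  moreover obtain C where "\<And>t. 0 \<le> t \<Longrightarrow> \<bar>Z t\<bar> \<le> C" using assms unfolding clamped_sol_def by blast
  ultimately show ?thesis
    using assms unfolding clamped_sol_def by (auto intro!: exI[of _ C])
qed

lemma clamped_sol_zero: "clamped_sol (\<lambda>t. 0) (\<lambda>t. 0)"
  unfolding clamped_sol_def by (auto simp: c_zero intro!: exI[of _ 0])

text \<open>The cone function grows at least at rate k and is bounded above because both unstable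
  components are bounded. A positive value would have to grow exponentially.\<close>

lemma clamped_sol_cone:
  assumes s1: "clamped_sol Y Z" and s2: "clamped_sol Y' Z'" and t: "0 \<le> t"
  shows "\<bar>Z t - Z' t\<bar> \<le> m * \<bar>Y t - Y' t\<bar>"
proof -
  obtain C C' where C: "\<And>t. 0 \<le> t \<Longrightarrow> \<bar>Z t\<bar> \<le> C" "\<And>t. 0 \<le> t \<Longrightarrow> \<bar>Z' t\<bar> \<le> C'"
    using s1 s2 unfolding clamped_sol_def by blast
  define D where "D s = (Z s - Z' s)\<^sup>2 - m\<^sup>2 * (Y s - Y' s)\<^sup>2" for s
  have "D t \<le> 0"
  proof (rule bounded_exp_growth_nonpos[where D=D and a=t, OF k])
    have "continuous_on {0..} D"
      unfolding D_def using s1 s2 by (intro continuous_intros) (auto simp: clamped_sol_def)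
    then show "continuous_on {t..} D" by (rule continuous_on_subset) (use t in auto)
  next
    fix s assume "t < s"
    then have s: "0 < s" using t by simp
    show "(D has_real_derivative 2 * (Z s - Z' s) * (k * (Z s - Z' s) + (cB (Y s) (Z s) - cB (Y' s) (Z' s)))
       - m\<^sup>2 * (2 * (Y s - Y' s) * (- lam * (Y s - Y' s) + (cA (Y s) (Z s) - cA (Y' s) (Z' s))))) (at s)"
      unfolding D_def using s1 s2 s unfolding clamped_sol_def
      by (auto intro!: derivative_eq_intros simp: algebra_simps)
    show "k * D s \<le> 2 * (Z s - Z' s) * (k * (Z s - Z' s) + (cB (Y s) (Z s) - cB (Y' s) (Z' s)))
       - m\<^sup>2 * (2 * (Y s - Y' s) * (- lam * (Y s - Y' s) + (cA (Y s) (Z s) - cA (Y' s) (Z' s))))"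
      unfolding D_def by (rule cone_growth[OF k m lam L]) (rule cA_lip cB_lip)+
  next
    fix s assume "t \<le> s"
    then have s: "0 \<le> s" using t by simp
    have "\<bar>Z s - Z' s\<bar> \<le> \<bar>C + C'\<bar>" using C[OF s] by linarith
    then have "(Z s - Z' s)\<^sup>2 \<le> (C + C')\<^sup>2" by (simp add: abs_le_square_iff)
    then show "D s \<le> (C + C')\<^sup>2" unfolding D_def by (smt (verit) mult_nonneg_nonneg zero_le_power2)
  qed
  then have "(Z t - Z' t)\<^sup>2 \<le> (m * (Y t - Y' t))\<^sup>2" by (simp add: D_def power_mult_distrib)
  then have "\<bar>Z t - Z' t\<bar> \<le> \<bar>m * (Y t - Y' t)\<bar>" by (simp add: abs_le_square_iff)
  then show ?thesis using m by (simp add: abs_mult)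
qed

lemma clamped_sol_cone0:
  assumes "clamped_sol Y Z" "0 \<le> t" shows "\<bar>Z t\<bar> \<le> m * \<bar>Y t\<bar>"
  using clamped_sol_cone[OF assms(1) clamped_sol_zero assms(2)] by simp

text \<open>By the cone estimate the difference of the unstable components is dominated by that of
  the stable ones, so a scalar Gronwall argument for (Y - Y')^2 suffices and agreement of Y at one
  time is enough.\<close>

lemma clamped_sol_unique:
  assumes s1: "clamped_sol Y Z" and s2: "clamped_sol Y' Z'" and st: "0 \<le> s" "s \<le> t" and eq: "Y s = Y' s"
  shows "Y t = Y' t" "Z t = Z' t"
proof -
  have "exp (- (4 * L * s)) * - (Y s - Y' s)\<^sup>2 \<le> exp (- (4 * L * t)) * - (Y t - Y' t)\<^sup>2"
  proof (rule exp_growth_mono[OF st(2)])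
    have "continuous_on {0..} (\<lambda>t. - (Y t - Y' t)\<^sup>2)"
      using s1 s2 by (intro continuous_intros) (auto simp: clamped_sol_def)
    then show "continuous_on {s..t} (\<lambda>t. - (Y t - Y' t)\<^sup>2)" by (rule continuous_on_subset) (use st in auto)
    fix x assume x: "s < x" "x < t"
    let ?d = "Y x - Y' x" and ?a = "cA (Y x) (Z x) - cA (Y' x) (Z' x)"
    show "((\<lambda>t. - (Y t - Y' t)\<^sup>2) has_real_derivative - (2 * ?d * (- lam * ?d + ?a))) (at x)"
      using s1 s2 x st unfolding clamped_sol_def by (auto intro!: derivative_eq_intros simp: algebra_simps)
    have "\<bar>?a\<bar> \<le> L * (\<bar>?d\<bar> + \<bar>Z x - Z' x\<bar>)" by (rule cA_lip)
    also have "\<bar>Z x - Z' x\<bar> \<le> m * \<bar>?d\<bar>" using clamped_sol_cone[OF s1 s2, of x] st x by simp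
    also have "m * \<bar>?d\<bar> \<le> \<bar>?d\<bar>" using m by (simp add: mult_left_le_one_le)
    finally have "\<bar>?a\<bar> \<le> L * (\<bar>?d\<bar> + \<bar>?d\<bar>)" using L by (simp add: mult_left_mono)
    then have "\<bar>?d\<bar> * \<bar>?a\<bar> \<le> \<bar>?d\<bar> * (L * (\<bar>?d\<bar> + \<bar>?d\<bar>))" by (intro mult_left_mono) auto
    also have "\<dots> = 2 * L * (\<bar>?d\<bar> * \<bar>?d\<bar>)" by (simp add: algebra_simps)
    also have "\<dots> = 2 * L * ?d\<^sup>2" by (simp add: power2_eq_square)
    finally have "?d * ?a \<le> 2 * L * ?d\<^sup>2" unfolding abs_mult[symmetric] by linarith
    moreover have "0 \<le> lam * ?d\<^sup>2" using lam by simp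
    moreover have "2 * ?d * (- lam * ?d + ?a) = 2 * (?d * ?a) - 2 * (lam * ?d\<^sup>2)"
      by (simp add: algebra_simps power2_eq_square)
    ultimately show "4 * L * - (Y x - Y' x)\<^sup>2 \<le> - (2 * ?d * (- lam * ?d + ?a))" by simp
  qed
  then show "Y t = Y' t" using eq by (simp add: mult_le_0_iff)
  then show "Z t = Z' t" using clamped_sol_cone[OF s1 s2, of t] st by simp
qed

text \<open>Independent of the choice of the solution, by the cone estimate.\<close>

definition graph :: "real \<Rightarrow> real" where
  "graph y0 = (SOME z. \<exists>Y Z. clamped_sol Y Z \<and> Y 0 = y0 \<and> Z 0 = z)"

text \<open>Invariance of the graph: a time shift of a clamped solution is a clamped solution, and
  two of them with the same Y have the same Z.\<close>

lemma graph_eq: assumes "clamped_sol Y Z" "0 \<le> t" shows "Z t = graph (Y t)"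
proof -
  have "\<exists>Y' Z'. clamped_sol Y' Z' \<and> Y' 0 = Y t \<and> Z' 0 = graph (Y t)"
    unfolding graph_def
    by (rule someI[of "\<lambda>z. \<exists>Y' Z'. clamped_sol Y' Z' \<and> Y' 0 = Y t \<and> Z' 0 = z" "Z t"])
      (use clamped_sol_shift[OF assms] in force)
  then show ?thesis using clamped_sol_unique(2)[OF clamped_sol_shift[OF assms], of _ _ 0 0] by fastforce
qed

lemma graph_cone: "\<bar>graph y - graph y'\<bar> \<le> m * \<bar>y - y'\<bar>"
proof -
  obtain Y Z where 1: "Y 0 = y" "clamped_sol Y Z" by (rule clamped_sol_exists)
  obtain Y' Z' where 2: "Y' 0 = y'" "clamped_sol Y' Z'" by (rule clamped_sol_exists)
  show ?thesis using clamped_sol_cone[OF 1(2) 2(2), of 0] graph_eq[OF 1(2), of 0] graph_eq[OF 2(2), of 0] 1 2 by simp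
qed

lemma graph_0: "graph 0 = 0"
  using graph_eq[OF clamped_sol_zero, of 0] by simp

lemma graph_cone0: "\<bar>graph y\<bar> \<le> m * \<bar>y\<bar>"
  using graph_cone[of y 0] by (simp add: graph_0)

lemma continuous_graph: "continuous_on S graph"
  by (rule lipschitz_on_continuous_on[of m], rule lipschitz_onI)
    (use graph_cone m in \<open>auto simp: dist_real_def\<close>)

lemma clamped_solI:
  assumes "continuous_on {0..} Y" "continuous_on {0..} Z"
    and "\<And>t. 0 < t \<Longrightarrow> (Y has_real_derivative - lam * Y t + A (Y t) (Z t)) (at t)"
    and "\<And>t. 0 < t \<Longrightarrow> (Z has_real_derivative k * Z t + B (Y t) (Z t)) (at t)"
    and "\<And>t. 0 \<le> t \<Longrightarrow> \<bar>Y t\<bar> \<le> r" "\<And>t. 0 \<le> t \<Longrightarrow> \<bar>Z t\<bar> \<le> m * r"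
  shows "clamped_sol Y Z"
  unfolding clamped_sol_def using assms by (auto simp: c_inside less_imp_le)

text \<open>On the cone |cA| \<le> 2 L |Y|, so Y^2 can shrink at most exponentially and Y cannot
  reach 0 in finite time. The sign \<sigma> treats both sides of the equilibrium at once.\<close>

lemma clamped_sol_pos:
  assumes s: "clamped_sol Y Z" and \<sigma>: "\<sigma> = 1 \<or> \<sigma> = -1" and y0: "0 < \<sigma> * Y 0" and t: "0 \<le> t"
  shows "0 < \<sigma> * Y t"
proof (rule ccontr)
  assume "\<not> 0 < \<sigma> * Y t"
  moreover have cont: "continuous_on {0..t} (\<lambda>t. \<sigma> * Y t)"
    using s by (intro continuous_intros) (auto simp: clamped_sol_def intro: continuous_on_subset)
  ultimately obtain s0 where s0: "0 \<le> s0" "s0 \<le> t" "\<sigma> * Y s0 = 0"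
    using IVT2'[of "\<lambda>t. \<sigma> * Y t" t 0 0] t y0 by auto
  define c where "c = 2 * (- (lam + 2 * L))"
  have "exp (- (c * 0)) * (Y 0)\<^sup>2 \<le> exp (- (c * s0)) * (Y s0)\<^sup>2"
  proof (rule exp_growth_mono[OF s0(1)])
    show "continuous_on {0..s0} (\<lambda>t. (Y t)\<^sup>2)"
      using s by (intro continuous_intros) (auto simp: clamped_sol_def intro: continuous_on_subset)
    fix x assume x: "0 < x" "x < s0"
    show "((\<lambda>t. (Y t)\<^sup>2) has_real_derivative 2 * Y x * (- lam * Y x + cA (Y x) (Z x))) (at x)"
      using s x unfolding clamped_sol_def by (auto intro!: derivative_eq_intros)
    have "\<bar>cA (Y x) (Z x)\<bar> \<le> L * (\<bar>Y x\<bar> + \<bar>Z x\<bar>)" using cA_lip[of "Y x" "Z x" 0 0] by (simp add: c_zero)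
    also have "\<bar>Z x\<bar> \<le> m * \<bar>Y x\<bar>" using clamped_sol_cone0[OF s, of x] x by simp
    also have "m * \<bar>Y x\<bar> \<le> \<bar>Y x\<bar>" using m by (simp add: mult_left_le_one_le)
    finally have "\<bar>cA (Y x) (Z x)\<bar> \<le> L * (\<bar>Y x\<bar> + \<bar>Y x\<bar>)" using L by (simp add: mult_left_mono)
    then have "\<bar>Y x\<bar> * \<bar>cA (Y x) (Z x)\<bar> \<le> \<bar>Y x\<bar> * (L * (\<bar>Y x\<bar> + \<bar>Y x\<bar>))" by (intro mult_left_mono) auto
    also have "\<dots> = 2 * L * (\<bar>Y x\<bar> * \<bar>Y x\<bar>)" by (simp add: algebra_simps)
    also have "\<dots> = 2 * L * (Y x)\<^sup>2" by (simp add: power2_eq_square)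
    finally have "- (Y x * cA (Y x) (Z x)) \<le> 2 * L * (Y x)\<^sup>2" unfolding abs_mult[symmetric] by linarith
    moreover have "2 * Y x * (- lam * Y x + cA (Y x) (Z x)) = 2 * (Y x * cA (Y x) (Z x)) - 2 * (lam * (Y x)\<^sup>2)"
      "c * (Y x)\<^sup>2 = - (2 * (2 * L * (Y x)\<^sup>2)) - 2 * (lam * (Y x)\<^sup>2)"
      by (simp_all add: c_def algebra_simps power2_eq_square)
    ultimately show "c * (Y x)\<^sup>2 \<le> 2 * Y x * (- lam * Y x + cA (Y x) (Z x))" by linarith
  qed
  moreover have "Y s0 = 0" using s0 \<sigma> by auto
  ultimately show False using y0 by simp
qed

lemma clamped_sol_nonneg:
  assumes s: "clamped_sol Y Z" and \<sigma>: "\<sigma> = 1 \<or> \<sigma> = -1" and y0: "0 \<le> \<sigma> * Y 0" and t: "0 \<le> t"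
  shows "0 \<le> \<sigma> * Y t"
proof (cases "Y 0 = 0")
  case True
  then show ?thesis using clamped_sol_unique(1)[OF s clamped_sol_zero, of 0 t] t by simp
next
  case False
  then have "0 < \<sigma> * Y 0" using y0 \<sigma> by auto
  then show ?thesis using clamped_sol_pos[OF s \<sigma> _ t] by simp
qed

end

lemma reciprocal_sum_le:
  fixes a b s :: real
  assumes "0 < a" "0 < b"
  shows "1 / a + s \<le> 1 / b \<longleftrightarrow> b * (1 + s * a) \<le> a" "1 / b \<le> 1 / a + s \<longleftrightarrow> a \<le> b * (1 + s * a)"
proof -
  have eq: "1 / a + s = (b * (1 + s * a)) / (a * b)" "1 / b = a / (a * b)" using assms by (simp_all add: field_simps)
  have ab: "0 < a * b" using assms by simp
  show "1 / a + s \<le> 1 / b \<longleftrightarrow> b * (1 + s * a) \<le> a" "1 / b \<le> 1 / a + s \<longleftrightarrow> a \<le> b * (1 + s * a)"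
    unfolding eq divide_le_cancel using ab less_asym by blast+
qed

section \<open>Decay along an attracting side of the graph\<close>

context planar_center_stable begin

text \<open>Side \<sigma> of the equilibrium attracts, with a speed of at least quadratic size. This
  weak rate is what the subsonic and the transonic case have in common. Only points of the cone
  matter, since clamped solutions stay there.\<close>

definition inward :: "real \<Rightarrow> real \<Rightarrow> bool" where
  "inward \<sigma> c \<longleftrightarrow> (\<sigma> = 1 \<or> \<sigma> = -1) \<and> 0 < c \<and>
     (\<forall>y z. 0 \<le> \<sigma> * y \<longrightarrow> \<bar>y\<bar> \<le> r \<longrightarrow> \<bar>z\<bar> \<le> m * \<bar>y\<bar> \<longrightarrow> \<sigma> * (- lam * y + A y z) \<le> - (c * y\<^sup>2))"

text \<open>Clamping keeps a point of the cone in the cone and on its side. Outside of the box A is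
  evaluated at the clamped point, where the sign is known, while the unclamped linear term only
  helps.\<close>

lemma inward_clamped:
  assumes "inward \<sigma> c" "0 \<le> \<sigma> * y" "\<bar>z\<bar> \<le> m * \<bar>y\<bar>"
  shows "\<sigma> * (- lam * y + cA y z) \<le> 0"
proof -
  define y' where "y' = clamp_real r y"
  define z' where "z' = clamp_real (m * r) z"
  have y': "0 \<le> \<sigma> * y'" "\<sigma> * y' \<le> \<sigma> * y" "\<bar>y'\<bar> \<le> r"
    using assms(1,2) mr unfolding y'_def inward_def clamp_real_def by auto
  have z': "\<bar>z'\<bar> \<le> m * \<bar>y'\<bar>"
  proof (cases "\<bar>y\<bar> \<le> r")
    case True
    then have "y' = y" by (simp add: y'_def clamp_real_id)
    moreover have "\<bar>z'\<bar> \<le> \<bar>z\<bar>" using mr unfolding z'_def clamp_real_def by linarith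
    ultimately show ?thesis using assms(3) by simp
  next
    case False
    then have "\<bar>y'\<bar> = r" using r unfolding y'_def clamp_real_def by linarith
    then show ?thesis using clamp_real_abs[OF mr(2), of z] by (simp add: z'_def)
  qed
  have "\<sigma> * (- lam * y' + A y' z') \<le> - (c * y'\<^sup>2)" using assms(1) y' z' by (auto simp: inward_def)
  also have "\<dots> \<le> 0" using assms(1) by (simp add: inward_def)
  finally have "\<sigma> * (- lam * y' + A y' z') \<le> 0" .
  moreover have "lam * (\<sigma> * y') \<le> lam * (\<sigma> * y)" using y'(2) lam by (rule mult_left_mono)
  ultimately show ?thesis unfolding cA_def y'_def z'_def by (simp add: algebra_simps)
qed

lemma inward_decreasing:
  assumes i: "inward \<sigma> c" and s: "clamped_sol Y Z" and y0: "0 \<le> \<sigma> * Y 0" and st: "0 \<le> s" "s \<le> t"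
  shows "\<sigma> * Y t \<le> \<sigma> * Y s"
proof -
  have "- (\<sigma> * Y s) \<le> - (\<sigma> * Y t)"
  proof (rule DERIV_nonneg_imp_increasing_open[OF st(2)])
    fix x assume x: "s < x" "x < t"
    have "((\<lambda>t. - (\<sigma> * Y t)) has_real_derivative - (\<sigma> * (- lam * Y x + cA (Y x) (Z x)))) (at x)"
      using s x st unfolding clamped_sol_def by (auto intro!: derivative_eq_intros)
    moreover have "\<sigma> * (- lam * Y x + cA (Y x) (Z x)) \<le> 0"
      by (rule inward_clamped[OF i]) (use clamped_sol_nonneg[OF s _ y0, of x] clamped_sol_cone0[OF s, of x] i x st in \<open>auto simp: inward_def\<close>)
    ultimately show "\<exists>y. ((\<lambda>t. - (\<sigma> * Y t)) has_real_derivative y) (at x) \<and> 0 \<le> y" by (metis neg_0_le_iff_le)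
  next
    show "continuous_on {s..t} (\<lambda>t. - (\<sigma> * Y t))"
      using s st by (intro continuous_intros) (auto simp: clamped_sol_def intro: continuous_on_subset)
  qed
  then show ?thesis by simp
qed

lemma inward_abs:
  assumes i: "inward \<sigma> c" and s: "clamped_sol Y Z" and y0: "0 \<le> \<sigma> * Y 0" and t: "0 \<le> t"
  shows "\<bar>Y t\<bar> = \<sigma> * Y t"
  using clamped_sol_nonneg[OF s _ y0 t] i by (auto simp: inward_def)

text \<open>Since |Y| decreases, an orbit that starts in the box stays there. The clamping is then
  inactive and the orbit solves the original system.\<close>

lemma inward_inside:
  assumes i: "inward \<sigma> c" and s: "clamped_sol Y Z" and y0: "0 \<le> \<sigma> * Y 0" "\<bar>Y 0\<bar> \<le> r" and t: "0 \<le> t"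
  shows "\<bar>Y t\<bar> \<le> \<bar>Y 0\<bar>" "\<bar>Y t\<bar> \<le> r" "\<bar>Z t\<bar> \<le> m * \<bar>Y t\<bar>" "\<bar>Z t\<bar> \<le> m * r"
    "cA (Y t) (Z t) = A (Y t) (Z t)" "cB (Y t) (Z t) = B (Y t) (Z t)"
proof -
  show 1: "\<bar>Y t\<bar> \<le> \<bar>Y 0\<bar>"
    using inward_decreasing[OF i s y0(1), of 0 t] inward_abs[OF i s y0(1)] t by simp
  show 2: "\<bar>Y t\<bar> \<le> r" using 1 y0 by simp
  show 3: "\<bar>Z t\<bar> \<le> m * \<bar>Y t\<bar>" by (rule clamped_sol_cone0[OF s t])
  also have "\<dots> \<le> m * r" using 2 m by (intro mult_left_mono) auto
  finally show 4: "\<bar>Z t\<bar> \<le> m * r" .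
  show "cA (Y t) (Z t) = A (Y t) (Z t)" "cB (Y t) (Z t) = B (Y t) (Z t)" using 2 4 by (simp_all add: c_inside)
qed

lemma inward_speed:
  assumes i: "inward \<sigma> c" and s: "clamped_sol Y Z" and y0: "0 \<le> \<sigma> * Y 0" "\<bar>Y 0\<bar> \<le> r" and t: "0 \<le> t"
  shows "\<sigma> * (- lam * Y t + A (Y t) (Z t)) \<le> - (c * (Y t)\<^sup>2)"
  using i inward_inside[OF assms] clamped_sol_nonneg[OF s _ y0(1) t] by (auto simp: inward_def)

lemma reciprocal_derivative:
  assumes s: "clamped_sol Y Z" and \<sigma>: "\<sigma> = 1 \<or> \<sigma> = -1" and "0 < \<sigma> * Y t" "0 < t"
  shows "((\<lambda>t. 1 / (\<sigma> * Y t)) has_real_derivative - (\<sigma> * (- lam * Y t + cA (Y t) (Z t))) / (Y t)\<^sup>2) (at t)"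
proof -
  have "(\<sigma> * Y t)\<^sup>2 = (Y t)\<^sup>2" "Y t \<noteq> 0" "\<sigma> * \<sigma> = 1" using \<sigma> assms(3) by auto
  then show ?thesis using s assms unfolding clamped_sol_def
    by (auto intro!: derivative_eq_intros simp: power2_eq_square field_simps)
qed

lemma continuous_reciprocal:
  assumes s: "clamped_sol Y Z" and \<sigma>: "\<sigma> = 1 \<or> \<sigma> = -1" and "0 < \<sigma> * Y 0" 
  shows "continuous_on {0..t} (\<lambda>t. 1 / (\<sigma> * Y t))"
proof (intro continuous_intros ballI)
  show "continuous_on {0..t} Y" using s by (auto simp: clamped_sol_def intro: continuous_on_subset)
  show "\<sigma> * Y x \<noteq> 0" if "x \<in> {0..t}" for x using clamped_sol_pos[OF s \<sigma> assms(3), of x] that by auto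
qed

text \<open>The reciprocal of |Y| increases at rate at least c. Multiplying out the resulting bound
  keeps the case Y 0 = 0 inside the statement.\<close>

lemma inward_decay:
  assumes i: "inward \<sigma> c" and s: "clamped_sol Y Z" and y0: "0 \<le> \<sigma> * Y 0" "\<bar>Y 0\<bar> \<le> r" and t: "0 \<le> t"
  shows "\<bar>Y t\<bar> * (1 + c * \<bar>Y 0\<bar> * t) \<le> \<bar>Y 0\<bar>"
proof (cases "Y 0 = 0")
  case True
  then show ?thesis using inward_inside(1)[OF assms] by simp
next
  case False
  have \<sigma>: "\<sigma> = 1 \<or> \<sigma> = -1" using i by (simp add: inward_def)
  have pos0: "0 < \<sigma> * Y 0" using y0 False \<sigma> by auto
  have pos: "0 < \<sigma> * Y x" if "0 \<le> x" for x by (rule clamped_sol_pos[OF s \<sigma> pos0 that])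
  have "1 / (\<sigma> * Y 0) - c * 0 \<le> 1 / (\<sigma> * Y t) - c * t"
  proof (rule DERIV_nonneg_imp_increasing_open[OF t])
    fix x assume x: "0 < x" "x < t"
    have "((\<lambda>t. 1 / (\<sigma> * Y t) - c * t) has_real_derivative - (\<sigma> * (- lam * Y x + cA (Y x) (Z x))) / (Y x)\<^sup>2 - c) (at x)"
      by (intro DERIV_diff reciprocal_derivative s \<sigma> pos x) (use x in \<open>auto intro!: derivative_eq_intros\<close>)
    moreover have "c \<le> - (\<sigma> * (- lam * Y x + cA (Y x) (Z x))) / (Y x)\<^sup>2"
      using inward_speed[OF i s y0, of x] inward_inside(5)[OF i s y0, of x] pos[of x] x
      by (subst pos_le_divide_eq) auto
    ultimately show "\<exists>y. ((\<lambda>t. 1 / (\<sigma> * Y t) - c * t) has_real_derivative y) (at x) \<and> 0 \<le> y"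
      by (metis diff_ge_0_iff_ge)
  qed (intro continuous_on_diff continuous_reciprocal[OF s \<sigma> pos0] continuous_intros)
  then have "1 / \<bar>Y 0\<bar> + c * t \<le> 1 / \<bar>Y t\<bar>" using inward_abs[OF i s y0(1)] t by simp
  moreover have "0 < \<bar>Y 0\<bar>" "0 < \<bar>Y t\<bar>" using False pos[OF t] by auto
  ultimately have "\<bar>Y t\<bar> * (1 + (c * t) * \<bar>Y 0\<bar>) \<le> \<bar>Y 0\<bar>" by (simp only: reciprocal_sum_le)
  then show ?thesis by (simp only: mult_ac)
qed

text \<open>The reverse estimate, from an upper bound c' for the growth of the reciprocal. In the
  transonic case it turns elapsed time into a lower bound for the distance from the
  equilibrium.\<close>

lemma inward_decay_lower:
  assumes i: "inward \<sigma> c" and s: "clamped_sol Y Z" and y0: "0 \<le> \<sigma> * Y 0" "\<bar>Y 0\<bar> \<le> r" and t: "0 \<le> t"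
    and upper: "\<And>y z. 0 \<le> \<sigma> * y \<Longrightarrow> \<bar>y\<bar> \<le> r \<Longrightarrow> \<bar>z\<bar> \<le> m * \<bar>y\<bar> \<Longrightarrow> - (c' * y\<^sup>2) \<le> \<sigma> * (- lam * y + A y z)"
  shows "\<bar>Y 0\<bar> \<le> \<bar>Y t\<bar> * (1 + c' * \<bar>Y 0\<bar> * t)"
proof (cases "Y 0 = 0")
  case False
  have \<sigma>: "\<sigma> = 1 \<or> \<sigma> = -1" using i by (simp add: inward_def)
  have pos0: "0 < \<sigma> * Y 0" using y0 False \<sigma> by auto
  have pos: "0 < \<sigma> * Y x" if "0 \<le> x" for x by (rule clamped_sol_pos[OF s \<sigma> pos0 that])
  have "c' * 0 - 1 / (\<sigma> * Y 0) \<le> c' * t - 1 / (\<sigma> * Y t)"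
  proof (rule DERIV_nonneg_imp_increasing_open[OF t])
    fix x assume x: "0 < x" "x < t"
    have "((\<lambda>t. c' * t - 1 / (\<sigma> * Y t)) has_real_derivative c' - - (\<sigma> * (- lam * Y x + cA (Y x) (Z x))) / (Y x)\<^sup>2) (at x)"
      by (intro DERIV_diff reciprocal_derivative s \<sigma> pos x) (use x in \<open>auto intro!: derivative_eq_intros\<close>)
    moreover have "- (\<sigma> * (- lam * Y x + cA (Y x) (Z x))) / (Y x)\<^sup>2 \<le> c'"
      using upper[of "Y x" "Z x"] inward_inside[OF i s y0, of x] pos[of x] x
      by (subst pos_divide_le_eq) auto
    ultimately show "\<exists>y. ((\<lambda>t. c' * t - 1 / (\<sigma> * Y t)) has_real_derivative y) (at x) \<and> 0 \<le> y"
      by (metis diff_ge_0_iff_ge)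
  qed (intro continuous_on_diff continuous_reciprocal[OF s \<sigma> pos0] continuous_intros)
  then have "1 / \<bar>Y t\<bar> \<le> 1 / \<bar>Y 0\<bar> + c' * t" using inward_abs[OF i s y0(1)] t by simp
  moreover have "0 < \<bar>Y 0\<bar>" "0 < \<bar>Y t\<bar>" using False pos[OF t] by auto
  ultimately have "\<bar>Y 0\<bar> \<le> \<bar>Y t\<bar> * (1 + (c' * t) * \<bar>Y 0\<bar>)" by (simp only: reciprocal_sum_le)
  then show ?thesis by (simp only: mult_ac)
qed simp

lemma inward_decay_exp:
  assumes i: "inward \<sigma> c" and s: "clamped_sol Y Z" and y0: "0 \<le> \<sigma> * Y 0" "\<bar>Y 0\<bar> \<le> r" and t: "0 \<le> t"
    and fast: "\<And>y z. 0 \<le> \<sigma> * y \<Longrightarrow> \<bar>y\<bar> \<le> r \<Longrightarrow> \<bar>z\<bar> \<le> m * \<bar>y\<bar> \<Longrightarrow> \<sigma> * (- lam * y + A y z) \<le> - (\<nu> * \<bar>y\<bar>)"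
  shows "\<bar>Y t\<bar> \<le> \<bar>Y 0\<bar> * exp (- \<nu> * t)"
proof -
  have \<sigma>: "\<sigma> = 1 \<or> \<sigma> = -1" using i by (simp add: inward_def)
  have "exp (- (- \<nu> * 0)) * - (\<sigma> * Y 0) \<le> exp (- (- \<nu> * t)) * - (\<sigma> * Y t)"
  proof (rule exp_growth_mono[OF t])
    show "continuous_on {0..t} (\<lambda>t. - (\<sigma> * Y t))"
      using s by (intro continuous_intros) (auto simp: clamped_sol_def intro: continuous_on_subset)
    fix x assume x: "0 < x" "x < t"
    show "((\<lambda>t. - (\<sigma> * Y t)) has_real_derivative - (\<sigma> * (- lam * Y x + cA (Y x) (Z x)))) (at x)"
      using s x unfolding clamped_sol_def by (auto intro!: derivative_eq_intros)
    show "- \<nu> * - (\<sigma> * Y x) \<le> - (\<sigma> * (- lam * Y x + cA (Y x) (Z x)))"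
      using fast[of "Y x" "Z x"] inward_inside[OF i s y0, of x] clamped_sol_nonneg[OF s \<sigma> y0(1), of x]
        inward_abs[OF i s y0(1), of x] x by simp
  qed
  then have "exp (\<nu> * t) * \<bar>Y t\<bar> \<le> \<bar>Y 0\<bar>" using inward_abs[OF i s y0(1)] t by simp
  then show ?thesis by (simp add: exp_minus field_simps)
qed

lemma inward_tendsto:
  assumes i: "inward \<sigma> c" and s: "clamped_sol Y Z" and y0: "0 \<le> \<sigma> * Y 0" "\<bar>Y 0\<bar> \<le> r"
  shows "(Y \<longlongrightarrow> 0) at_top" "(Z \<longlongrightarrow> 0) at_top"
proof -
  have c: "0 < c" using i by (simp add: inward_def)
  have "\<bar>Y t\<bar> \<le> 1 / c / t" if t: "0 < t" for t
  proof (cases "Y 0 = 0")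
    case True
    then show ?thesis using inward_inside(1)[OF i s y0, of t] t c by simp
  next
    case False
    have "\<bar>Y 0\<bar> * (\<bar>Y t\<bar> * (c * t)) \<le> \<bar>Y 0\<bar> * 1"
      using inward_decay[OF i s y0, of t] t by (simp add: algebra_simps)
    then have "\<bar>Y t\<bar> * (c * t) \<le> 1" using False by (simp only: mult_le_cancel_left)
    then show ?thesis using t c by (simp add: field_simps)
  qed
  then have ev: "eventually (\<lambda>t. norm (Y t) \<le> 1 / c / t) at_top"
    by (auto simp: eventually_at_top_dense)
  have "((\<lambda>t. 1 / c / t) \<longlongrightarrow> 0) at_top" by (rule tendsto_divide_0[OF tendsto_const filterlim_at_top_imp_at_infinity[OF filterlim_ident]])
  from Lim_null_comparison[OF ev this] show Y: "(Y \<longlongrightarrow> 0) at_top" .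
  have "eventually (\<lambda>t. norm (Z t) \<le> m * \<bar>Y t\<bar>) at_top"
    using eventually_ge_at_top[of 0] by eventually_elim (use clamped_sol_cone0[OF s] in auto)
  then show "(Z \<longlongrightarrow> 0) at_top"
    by (rule Lim_null_comparison) (use tendsto_mult[OF tendsto_const tendsto_rabs[OF Y]] in simp)
qed

text \<open>The functions Z - K Y^2 and - Z - K Y^2 grow at rate k and are bounded above, hence
  nonpositive. K = 2 Q / k balances |B| \<le> 2 Q Y^2, and - K Y^2 helps because Y^2 decreases. This
  quadratic contact is the source of the tangency statements.\<close>

lemma inward_parabola:
  assumes i: "inward \<sigma> c" and s: "clamped_sol Y Z" and y0: "0 \<le> \<sigma> * Y 0" "\<bar>Y 0\<bar> \<le> r" and t: "0 \<le> t"
  shows "\<bar>Z t\<bar> \<le> 2 * Q / k * (Y t)\<^sup>2"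
proof -
  define K where "K = 2 * Q / k"
  have K: "0 \<le> K" "k * K = 2 * Q" using Q k by (auto simp: K_def)
  have "\<zeta> * Z t - K * (Y t)\<^sup>2 \<le> 0" if \<zeta>: "\<zeta> = 1 \<or> \<zeta> = -1" for \<zeta>
  proof (rule bounded_exp_growth_nonpos[where D="\<lambda>s. \<zeta> * Z s - K * (Y s)\<^sup>2" and a=t, OF k])
    have "continuous_on {0..} (\<lambda>s. \<zeta> * Z s - K * (Y s)\<^sup>2)"
      using s by (intro continuous_intros) (auto simp: clamped_sol_def)
    then show "continuous_on {t..} (\<lambda>s. \<zeta> * Z s - K * (Y s)\<^sup>2)" by (rule continuous_on_subset) (use t in auto)
  next
    fix x assume "t < x"
    then have x: "0 < x" using t by simp
    note ins = inward_inside[OF i s y0 less_imp_le[OF x]]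
    let ?V = "- lam * Y x + A (Y x) (Z x)"
    show "((\<lambda>s. \<zeta> * Z s - K * (Y s)\<^sup>2) has_real_derivative
       \<zeta> * (k * Z x + B (Y x) (Z x)) - K * (2 * Y x * (- lam * Y x + A (Y x) (Z x)))) (at x)"
      using s x ins unfolding clamped_sol_def by (auto intro!: derivative_eq_intros)
    have "\<bar>B (Y x) (Z x)\<bar> \<le> Q * ((Y x)\<^sup>2 + (Z x)\<^sup>2)" by (rule B_quad[OF ins(2,4)])
    also have "\<dots> \<le> Q * ((Y x)\<^sup>2 + (Y x)\<^sup>2)"
    proof -
      have "\<bar>Z x\<bar> \<le> \<bar>Y x\<bar>" using ins(3) m by (meson abs_ge_zero mult_left_le_one_le order_trans less_imp_le)
      then show ?thesis using Q by (intro mult_left_mono add_mono) (auto simp: abs_le_square_iff)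
    qed
    finally have "- (2 * (Q * (Y x)\<^sup>2)) \<le> \<zeta> * B (Y x) (Z x)" using \<zeta> by (auto simp: algebra_simps)
    moreover have "Y x * ?V \<le> 0"
    proof -
      have "\<sigma> * ?V \<le> - (c * (Y x)\<^sup>2)" by (rule inward_speed[OF i s y0]) (use x in simp)
      also have "\<dots> \<le> 0" using i by (simp add: inward_def)
      finally have "\<sigma> * ?V \<le> 0" .
      moreover have "0 \<le> \<sigma> * Y x" using inward_abs[OF i s y0(1), of x] x by (metis abs_ge_zero less_imp_le)
      ultimately have "(\<sigma> * Y x) * (\<sigma> * ?V) \<le> 0" by (rule mult_nonneg_nonpos[rotated])
      moreover have "(\<sigma> * Y x) * (\<sigma> * ?V) = (\<sigma> * \<sigma>) * (Y x * ?V)" by (simp only: mult_ac)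
      moreover have "\<sigma> * \<sigma> = 1" using i by (auto simp: inward_def)
      ultimately show ?thesis by (simp only: mult_1_left)
    qed
    then have "K * (2 * Y x * ?V) \<le> 0" using K by (simp add: mult_nonneg_nonpos mult.assoc)
    moreover have "k * (\<zeta> * Z x - K * (Y x)\<^sup>2) = \<zeta> * (k * Z x) - 2 * (Q * (Y x)\<^sup>2)"
    proof -
      have "k * (\<zeta> * Z x - K * (Y x)\<^sup>2) = \<zeta> * (k * Z x) - (k * K) * (Y x)\<^sup>2" by (simp add: algebra_simps)
      then show ?thesis by (simp add: K)
    qed
    ultimately show "k * (\<zeta> * Z x - K * (Y x)\<^sup>2) \<le> \<zeta> * (k * Z x + B (Y x) (Z x)) - K * (2 * Y x * (- lam * Y x + A (Y x) (Z x)))"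
      by (simp add: distrib_left)
  next
    fix x assume "t \<le> x"
    then have "\<bar>Z x\<bar> \<le> m * r" using inward_inside(4)[OF i s y0, of x] t by simp
    then have "\<zeta> * Z x \<le> m * r" using \<zeta> by auto
    moreover have "0 \<le> K * (Y x)\<^sup>2" using K by simp
    ultimately show "\<zeta> * Z x - K * (Y x)\<^sup>2 \<le> m * r" by simp
  qed
  from this[of 1] this[of "-1"] show ?thesis unfolding K_def[symmetric] by auto
qed

lemma graph_parabola:
  assumes i: "inward \<sigma> c" and y: "0 \<le> \<sigma> * y" "\<bar>y\<bar> \<le> r"
  shows "\<bar>graph y\<bar> \<le> 2 * Q / k * y\<^sup>2"
proof -
  obtain Y Z where "Y 0 = y" "clamped_sol Y Z" by (rule clamped_sol_exists)
  then show ?thesis using inward_parabola[OF i, of Y Z 0] graph_eq[of Y Z 0] y by simp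
qed

text \<open>One orbit started at the edge \<sigma> r covers the whole open side: it is strictly
  monotone in y and tends to 0. With g the inverse of its Y, the graph equals Z composed with g
  there, and the inverse function rule gives the slope z' / y'. The fixed point never has to be
  differentiated in its parameter.\<close>

lemma graph_derivative:
  assumes i: "inward \<sigma> c" and y: "0 < \<sigma> * y" "\<bar>y\<bar> < r"
  shows "(graph has_real_derivative (k * graph y + B y (graph y)) / (- lam * y + A y (graph y))) (at y)"
proof -
  have \<sigma>: "\<sigma> = 1 \<or> \<sigma> = -1" and c: "0 < c" using i by (auto simp: inward_def)
  have \<sigma>r: "\<sigma> * (\<sigma> * r) = r" using \<sigma> by auto
  obtain Y Z where Y0: "Y 0 = \<sigma> * r" and s: "clamped_sol Y Z" by (rule clamped_sol_exists)
  have y0: "0 \<le> \<sigma> * Y 0" "\<bar>Y 0\<bar> \<le> r" "0 < \<sigma> * Y 0" using Y0 r \<sigma> by auto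
  have pos: "0 < \<sigma> * Y x" if "0 \<le> x" for x by (rule clamped_sol_pos[OF s \<sigma> y0(3) that])
  have cont: "continuous_on {0..} Y" using s by (simp add: clamped_sol_def)
  have der: "(Y has_real_derivative - lam * Y x + A (Y x) (Z x)) (at x)"
    "(Z has_real_derivative k * Z x + B (Y x) (Z x)) (at x)" if "0 < x" for x
    using s inward_inside(5,6)[OF i s y0(1,2), of x] that by (auto simp: clamped_sol_def)
  have neg: "\<sigma> * (- lam * Y x + A (Y x) (Z x)) < 0" if "0 \<le> x" for x
  proof -
    have "0 < c * (Y x)\<^sup>2" using c pos[OF that] by (intro mult_pos_pos) auto
    then show ?thesis using inward_speed[OF i s y0(1,2) that] by linarith
  qed
  have strict: "\<sigma> * Y b < \<sigma> * Y a" if ab: "0 \<le> a" "a < b" for a b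
  proof (rule DERIV_neg_imp_decreasing_open[OF ab(2)])
    fix x assume "a < x" "x < b"
    then have x: "0 < x" using ab by simp
    then show "\<exists>y. ((\<lambda>a. \<sigma> * Y a) has_real_derivative y) (at x) \<and> y < 0"
      using DERIV_cmult[OF der(1)[OF x], of \<sigma>] neg[of x] by auto
  next
    show "continuous_on {a..b} (\<lambda>a. \<sigma> * Y a)"
      using ab by (intro continuous_intros continuous_on_subset[OF cont]) auto
  qed
  have inj: "a = b" if "0 \<le> a" "0 \<le> b" "Y a = Y b" for a b
    using strict[of a b] strict[of b a] that by (metis less_irrefl linorder_neqE)
  have surj: "\<exists>t. 0 < t \<and> Y t = v" if v: "0 < \<sigma> * v" "\<sigma> * v < r" for v
  proof -
    have "((\<lambda>t. \<sigma> * Y t) \<longlongrightarrow> \<sigma> * 0) at_top" by (intro tendsto_intros inward_tendsto[OF i s y0(1,2)])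
    then have "eventually (\<lambda>t. \<sigma> * Y t < \<sigma> * v) at_top" using v by (intro order_tendstoD(2)) auto
    then have "eventually (\<lambda>t. \<sigma> * Y t < \<sigma> * v \<and> 0 \<le> t) at_top" using eventually_ge_at_top by (rule eventually_conj)
    then obtain T where T: "\<sigma> * Y T < \<sigma> * v" "0 \<le> T" by (auto dest!: eventually_happens)
    have "continuous_on {0..T} (\<lambda>a. \<sigma> * Y a)"
      by (intro continuous_intros continuous_on_subset[OF cont]) auto
    then obtain t where t: "0 \<le> t" "t \<le> T" "\<sigma> * Y t = \<sigma> * v"
      using IVT2'[of "\<lambda>a. \<sigma> * Y a" T "\<sigma> * v" 0] T v Y0 \<sigma>r by auto
    then have "Y t = v" "t \<noteq> 0" using \<sigma> v Y0 \<sigma>r by auto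
    then show ?thesis using t by (intro exI[of _ t]) auto
  qed
  define g where "g v = (SOME t. 0 \<le> t \<and> Y t = v)" for v
  have gY: "g (Y t) = t" if "0 \<le> t" for t
  proof -
    have "0 \<le> g (Y t) \<and> Y (g (Y t)) = Y t" unfolding g_def by (rule someI[of _ t]) (use that in simp)
    then show ?thesis using inj[of "g (Y t)" t] that by simp
  qed
  have Yg: "Y (g v) = v" "0 < g v" if "0 < \<sigma> * v" "\<sigma> * v < r" for v
    using surj[OF that] gY by force+
  have \<sigma>y: "\<sigma> * y < r" using y \<sigma> by auto
  note t0 = Yg[OF y(1) \<sigma>y]
  have "isCont g (Y (g y))"
  proof (rule isCont_inverse_function[where d="g y / 2" and f=Y and g=g and x="g y"])
    show "0 < g y / 2" using t0 by simp
    fix z assume "\<bar>z - g y\<bar> \<le> g y / 2"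
    then have "0 < z" using t0 by linarith
    then show "g (Y z) = z" "isCont Y z" using gY DERIV_isCont[OF der(1)] by auto
  qed
  then have "isCont g y" using t0 by simp
  define a where "a = min 0 (\<sigma> * r)"
  define b where "b = max 0 (\<sigma> * r)"
  have ab: "a < v \<and> v < b \<longleftrightarrow> 0 < \<sigma> * v \<and> \<sigma> * v < r" for v
    using \<sigma> r by (auto simp: a_def b_def)
  have yab: "a < y" "y < b" using ab[of y] y(1) \<sigma>y by auto
  have neq: "- lam * Y (g y) + A (Y (g y)) (Z (g y)) \<noteq> 0" using neg[of "g y"] t0 by force
  have "(g has_real_derivative inverse (- lam * Y (g y) + A (Y (g y)) (Z (g y)))) (at y)"
    by (rule DERIV_inverse_function[where f=Y and g=g and x=y, OF der(1)[OF t0(2)] neq yab])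
      (use \<open>isCont g y\<close> ab Yg in auto)
  from DERIV_chain2[OF der(2)[OF t0(2)] this]
  have 1: "((\<lambda>v. Z (g v)) has_real_derivative (k * Z (g y) + B (Y (g y)) (Z (g y))) *
     inverse (- lam * Y (g y) + A (Y (g y)) (Z (g y)))) (at y)" .
  have gr: "Z (g v) = graph v" if "a < v" "v < b" for v
    using graph_eq[OF s, of "g v"] Yg[of v] ab[of v] that by simp
  have "((\<lambda>v. Z (g v)) has_real_derivative (k * graph y + B y (graph y)) / (- lam * y + A y (graph y))) (at y)"
    using 1 unfolding t0 gr[OF yab] by (simp add: divide_inverse)
  then show ?thesis
    by (rule has_field_derivative_transform_within_open[where S="{a<..<b}"]) (use yab gr in auto)
qed

end

section \<open>Diagonalisation of the planar field\<close>

lemma abs_mult_diff_le: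
  fixes x y x' y' :: real
  assumes "\<bar>x\<bar> \<le> s" "\<bar>y'\<bar> \<le> t"
  shows "\<bar>x * y - x' * y'\<bar> \<le> s * \<bar>y - y'\<bar> + t * \<bar>x - x'\<bar>"
proof -
  have "x * y - x' * y' = x * (y - y') + y' * (x - x')" by (simp add: algebra_simps)
  then have "\<bar>x * y - x' * y'\<bar> \<le> \<bar>x\<bar> * \<bar>y - y'\<bar> + \<bar>y'\<bar> * \<bar>x - x'\<bar>"
    by (metis abs_mult abs_triangle_ineq)
  also have "\<dots> \<le> s * \<bar>y - y'\<bar> + t * \<bar>x - x'\<bar>" using assms by (intro add_mono mult_right_mono) auto
  finally show ?thesis .
qed

text \<open>\<open>dl\<close> and \<open>du\<close> are the coordinates along the eigenvectors \<open>base1\<close> (eigenvalue \<open>l2 \<le> 0\<close>) and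
  \<open>base2\<close> (eigenvalue \<open>l1 > 0\<close>) of the linear part; \<open>beta\<close>, defined later, is the coefficient of the quadratic
  part along the kernel when \<open>l2 = 0\<close>.\<close>

locale saddle_field =
  fixes a b c d q1 q2 q3 q4 :: real and p :: "real^2"
  assumes b: "0 < b" and c: "0 < c" and d: "0 < d" and det: "a * d \<le> b * c"
begin

definition fld :: "real^2 \<Rightarrow> real^2" where
  "fld w = vector [a * (w$1 - p$1) + b * (w$2 - p$2) + q1 * (w$1 - p$1)\<^sup>2,
     c * (w$1 - p$1) + d * (w$2 - p$2)
       + (q2 * (w$1 - p$1)\<^sup>2 + q3 * (w$1 - p$1) * (w$2 - p$2) + q4 * (w$1 - p$1)^3)]"

definition "disc = sqrt ((a - d)\<^sup>2 + 4 * b * c)"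
definition "l1 = (a + d + disc) / 2"
definition "l2 = (a + d - disc) / 2"

lemma disc: "disc\<^sup>2 = (a - d)\<^sup>2 + 4 * b * c" "0 < disc" "\<bar>a - d\<bar> < disc"
proof -
  have bc: "0 < 4 * b * c" using b c by simp
  then show 1: "disc\<^sup>2 = (a - d)\<^sup>2 + 4 * b * c" by (simp add: disc_def)
  have "\<bar>a - d\<bar> = sqrt ((a - d)\<^sup>2)" by simp
  also have "\<dots> < disc" unfolding disc_def using bc by (intro real_sqrt_less_mono) simp
  finally show "\<bar>a - d\<bar> < disc" .
  then show "0 < disc" by linarith
qed

lemma eigen: "l1 + l2 = a + d" "l1 - l2 = disc" "l1 * l2 = a * d - b * c"
  "(l1 - a) * (l1 - d) = b * c" "(l2 - a) * (l2 - d) = b * c"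
  using disc(1) by (simp_all add: l1_def l2_def field_simps power2_eq_square)

lemma eigen_sign: "0 < l1" "l2 \<le> 0" "a < l1" "l2 < a" "d < l1"
proof -
  show 1: "a < l1" "l2 < a" "d < l1" using disc(3) by (simp_all add: l1_def l2_def abs_less_iff)
  show 2: "0 < l1" using 1 d by linarith
  show "l2 \<le> 0"
  proof (rule ccontr)
    assume "\<not> l2 \<le> 0"
    then have "0 < l1 * l2" using 2 by simp
    then show False using eigen(3) det by simp
  qed
qed

definition dl :: "real^2 \<Rightarrow> real" where "dl v = ((l1 - a) * v$1 - b * v$2) / (b * disc)"
definition du :: "real^2 \<Rightarrow> real" where "du v = ((a - l2) * v$1 + b * v$2) / (b * disc)"
definition pos :: "real \<Rightarrow> real \<Rightarrow> real^2" where
  "pos y z = p + vector [b * (y + z), (l2 - a) * y + (l1 - a) * z]"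

definition nl1 :: "real \<Rightarrow> real \<Rightarrow> real" where "nl1 y z = q1 * (b * (y + z))\<^sup>2"
definition nl2 :: "real \<Rightarrow> real \<Rightarrow> real" where
  "nl2 y z = q2 * (b * (y + z))\<^sup>2 + q3 * (b * (y + z)) * ((l2 - a) * y + (l1 - a) * z) + q4 * (b * (y + z))^3"
definition "A y z = ((l1 - a) * nl1 y z - b * nl2 y z) / (b * disc)"
definition "B y z = ((a - l2) * nl1 y z + b * nl2 y z) / (b * disc)"

lemma bounded_linear_dl: "bounded_linear dl" and bounded_linear_du: "bounded_linear du"
  unfolding dl_def[abs_def] du_def[abs_def]
  by (auto intro!: bounded_linear_intros bounded_linear_divide[THEN bounded_linear_compose] bounded_linear_vec_nth
      bounded_linear_sub bounded_linear_add bounded_linear_const_mult)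

lemma dl_pos: "dl (pos y z - p) = y" and du_pos: "du (pos y z - p) = z"
proof -
  have "(l1 - a) * (b * (y + z)) - b * ((l2 - a) * y + (l1 - a) * z) = (b * disc) * y"
    "(a - l2) * (b * (y + z)) + b * ((l2 - a) * y + (l1 - a) * z) = (b * disc) * z"
    unfolding eigen(2)[symmetric] by (simp_all add: algebra_simps)
  then show "dl (pos y z - p) = y" "du (pos y z - p) = z"
    using b disc(2) by (simp_all add: dl_def du_def pos_def)
qed

lemma pos_dl_du: "pos (dl (w - p)) (du (w - p)) = w"
proof -
  have bd: "b * disc \<noteq> 0" "disc \<noteq> 0" using b disc(2) by auto
  define x where "x = (w - p)$1"
  define y where "y = (w - p)$2"
  have sum: "dl (w - p) + du (w - p) = x / b"
  proof -
    have "dl (w - p) + du (w - p) = ((l1 - a) * x - b * y + ((a - l2) * x + b * y)) / (b * disc)"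
      unfolding dl_def du_def x_def y_def by (rule add_divide_distrib[symmetric])
    also have "(l1 - a) * x - b * y + ((a - l2) * x + b * y) = x * disc"
      unfolding eigen(2)[symmetric] by (simp add: algebra_simps)
    finally show ?thesis using bd by simp
  qed
  have "(l2 - a) * dl (w - p) + (l1 - a) * du (w - p) = y"
  proof -
    have "(l2 - a) * dl (w - p) + (l1 - a) * du (w - p)
        = ((l2 - a) * ((l1 - a) * x - b * y) + (l1 - a) * ((a - l2) * x + b * y)) / (b * disc)"
      unfolding dl_def du_def x_def y_def times_divide_eq_right by (rule add_divide_distrib[symmetric])
    also have "(l2 - a) * ((l1 - a) * x - b * y) + (l1 - a) * ((a - l2) * x + b * y) = y * (b * disc)"
      unfolding eigen(2)[symmetric] by (simp add: algebra_simps)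
    finally show ?thesis using bd by simp
  qed
  then show ?thesis using sum b by (simp add: pos_def vec_eq_iff forall_2 x_def y_def)
qed

text \<open>\<open>dl\<close> and \<open>du\<close> are left eigenvectors of the linear part, so the
  linear terms decouple; the product b c is eliminated with the characteristic equation in the form
  \<open>eigen(4,5)\<close>.\<close>

lemma dl_fld: "dl (fld w) = l2 * dl (w - p) + A (dl (w - p)) (du (w - p))"
  and du_fld: "du (fld w) = l1 * du (w - p) + B (dl (w - p)) (du (w - p))"
proof -
  define Y where "Y = dl (w - p)"
  define Z where "Z = du (w - p)"
  define x where "x = (w - p)$1"
  define y where "y = (w - p)$2"
  have w: "w = pos Y Z" by (simp add: Y_def Z_def pos_dl_du)
  have xy: "x = b * (Y + Z)" "y = (l2 - a) * Y + (l1 - a) * Z" by (auto simp: x_def y_def w pos_def)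
  have f: "fld w $ 1 = a * x + b * y + nl1 Y Z" "fld w $ 2 = c * x + d * y + nl2 Y Z"
    by (simp_all add: fld_def nl1_def nl2_def xy[symmetric]) (simp_all add: x_def y_def)
  have YZ: "Y = ((l1 - a) * x - b * y) / (b * disc)" "Z = ((a - l2) * x + b * y) / (b * disc)"
    by (simp_all add: Y_def Z_def dl_def du_def x_def y_def)
  have "(l1 - a) * (a * x + b * y) - b * (c * x + d * y) = ((l1 - a) * a - b * c) * x + b * (l1 - a - d) * y"
    by (simp add: algebra_simps)
  also have "(l1 - a) * a - b * c = (a + d - l1) * (l1 - a)"
    unfolding eigen(4)[symmetric] by (simp add: algebra_simps)
  also have "a + d - l1 = l2" using eigen(1) by simp
  also have "l1 - a - d = - l2" using eigen(1) by simp
  finally have 1: "(l1 - a) * (a * x + b * y) - b * (c * x + d * y) = l2 * ((l1 - a) * x - b * y)"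
    by (simp add: algebra_simps)
  have "(a - l2) * (a * x + b * y) + b * (c * x + d * y) = ((a - l2) * a + b * c) * x + b * (a + d - l2) * y"
    by (simp add: algebra_simps)
  also have "(a - l2) * a + b * c = (a + d - l2) * (a - l2)"
    unfolding eigen(5)[symmetric] by (simp add: algebra_simps)
  also have "a + d - l2 = l1" using eigen(1) by simp
  finally have 2: "(a - l2) * (a * x + b * y) + b * (c * x + d * y) = l1 * ((a - l2) * x + b * y)"
    by (simp add: algebra_simps)
  have "dl (fld w) = (((l1 - a) * (a * x + b * y) - b * (c * x + d * y)) + ((l1 - a) * nl1 Y Z - b * nl2 Y Z)) / (b * disc)"
    unfolding dl_def f by (simp add: algebra_simps)
  also have "\<dots> = l2 * Y + A Y Z" unfolding 1 A_def YZ(1) times_divide_eq_right by (rule add_divide_distrib)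
  finally show "dl (fld w) = l2 * dl (w - p) + A (dl (w - p)) (du (w - p))" by (simp add: Y_def Z_def)
  have "du (fld w) = (((a - l2) * (a * x + b * y) + b * (c * x + d * y)) + ((a - l2) * nl1 Y Z + b * nl2 Y Z)) / (b * disc)"
    unfolding du_def f by (simp add: algebra_simps)
  also have "\<dots> = l1 * Z + B Y Z" unfolding 2 B_def YZ(2) times_divide_eq_right by (rule add_divide_distrib)
  finally show "du (fld w) = l1 * du (w - p) + B (dl (w - p)) (du (w - p))" by (simp add: Y_def Z_def)
qed

lemma coordinate_derivative:
  assumes "(W has_vector_derivative fld (W t)) (at t within S)"
  shows "((\<lambda>s. dl (W s - p)) has_real_derivative
      - (- l2) * dl (W t - p) + A (dl (W t - p)) (du (W t - p))) (at t within S)"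
    "((\<lambda>s. du (W s - p)) has_real_derivative
      l1 * du (W t - p) + B (dl (W t - p)) (du (W t - p))) (at t within S)"
proof -
  have "((\<lambda>s. W s - p) has_vector_derivative fld (W t)) (at t within S)"
    using has_vector_derivative_diff[OF assms has_vector_derivative_const[of p]] by simp
  from bounded_linear.has_vector_derivative[OF bounded_linear_dl this]
    bounded_linear.has_vector_derivative[OF bounded_linear_du this]
  show "((\<lambda>s. dl (W s - p)) has_real_derivative
      - (- l2) * dl (W t - p) + A (dl (W t - p)) (du (W t - p))) (at t within S)"
    "((\<lambda>s. du (W s - p)) has_real_derivative
      l1 * du (W t - p) + B (dl (W t - p)) (du (W t - p))) (at t within S)"
    by (simp_all add: has_real_derivative_iff_has_vector_derivative dl_fld du_fld)
qed

definition base1 :: "real^2" where "base1 = vector [b, l2 - a]"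
definition base2 :: "real^2" where "base2 = vector [b, l1 - a]"

lemma pos_base: "pos y z = p + (y *\<^sub>R base1 + z *\<^sub>R base2)"
  by (simp add: pos_def base1_def base2_def vec_eq_iff forall_2 algebra_simps)

lemma pos_derivative:
  assumes "(Y has_real_derivative - (- l2) * Y t + A (Y t) (Z t)) (at t within S)"
    "(Z has_real_derivative l1 * Z t + B (Y t) (Z t)) (at t within S)"
  shows "((\<lambda>s. pos (Y s) (Z s)) has_vector_derivative fld (pos (Y t) (Z t))) (at t within S)"
proof -
  define v where "v = fld (pos (Y t) (Z t))"
  have v: "v = dl v *\<^sub>R base1 + du v *\<^sub>R base2"
    using pos_dl_du[of "v + p"] by (simp add: pos_base)
  have "((\<lambda>s. pos (Y s) (Z s)) has_vector_derivative
      (0 + ((- (- l2) * Y t + A (Y t) (Z t)) *\<^sub>R base1 + (l1 * Z t + B (Y t) (Z t)) *\<^sub>R base2))) (at t within S)"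
    unfolding pos_base
    by (intro has_vector_derivative_add has_vector_derivative_const
        has_vector_derivative_scaleR[where g="\<lambda>_. base1" and g'=0, simplified]
        has_vector_derivative_scaleR[where g="\<lambda>_. base2" and g'=0, simplified]
        assms[unfolded has_real_derivative_iff_has_vector_derivative])
      (use assms in auto)
  then show ?thesis
    unfolding v_def[symmetric] by (subst v) (simp add: v_def dl_fld du_fld dl_pos du_pos)
qed

lemma coordinate_norms:
  obtains H where "1 \<le> H" "\<And>v. \<bar>dl v\<bar> \<le> H * norm v" "\<And>v. \<bar>du v\<bar> \<le> H * norm v"
    "\<And>y z. norm (pos y z - p) \<le> H * (\<bar>y\<bar> + \<bar>z\<bar>)"
proof -
  obtain K1 where K1: "\<And>v. norm (dl v) \<le> norm v * K1" using bounded_linear.bounded[OF bounded_linear_dl] by blast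
  obtain K2 where K2: "\<And>v. norm (du v) \<le> norm v * K2" using bounded_linear.bounded[OF bounded_linear_du] by blast
  define H where "H = 1 + \<bar>K1\<bar> + \<bar>K2\<bar> + norm base1 + norm base2"
  have H: "1 \<le> H" "K1 \<le> H" "K2 \<le> H" "norm base1 \<le> H" "norm base2 \<le> H"
    unfolding H_def using norm_ge_zero[of base1] norm_ge_zero[of base2] by linarith+
  show ?thesis
  proof
    show "1 \<le> H" by (rule H)
    show "\<bar>dl v\<bar> \<le> H * norm v" for v
      using order_trans[OF K1[of v] mult_left_mono[OF H(2) norm_ge_zero[of v]]] by (simp add: mult.commute)
    show "\<bar>du v\<bar> \<le> H * norm v" for v
      using order_trans[OF K2[of v] mult_left_mono[OF H(3) norm_ge_zero[of v]]] by (simp add: mult.commute)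
    fix y z
    have "norm (pos y z - p) \<le> norm (y *\<^sub>R base1) + norm (z *\<^sub>R base2)" 
      using norm_triangle_ineq[of "y *\<^sub>R base1" "z *\<^sub>R base2"] by (simp add: pos_base)
    also have "\<dots> \<le> \<bar>y\<bar> * H + \<bar>z\<bar> * H" using H by (auto intro!: add_mono mult_left_mono)
    finally show "norm (pos y z - p) \<le> H * (\<bar>y\<bar> + \<bar>z\<bar>)" by (simp add: algebra_simps)
  qed
qed

text \<open>All terms have degree two or three, so on a box of size \<rho> the Lipschitz constant is
  of order \<rho>; the cubic term is absorbed by \<rho> \<le> 1. Keeping \<rho> variable serves
  twice: to make the constant small by shrinking the box, and to read off quadratic bounds at a
  single point.\<close>

lemma nonlinearity_lipschitz:
  obtains C where "0 < C"
    "\<And>\<rho> y z y' z'. \<lbrakk>\<rho> \<le> 1; \<bar>y\<bar> \<le> \<rho>; \<bar>z\<bar> \<le> \<rho>; \<bar>y'\<bar> \<le> \<rho>; \<bar>z'\<bar> \<le> \<rho>\<rbrakk> \<Longrightarrow>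
       \<bar>A y z - A y' z'\<bar> \<le> C * \<rho> * (\<bar>y - y'\<bar> + \<bar>z - z'\<bar>) \<and>
       \<bar>B y z - B y' z'\<bar> \<le> C * \<rho> * (\<bar>y - y'\<bar> + \<bar>z - z'\<bar>)"
proof -
  define H where "H = b + \<bar>l2 - a\<bar> + \<bar>l1 - a\<bar>"
  have H: "0 < H" "b \<le> H" "\<bar>l2 - a\<bar> \<le> H" "\<bar>l1 - a\<bar> \<le> H" using b by (auto simp: H_def)
  define K where "K = (\<bar>q1\<bar> + \<bar>q2\<bar> + \<bar>q3\<bar>) * (4 * H\<^sup>2) + \<bar>q4\<bar> * (12 * H^3)"
  have K: "0 \<le> K" "\<bar>q1\<bar> * (4 * H\<^sup>2) \<le> K" using H by (auto simp: K_def distrib_right)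
  define C where "C = 1 + H / (b * disc) * (2 * K)"
  have bd: "0 < b * disc" using b disc by simp
  show ?thesis
  proof
    show "0 < C" using H K bd by (auto simp: C_def intro!: add_pos_nonneg)
    fix \<rho> y z y' z' :: real
    assume rho: "\<rho> \<le> 1" and yz: "\<bar>y\<bar> \<le> \<rho>" "\<bar>z\<bar> \<le> \<rho>" "\<bar>y'\<bar> \<le> \<rho>" "\<bar>z'\<bar> \<le> \<rho>"
    have rho0: "0 \<le> \<rho>" using yz by linarith
    define D where "D = \<bar>y - y'\<bar> + \<bar>z - z'\<bar>"
    have D: "0 \<le> D" by (simp add: D_def)
    define t where "t = 2 * H * \<rho>"
    have t: "0 \<le> t" "t\<^sup>2 \<le> 4 * H\<^sup>2 * \<rho>"
    proof -
      show "0 \<le> t" using H rho0 by (simp add: t_def)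
      have "\<rho> * \<rho> \<le> \<rho>" using rho rho0 by (simp add: mult_left_le)
      then have "4 * H\<^sup>2 * (\<rho> * \<rho>) \<le> 4 * H\<^sup>2 * \<rho>" by (intro mult_left_mono) auto
      then show "t\<^sup>2 \<le> 4 * H\<^sup>2 * \<rho>" by (simp add: t_def power2_eq_square algebra_simps)
    qed
    have lin: "\<bar>g * u + h * v\<bar> \<le> H * (\<bar>u\<bar> + \<bar>v\<bar>)" if "\<bar>g\<bar> \<le> H" "\<bar>h\<bar> \<le> H" for g h u v :: real
    proof -
      have "\<bar>g * u + h * v\<bar> \<le> \<bar>g\<bar> * \<bar>u\<bar> + \<bar>h\<bar> * \<bar>v\<bar>" by (metis abs_mult abs_triangle_ineq)
      also have "\<dots> \<le> H * \<bar>u\<bar> + H * \<bar>v\<bar>" using that by (intro add_mono mult_right_mono) auto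
      finally show ?thesis by (simp add: distrib_left)
    qed
    have lin_t: "\<bar>g * u + h * v\<bar> \<le> t" if "\<bar>g\<bar> \<le> H" "\<bar>h\<bar> \<le> H" "\<bar>u\<bar> \<le> \<rho>" "\<bar>v\<bar> \<le> \<rho>" for g h u v :: real
    proof -
      have "H * (\<bar>u\<bar> + \<bar>v\<bar>) \<le> H * (\<rho> + \<rho>)" using that H by (intro mult_left_mono add_mono) auto
      then show ?thesis using lin[OF that(1,2), of u v] by (simp add: t_def)
    qed
    have bH: "\<bar>b\<bar> \<le> H" using b H by simp
    define u where "u = b * (y + z)"
    define u' where "u' = b * (y' + z')"
    define v where "v = (l2 - a) * y + (l1 - a) * z"
    define v' where "v' = (l2 - a) * y' + (l1 - a) * z'"
    have ub: "\<bar>u\<bar> \<le> t" "\<bar>u'\<bar> \<le> t" "\<bar>v\<bar> \<le> t" "\<bar>v'\<bar> \<le> t"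
      using lin_t[OF bH bH yz(1,2)] lin_t[OF bH bH yz(3,4)] lin_t[OF H(3,4) yz(1,2)] lin_t[OF H(3,4) yz(3,4)]
      by (simp_all add: u_def u'_def v_def v'_def distrib_left)
    have ud: "\<bar>u - u'\<bar> \<le> H * D" "\<bar>v - v'\<bar> \<le> H * D"
      using lin[OF bH bH, of "y - y'" "z - z'"] lin[OF H(3,4), of "y - y'" "z - z'"]
      by (simp_all add: u_def u'_def v_def v'_def D_def algebra_simps)
    have quad: "\<bar>s * w - s' * w'\<bar> \<le> 4 * H\<^sup>2 * (\<rho> * D)"
      if "\<bar>s\<bar> \<le> t" "\<bar>w'\<bar> \<le> t" "\<bar>s - s'\<bar> \<le> H * D" "\<bar>w - w'\<bar> \<le> H * D" for s w s' w'
    proof -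
      have "\<bar>s * w - s' * w'\<bar> \<le> t * \<bar>w - w'\<bar> + t * \<bar>s - s'\<bar>" by (rule abs_mult_diff_le[OF that(1,2)])
      also have "\<dots> \<le> t * (H * D) + t * (H * D)" using that t by (intro add_mono mult_left_mono) auto
      also have "\<dots> = 4 * H\<^sup>2 * (\<rho> * D)" by (simp add: t_def power2_eq_square)
      finally show ?thesis .
    qed
    have uu: "\<bar>u\<^sup>2 - u'\<^sup>2\<bar> \<le> 4 * H\<^sup>2 * (\<rho> * D)" unfolding power2_eq_square[of u] power2_eq_square[of u']
      by (rule quad) (rule ub ud)+
    have uv: "\<bar>u * v - u' * v'\<bar> \<le> 4 * H\<^sup>2 * (\<rho> * D)" by (rule quad) (rule ub ud)+
    have uuu: "\<bar>u^3 - u'^3\<bar> \<le> 12 * H^3 * (\<rho> * D)"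
    proof -
      have u2: "\<bar>u'\<^sup>2\<bar> \<le> t\<^sup>2" using ub by (simp add: abs_le_square_iff[symmetric] t(1))
      have "\<bar>u * u\<^sup>2 - u' * u'\<^sup>2\<bar> \<le> t * \<bar>u\<^sup>2 - u'\<^sup>2\<bar> + t\<^sup>2 * \<bar>u - u'\<bar>" by (rule abs_mult_diff_le[OF ub(1) u2])
      also have "\<dots> \<le> 2 * H * (4 * H\<^sup>2 * (\<rho> * D)) + 4 * H\<^sup>2 * \<rho> * (H * D)"
        using uu ud t H D rho0 rho by (intro add_mono mult_mono) (auto simp: t_def mult_left_le)
      also have "\<dots> = 12 * H^3 * (\<rho> * D)" by (simp add: power3_eq_cube power2_eq_square)
      finally show ?thesis by (simp add: power3_eq_cube power2_eq_square)
    qed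
    have n1: "\<bar>nl1 y z - nl1 y' z'\<bar> \<le> K * (\<rho> * D)"
    proof -
      have "\<bar>nl1 y z - nl1 y' z'\<bar> = \<bar>q1\<bar> * \<bar>u\<^sup>2 - u'\<^sup>2\<bar>"
        by (simp add: nl1_def u_def[symmetric] u'_def[symmetric] right_diff_distrib[symmetric] abs_mult)
      also have "\<dots> \<le> \<bar>q1\<bar> * (4 * H\<^sup>2 * (\<rho> * D))" using uu by (intro mult_left_mono) auto
      also have "\<dots> = \<bar>q1\<bar> * (4 * H\<^sup>2) * (\<rho> * D)" by simp
      also have "\<dots> \<le> K * (\<rho> * D)" using K rho0 D by (intro mult_right_mono) auto
      finally show ?thesis .
    qed
    have n2: "\<bar>nl2 y z - nl2 y' z'\<bar> \<le> K * (\<rho> * D)"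
    proof -
      have "nl2 y z - nl2 y' z' = q2 * (u\<^sup>2 - u'\<^sup>2) + q3 * (u * v - u' * v') + q4 * (u^3 - u'^3)"
        unfolding nl2_def u_def[symmetric] u'_def[symmetric] v_def[symmetric] v'_def[symmetric]
        by (simp add: algebra_simps)
      then have "\<bar>nl2 y z - nl2 y' z'\<bar> \<le> \<bar>q2\<bar> * \<bar>u\<^sup>2 - u'\<^sup>2\<bar> + \<bar>q3\<bar> * \<bar>u * v - u' * v'\<bar> + \<bar>q4\<bar> * \<bar>u^3 - u'^3\<bar>"
        unfolding abs_mult[symmetric] by linarith
      also have "\<dots> \<le> \<bar>q2\<bar> * (4 * H\<^sup>2 * (\<rho> * D)) + \<bar>q3\<bar> * (4 * H\<^sup>2 * (\<rho> * D)) + \<bar>q4\<bar> * (12 * H^3 * (\<rho> * D))"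
        using uu uv uuu by (intro add_mono mult_left_mono) auto
      also have "\<dots> \<le> K * (\<rho> * D)"
      proof -
        have "0 \<le> \<bar>q1\<bar> * (4 * H\<^sup>2) * (\<rho> * D)" using rho0 D by simp
        then show ?thesis by (simp add: K_def algebra_simps)
      qed
      finally show ?thesis .
    qed
    have comb: "\<bar>(g * s + h * w) / (b * disc)\<bar> \<le> C * \<rho> * D"
      if "\<bar>g\<bar> \<le> H" "\<bar>h\<bar> \<le> H" "\<bar>s\<bar> \<le> K * (\<rho> * D)" "\<bar>w\<bar> \<le> K * (\<rho> * D)" for g h s w
    proof -
      have "\<bar>g * s + h * w\<bar> \<le> H * (\<bar>s\<bar> + \<bar>w\<bar>)" by (rule lin[OF that(1,2)])
      also have "\<dots> \<le> H * (K * (\<rho> * D) + K * (\<rho> * D))" using that H by (intro mult_left_mono add_mono) auto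
      finally have "\<bar>g * s + h * w\<bar> / (b * disc) \<le> H * (K * (\<rho> * D) + K * (\<rho> * D)) / (b * disc)"
        using bd by (intro divide_right_mono) auto
      also have "\<dots> = (C - 1) * (\<rho> * D)" by (simp add: C_def)
      also have "\<dots> \<le> C * (\<rho> * D)" using rho0 D by (intro mult_right_mono) auto
      finally show ?thesis unfolding abs_divide abs_of_pos[OF bd] by (simp only: mult.assoc)
    qed
    have eq: "A y z - A y' z' = ((l1 - a) * (nl1 y z - nl1 y' z') + (- b) * (nl2 y z - nl2 y' z')) / (b * disc)"
      "B y z - B y' z' = ((a - l2) * (nl1 y z - nl1 y' z') + b * (nl2 y z - nl2 y' z')) / (b * disc)"
      unfolding A_def B_def diff_divide_distrib[symmetric] by (simp_all add: algebra_simps)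
    have ab: "\<bar>- b\<bar> \<le> H" "\<bar>a - l2\<bar> \<le> H" using H bH by (simp_all add: abs_minus_commute)
    show "\<bar>A y z - A y' z'\<bar> \<le> C * \<rho> * (\<bar>y - y'\<bar> + \<bar>z - z'\<bar>) \<and>
       \<bar>B y z - B y' z'\<bar> \<le> C * \<rho> * (\<bar>y - y'\<bar> + \<bar>z - z'\<bar>)"
      unfolding D_def[symmetric] eq using comb[OF H(4) ab(1) n1 n2] comb[OF ab(2) bH n1 n2] by (rule conjI)
  qed
qed

lemma nonlinearity_zero: "A 0 0 = 0" "B 0 0 = 0"
  by (simp_all add: A_def B_def nl1_def nl2_def)

lemma center_stable_setup:
  assumes C: "0 < C" "\<And>\<rho> y z y' z'. \<lbrakk>\<rho> \<le> 1; \<bar>y\<bar> \<le> \<rho>; \<bar>z\<bar> \<le> \<rho>; \<bar>y'\<bar> \<le> \<rho>; \<bar>z'\<bar> \<le> \<rho>\<rbrakk> \<Longrightarrow>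
       \<bar>A y z - A y' z'\<bar> \<le> C * \<rho> * (\<bar>y - y'\<bar> + \<bar>z - z'\<bar>) \<and>
       \<bar>B y z - B y' z'\<bar> \<le> C * \<rho> * (\<bar>y - y'\<bar> + \<bar>z - z'\<bar>)"
    and m: "0 < m" "m \<le> 1" and r: "0 < r" "r \<le> 1" "C * r \<le> l1 * m / 16"
  shows "planar_center_stable (- l2) l1 m r (C * r) (2 * C) A B"
proof
  show "0 \<le> - l2" "0 < l1" using eigen_sign by auto
  have mr: "m * r \<le> r" using m r by (simp add: mult_left_le_one_le)
  show "\<bar>A y z - A y' z'\<bar> \<le> C * r * (\<bar>y - y'\<bar> + \<bar>z - z'\<bar>)" "\<bar>B y z - B y' z'\<bar> \<le> C * r * (\<bar>y - y'\<bar> + \<bar>z - z'\<bar>)"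
    if "\<bar>y\<bar> \<le> r" "\<bar>z\<bar> \<le> m * r" "\<bar>y'\<bar> \<le> r" "\<bar>z'\<bar> \<le> m * r" for y z y' z'
    using C(2)[of r y z y' z'] that r mr by auto
  show "\<bar>B y z\<bar> \<le> 2 * C * (y\<^sup>2 + z\<^sup>2)" if yz: "\<bar>y\<bar> \<le> r" "\<bar>z\<bar> \<le> m * r" for y z
  proof -
    \<comment> \<open>The smallest admissible box that contains the point; comparison with the
      origin then turns the Lipschitz bound into a quadratic one.\<close>
    define \<rho> where "\<rho> = max \<bar>y\<bar> \<bar>z\<bar>"
    have "\<bar>B y z - B 0 0\<bar> \<le> C * \<rho> * (\<bar>y - 0\<bar> + \<bar>z - 0\<bar>)"
      using C(2)[of \<rho> y z 0 0] yz mr r by (auto simp: \<rho>_def)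
    also have "\<dots> \<le> C * (\<bar>y\<bar> + \<bar>z\<bar>) * (\<bar>y\<bar> + \<bar>z\<bar>)"
      using C(1) by (intro mult_mono mult_left_mono) (auto simp: \<rho>_def)
    also have "\<dots> = C * (\<bar>y\<bar> + \<bar>z\<bar>)\<^sup>2" by (simp add: power2_eq_square)
    also have "\<dots> \<le> C * (2 * (y\<^sup>2 + z\<^sup>2))"
      using sum_squares_bound[of "\<bar>y\<bar>" "\<bar>z\<bar>"] C(1) by (intro mult_left_mono) (auto simp: power2_sum)
    finally show ?thesis by (simp add: nonlinearity_zero algebra_simps)
  qed
qed (use m r C nonlinearity_zero in auto)

lemma fld_p: "fld p = 0"
  by (simp add: fld_def vec_eq_iff forall_2)

lemma polynomial_function_fld: "polynomial_function fld"
proof -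
  have nth: "real_polynomial_function (\<lambda>w::real^2. w $ i)" for i
    by (rule real_polynomial_function.intros(1)) (rule bounded_linear_vec_nth)
  note poly = real_polynomial_function.intros(2-4) real_polynomial_function_diff real_polynomial_function_power nth
  have "real_polynomial_function (\<lambda>w. fld w \<bullet> axis 1 1)" "real_polynomial_function (\<lambda>w. fld w \<bullet> axis 2 1)"
    unfolding fld_def inner_axis by (simp_all, (intro poly)+)
  then show ?thesis unfolding polynomial_function_iff_Basis_inner
    by (auto simp: Basis_vec_def) (metis exhaust_2)
qed

end

section \<open>Continuous differentiability of the graph\<close>

context planar_center_stable begin

lemma continuous_on_graph_A: "continuous_on {-r..r} (\<lambda>y. A y (graph y))"
  and continuous_on_graph_B: "continuous_on {-r..r} (\<lambda>y. B y (graph y))"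
proof -
  have in_box: "\<bar>y\<bar> \<le> r" "\<bar>graph y\<bar> \<le> m * r" if "y \<in> {-r..r}" for y
  proof -
    show 1: "\<bar>y\<bar> \<le> r" using that by auto
    have "m * \<bar>y\<bar> \<le> m * r" using 1 m by (intro mult_left_mono) auto
    then show "\<bar>graph y\<bar> \<le> m * r" using graph_cone0[of y] by simp
  qed
  have bd: "L * (\<bar>y - y'\<bar> + \<bar>graph y - graph y'\<bar>) \<le> L * (1 + m) * \<bar>y - y'\<bar>" for y y'
  proof -
    have "L * (\<bar>y - y'\<bar> + \<bar>graph y - graph y'\<bar>) \<le> L * (\<bar>y - y'\<bar> + m * \<bar>y - y'\<bar>)"
      using graph_cone[of y y'] L by (intro mult_left_mono) auto
    then show ?thesis by (simp add: algebra_simps)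
  qed
  have nn: "0 \<le> L * (1 + m)" using L m by simp
  show "continuous_on {-r..r} (\<lambda>y. A y (graph y))"
    by (rule lipschitz_on_continuous_on[of "L * (1 + m)"], rule lipschitz_onI[OF _ nn], unfold dist_real_def,
        rule order_trans[OF A_lip bd]) (rule in_box; assumption)+
  show "continuous_on {-r..r} (\<lambda>y. B y (graph y))"
    by (rule lipschitz_on_continuous_on[of "L * (1 + m)"], rule lipschitz_onI[OF _ nn], unfold dist_real_def,
        rule order_trans[OF B_lip bd]) (rule in_box; assumption)+
qed

text \<open>The slope z' / y' of the field on the graph. At y = 0 this is 0 / 0, and the value 0 is
  its limit, as \<open>graph_C1\<close> shows under a linear decay rate.\<close>

definition graph' :: "real \<Rightarrow> real" where
  "graph' y = (if y = 0 then 0 else (k * graph y + B y (graph y)) / (- lam * y + A y (graph y)))"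

lemma graph_derivative_0:
  assumes "inward 1 c" "inward (-1) c"
  shows "(graph has_real_derivative 0) (at 0)"
proof -
  define K where "K = 2 * Q / k"
  have gK: "\<bar>graph y\<bar> \<le> K * y\<^sup>2" if "\<bar>y\<bar> \<le> r" for y
    using graph_parabola[OF assms(1), of y] graph_parabola[OF assms(2), of y] that by (cases "0 \<le> y") (auto simp: K_def)
  have "eventually (\<lambda>h. norm (graph h / h) \<le> K * \<bar>h\<bar>) (at 0)"
    unfolding eventually_at
  proof (intro exI[of _ r] conjI r ballI impI)
    fix h :: real assume h: "h \<noteq> 0 \<and> dist h 0 < r"
    then have "\<bar>graph h\<bar> \<le> K * (\<bar>h\<bar> * \<bar>h\<bar>)" using gK[of h] by (simp add: power2_eq_square)
    then show "norm (graph h / h) \<le> K * \<bar>h\<bar>" using h by (simp add: abs_divide pos_divide_le_eq)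
  qed
  moreover have "((\<lambda>h::real. K * \<bar>h\<bar>) \<longlongrightarrow> 0) (at 0)"
    using tendsto_mult[OF tendsto_const[of K] tendsto_rabs[OF tendsto_ident_at[of 0 UNIV]]] by simp
  ultimately have "((\<lambda>h. graph h / h) \<longlongrightarrow> 0) (at 0)" by (rule Lim_null_comparison)
  then show ?thesis by (simp add: DERIV_def graph_0)
qed

text \<open>The linear decay rate bounds the denominator of the slope below by \<nu> |y|, while the
  numerator is O(y^2) by \<open>graph_parabola\<close> and \<open>B_quad\<close>. The slope is
  therefore O(|y|) and continuous at 0.\<close>

lemma graph_C1:
  assumes i: "inward 1 c" "inward (-1) c" and nu: "0 < \<nu>"
    and fast: "\<And>\<sigma> y z. \<lbrakk>\<sigma> = 1 \<or> \<sigma> = -1; 0 \<le> \<sigma> * y; \<bar>y\<bar> \<le> r; \<bar>z\<bar> \<le> m * \<bar>y\<bar>\<rbrakk> \<Longrightarrow> \<sigma> * (- lam * y + A y z) \<le> - (\<nu> * \<bar>y\<bar>)"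
  shows "\<And>y. \<bar>y\<bar> < r \<Longrightarrow> (graph has_real_derivative graph' y) (at y)"
    and "continuous_on {-r<..<r} graph'"
proof -
  show "(graph has_real_derivative graph' y) (at y)" if "\<bar>y\<bar> < r" for y
    using graph_derivative_0[OF i] graph_derivative[OF i(1), of y] graph_derivative[OF i(2), of y] that
    unfolding graph'_def by (cases y "0::real" rule: linorder_cases) auto
  have den: "\<nu> * \<bar>y\<bar> \<le> \<bar>- lam * y + A y (graph y)\<bar>" if "\<bar>y\<bar> \<le> r" for y
    using fast[of 1 y "graph y"] fast[of "-1" y "graph y"] graph_cone0[of y] that by (cases "0 \<le> y") auto
  have "isCont graph' y" if y: "\<bar>y\<bar> < r" for y
  proof (cases "y = 0")
    case False
    define S where "S = {-r<..<r} - {0::real}"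
    have S: "open S" "y \<in> S" using y False by (auto simp: S_def)
    have "continuous_on S (\<lambda>y. (k * graph y + B y (graph y)) / (- lam * y + A y (graph y)))"
    proof (intro continuous_intros continuous_graph ballI
        continuous_on_subset[OF continuous_on_graph_A] continuous_on_subset[OF continuous_on_graph_B])
      fix x assume x: "x \<in> S"
      then have "0 < \<nu> * \<bar>x\<bar>" using nu by (auto simp: S_def)
      moreover have "\<bar>x\<bar> \<le> r" using x by (simp add: S_def abs_le_iff)
      ultimately show "- lam * x + A x (graph x) \<noteq> 0" using den[of x] by linarith
    qed (auto simp: S_def)
    then have "continuous_on S graph'"
      by (rule continuous_on_eq) (auto simp: graph'_def S_def)
    then show ?thesis using S continuous_on_eq_continuous_at by blast
  next
    case True
    define K where "K = (2 * Q + 2 * Q) / \<nu>"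
    have bd: "norm (graph' h) \<le> K * \<bar>h\<bar>" if h: "\<bar>h\<bar> < r" "h \<noteq> 0" for h
    proof -
      have g: "\<bar>graph h\<bar> \<le> 2 * Q / k * h\<^sup>2"
        using graph_parabola[OF i(1), of h] graph_parabola[OF i(2), of h] h by (cases "0 \<le> h") auto
      have g1: "\<bar>graph h\<bar> \<le> \<bar>h\<bar>"
        using graph_cone0[of h] m by (meson abs_ge_zero less_imp_le mult_left_le_one_le order_trans)
      have "\<bar>graph h\<bar> \<le> m * r" using graph_cone0[of h] h m by (smt (verit) mult_left_mono)
      then have "\<bar>B h (graph h)\<bar> \<le> Q * (h\<^sup>2 + (graph h)\<^sup>2)" using h by (intro B_quad) auto
      also have "\<dots> \<le> Q * (h\<^sup>2 + h\<^sup>2)" using g1 Q by (intro mult_left_mono add_mono) (auto simp: abs_le_square_iff)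
      finally have b: "\<bar>B h (graph h)\<bar> \<le> Q * (h\<^sup>2 + h\<^sup>2)" .
      have "k * \<bar>graph h\<bar> \<le> k * (2 * Q / k * h\<^sup>2)" using g k by (intro mult_left_mono) auto
      then have "\<bar>k * graph h\<bar> \<le> 2 * Q * h\<^sup>2" using k by (simp add: abs_mult)
      then have num: "\<bar>k * graph h + B h (graph h)\<bar> \<le> (2 * Q + 2 * Q) * h\<^sup>2" using b by (simp add: algebra_simps)
      have d: "0 < \<nu> * \<bar>h\<bar>" using nu h by simp
      have "\<bar>graph' h\<bar> = \<bar>k * graph h + B h (graph h)\<bar> / \<bar>- lam * h + A h (graph h)\<bar>"
        using h by (simp add: graph'_def abs_divide)
      also have "\<dots> \<le> ((2 * Q + 2 * Q) * h\<^sup>2) / (\<nu> * \<bar>h\<bar>)"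
        using num den[of h] h d Q by (intro frac_le) auto
      also have "\<dots> = K * \<bar>h\<bar>"
      proof -
        have "h\<^sup>2 / \<bar>h\<bar> = \<bar>h\<bar>" using h by (simp add: power2_eq_square) (metis abs_mult_self_eq nonzero_mult_div_cancel_right abs_eq_0)
        have "((2 * Q + 2 * Q) * h\<^sup>2) / (\<nu> * \<bar>h\<bar>) = (2 * Q + 2 * Q) / \<nu> * (h\<^sup>2 / \<bar>h\<bar>)" by simp
        also note \<open>h\<^sup>2 / \<bar>h\<bar> = \<bar>h\<bar>\<close>
        finally show ?thesis unfolding K_def .
      qed
      finally show ?thesis by simp
    qed
    have "eventually (\<lambda>h. norm (graph' h) \<le> K * \<bar>h\<bar>) (at 0)"
      unfolding eventually_at using bd r by (intro exI[of _ r]) auto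
    moreover have "((\<lambda>h::real. K * \<bar>h\<bar>) \<longlongrightarrow> 0) (at 0)"
      using tendsto_mult[OF tendsto_const[of K] tendsto_rabs[OF tendsto_ident_at[of 0 UNIV]]] by simp
    ultimately have "(graph' \<longlongrightarrow> 0) (at 0)" by (rule Lim_null_comparison)
    then show ?thesis by (simp add: True isCont_def graph'_def)
  qed
  then show "continuous_on {-r<..<r} graph'" by (intro continuous_at_imp_continuous_on) auto
qed

end

text \<open>On a compact time interval both orbits stay in a bounded set, where the polynomial field
  is Lipschitz.\<close>

lemma connects_unique:
  assumes f: "polynomial_function f" and W: "connects f w0 p W" and W': "connects f w0 p' W'" and t: "0 \<le> \<xi>"
  shows "W' \<xi> = W \<xi>"
proof -
  have c: "continuous_on {0..\<xi>} W" "continuous_on {0..\<xi>} W'"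
    using W W' unfolding connects_def by (auto intro: continuous_on_subset)
  have "bounded (W ` {0..\<xi>} \<union> W' ` {0..\<xi>})"
    using compact_continuous_image[OF c(1)] compact_continuous_image[OF c(2)] by (auto intro: compact_imp_bounded)
  then obtain L where L: "L-lipschitz_on (W ` {0..\<xi>} \<union> W' ` {0..\<xi>}) f"
    using polynomial_function_lipschitz[OF f] by blast
  show ?thesis
    by (rule ode_unique_forward[OF L t c(2,1)]) (use W W' t in \<open>auto simp: connects_def\<close>)
qed

text \<open>The constant p is a solution, and all its derivatives vanish. Together with a Lipschitz
  bound this makes every derivative of an orbit at most a multiple of its distance from p.\<close>

lemma lie_derivatives_at_equilibrium:
  assumes "f p = 0"
    and G: "\<And>n W t S. (W has_vector_derivative f (W t)) (at t within S) \<Longrightarrow>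
       ((\<lambda>s. G n (W s)) has_vector_derivative G (Suc n) (W t)) (at t within S)"
  shows "G (Suc n) p = 0"
proof -
  have "((\<lambda>s::real. p) has_vector_derivative f p) (at 0 within UNIV)" using assms(1) by simp
  from G[of "\<lambda>s. p", OF this] have "((\<lambda>s::real. G n p) has_vector_derivative G (Suc n) p) (at 0)" by simp
  moreover have "((\<lambda>s::real. G n p) has_vector_derivative 0) (at 0)" by simp
  ultimately show ?thesis by (rule vector_derivative_unique_at)
qed

section \<open>The linearisation, its eigenvectors and the centre-stable line\<close>

context saddle_field begin

definition lin :: "real^2^2" where "lin = vector [vector [a, b], vector [c, d]]"

lemma lin_nth: "(lin *v v) $ 1 = a * v$1 + b * v$2" "(lin *v v) $ 2 = c * v$1 + d * v$2"
  by (simp_all add: lin_def matrix_vector_mult_def sum_2)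

lemma fld_derivative: "(fld has_derivative (\<lambda>v. lin *v v)) (at p)"
proof -
  have n: "((\<lambda>w. w $ i - p $ i) has_derivative (\<lambda>v. v $ i)) (at p)" for i
    using has_derivative_diff[OF bounded_linear.has_derivative[OF bounded_linear_vec_nth has_derivative_ident] has_derivative_const]
    by (simp add: id_def)
  have 1: "((\<lambda>w. a * (w$1 - p$1) + b * (w$2 - p$2) + q1 * (w$1 - p$1)\<^sup>2) has_derivative (\<lambda>v. (lin *v v) $ 1)) (at p)"
    unfolding lin_nth by (rule n derivative_eq_intros refl | simp)+
  have 2: "((\<lambda>w. c * (w$1 - p$1) + d * (w$2 - p$2)
       + (q2 * (w$1 - p$1)\<^sup>2 + q3 * (w$1 - p$1) * (w$2 - p$2) + q4 * (w$1 - p$1)^3)) has_derivative (\<lambda>v. (lin *v v) $ 2)) (at p)"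
    unfolding lin_nth by (rule n derivative_eq_intros refl | simp)+
  have "((\<lambda>x. fld x \<bullet> i) has_derivative (\<lambda>v. (lin *v v) \<bullet> i)) (at p)" if i: "i \<in> Basis" for i
  proof -
    obtain j where j: "i = axis j 1" using i by (auto simp: Basis_vec_def)
    show ?thesis using 1 2 exhaust_2[of j] unfolding j inner_axis fld_def by auto
  qed
  then show ?thesis by (subst has_derivative_componentwise_within) blast
qed

lemma eigenvalues_lin: "eigenvalues lin = {l1, l2}"
proof (intro equalityI subsetI)
  fix l assume "l \<in> eigenvalues lin"
  then obtain v where v: "v \<noteq> 0" "lin *v v = l *\<^sub>R v" by (auto simp: eigenvalues_def)
  then have eq: "a * v$1 + b * v$2 = l * v$1" "c * v$1 + d * v$2 = l * v$2"
    using lin_nth[of v] by (simp_all add: vec_eq_iff forall_2)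
  have v2: "b * v$2 = (l - a) * v$1" using eq by (simp add: algebra_simps)
  have v1: "v$1 \<noteq> 0"
  proof
    assume 0: "v$1 = 0"
    then have "v$2 = 0" using v2 b by simp
    then show False using v(1) 0 by (simp add: vec_eq_iff forall_2)
  qed
  have "c * v$1 = l * v$2 - d * v$2" using eq by simp
  then have "(b * c) * v$1 = b * (l * v$2 - d * v$2)" by (simp only: mult.assoc)
  also have "\<dots> = (l - d) * (b * v$2)" by (simp add: algebra_simps)
  also have "\<dots> = ((l - a) * (l - d)) * v$1" unfolding v2 by simp
  finally have "b * c = (l - a) * (l - d)" using v1 by simp
  moreover have "(l - l1) * (l - l2) = (l - a) * (l - d) - b * c"
  proof -
    have "(l - l1) * (l - l2) = l * l - (l1 + l2) * l + l1 * l2" by (simp add: algebra_simps)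
    then show ?thesis unfolding eigen(1,3) by (simp add: algebra_simps)
  qed
  ultimately show "l \<in> {l1, l2}" by auto
next
  fix l assume "l \<in> {l1, l2}"
  then have l: "(l - a) * (l - d) = b * c" using eigen(4,5) by auto
  define v :: "real^2" where "v = vector [b, l - a]"
  have "c * b + d * (l - a) = l * (l - a)" using l by (simp add: algebra_simps)
  then have "lin *v v = l *\<^sub>R v"
    by (simp add: vec_eq_iff forall_2 lin_nth) (simp add: v_def algebra_simps)
  moreover have "v \<noteq> 0" using b by (auto simp: v_def vec_eq_iff forall_2)
  ultimately show "l \<in> eigenvalues lin" by (auto simp: eigenvalues_def)
qed

lemma lin_base: "lin *v base1 = l2 *\<^sub>R base1" "lin *v base2 = l1 *\<^sub>R base2"
proof -
  have "c * b + d * (l2 - a) = l2 * (l2 - a)" "c * b + d * (l1 - a) = l1 * (l1 - a)"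
    using eigen(4,5) by (simp_all add: algebra_simps)
  then show "lin *v base1 = l2 *\<^sub>R base1" "lin *v base2 = l1 *\<^sub>R base2"
    by (simp_all add: vec_eq_iff forall_2 lin_nth) (simp_all add: base1_def base2_def algebra_simps)
qed

lemma pos_uminus: "pos y z - p = y *\<^sub>R base1 + z *\<^sub>R base2" by (simp add: pos_base)

lemma dl_base: "dl base1 = 1" "dl base2 = 0" and du_base: "du base1 = 0" "du base2 = 1"
  using dl_pos[of 1 0] dl_pos[of 0 1] du_pos[of 1 0] du_pos[of 0 1] by (simp_all add: pos_uminus)

lemma dl_linear: "dl (x *\<^sub>R v + y *\<^sub>R w) = x * dl v + y * dl w"
  and du_linear: "du (x *\<^sub>R v + y *\<^sub>R w) = x * du v + y * du w"
  using bounded_linear_dl bounded_linear_du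
  by (simp_all add: linear_add linear_scale bounded_linear.linear linear_simps)

lemma stable_line: "{w. du (w - p) = 0} = {p + t *\<^sub>R base1 | t. True}"
proof (intro equalityI subsetI)
  fix w assume "w \<in> {w. du (w - p) = 0}"
  then have "w = p + dl (w - p) *\<^sub>R base1" using pos_dl_du[of w] by (simp add: pos_base)
  then show "w \<in> {p + t *\<^sub>R base1 | t. True}" by blast
next
  fix w assume "w \<in> {p + t *\<^sub>R base1 | t. True}"
  then obtain t where "w = p + t *\<^sub>R base1" by blast
  then show "w \<in> {w. du (w - p) = 0}" using du_linear[of t base1 0 0] by (simp add: du_base)
qed

lemma center_stable_space: "(+) p ` span {v. \<exists>l\<le>0. lin *v v = l *\<^sub>R v} = {p + t *\<^sub>R base1 | t. True}"
proof -
  have "{v. \<exists>l\<le>0. lin *v v = l *\<^sub>R v} = span {base1}"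
  proof (intro equalityI subsetI)
    fix v assume "v \<in> {v. \<exists>l\<le>0. lin *v v = l *\<^sub>R v}"
    then obtain l where l: "l \<le> 0" "lin *v v = l *\<^sub>R v" by blast
    define y z where "y = dl v" and "z = du v"
    have v: "v = y *\<^sub>R base1 + z *\<^sub>R base2" using pos_dl_du[of "v + p"] by (simp add: y_def z_def pos_base)
    have "lin *v v = (y * l2) *\<^sub>R base1 + (z * l1) *\<^sub>R base2"
      by (simp add: v matrix_vector_right_distrib lin_base matrix_vector_mult_scaleR)
    then have "du (l *\<^sub>R v) = z * l1" using l(2) du_linear[of "y * l2" base1 "z * l1" base2] by (simp add: du_base)
    then have "z * (l1 - l) = 0" using du_linear[of l v 0 0] by (simp add: z_def algebra_simps)
    moreover have "l1 - l \<noteq> 0" using l(1) eigen_sign(1) by simp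
    ultimately have "z = 0" by simp
    then show "v \<in> span {base1}" using v by (auto simp: span_singleton)
  next
    fix v assume "v \<in> span {base1}"
    then obtain t where "v = t *\<^sub>R base1" by (auto simp: span_singleton)
    then have "lin *v v = l2 *\<^sub>R v" by (simp add: matrix_vector_mult_scaleR lin_base)
    then show "v \<in> {v. \<exists>l\<le>0. lin *v v = l *\<^sub>R v}" using eigen_sign(2) by blast
  qed
  then have "span {v. \<exists>l\<le>0. lin *v v = l *\<^sub>R v} = span {base1}" by (metis span_span)
  then show ?thesis unfolding span_singleton by auto
qed

end

section \<open>The subsonic stable manifold\<close>

context saddle_field begin

lemma continuous_dl: "continuous_on S W \<Longrightarrow> continuous_on S (\<lambda>t. dl (W t - p))"
  and continuous_du: "continuous_on S W \<Longrightarrow> continuous_on S (\<lambda>t. du (W t - p))"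
  by (auto intro!: bounded_linear.continuous_on[OF bounded_linear_dl] bounded_linear.continuous_on[OF bounded_linear_du]
      continuous_intros)

text \<open>H \<epsilon> \<le> m r places the \<epsilon>-ball inside the coordinate box. An orbit
  that never leaves the ball therefore does not feel the clamping and is a clamped solution, so it
  lies on the graph.\<close>

lemma orbit_on_graph:
  assumes cs: "planar_center_stable (- l2) l1 m r L Q A B"
    and H: "\<And>v. \<bar>dl v\<bar> \<le> H * norm v" "\<And>v. \<bar>du v\<bar> \<le> H * norm v" "0 < H"
    and \<epsilon>: "H * \<epsilon> \<le> m * r"
    and cont: "continuous_on {0..} W"
    and der: "\<And>t. 0 < t \<Longrightarrow> (W has_vector_derivative fld (W t)) (at t)"
    and ball: "\<And>t. 0 \<le> t \<Longrightarrow> W t \<in> ball p \<epsilon>"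
  shows "planar_center_stable.clamped_sol (- l2) l1 m r A B (\<lambda>t. dl (W t - p)) (\<lambda>t. du (W t - p))"
    and "\<And>t. 0 \<le> t \<Longrightarrow> W t = pos (dl (W t - p)) (planar_center_stable.graph (- l2) l1 m r A B (dl (W t - p)))"
    and "\<And>t. 0 \<le> t \<Longrightarrow> \<bar>dl (W t - p)\<bar> \<le> r"
proof -
  interpret cs: planar_center_stable "- l2" l1 m r L Q A B by (rule cs)
  have bd: "\<bar>dl (W t - p)\<bar> \<le> m * r" "\<bar>du (W t - p)\<bar> \<le> m * r" if "0 \<le> t" for t
  proof -
    have "H * norm (W t - p) \<le> H * \<epsilon>" using ball[OF that] H(3)
      by (intro mult_left_mono) (auto simp: dist_norm norm_minus_commute)
    then show "\<bar>dl (W t - p)\<bar> \<le> m * r" "\<bar>du (W t - p)\<bar> \<le> m * r" using H(1,2)[of "W t - p"] \<epsilon> by linarith+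
  qed
  have mr: "m * r \<le> r" using cs.m cs.r by (simp add: mult_left_le_one_le)
  show bd1: "\<bar>dl (W t - p)\<bar> \<le> r" if "0 \<le> t" for t using bd(1)[OF that] mr by linarith
  show sol: "cs.clamped_sol (\<lambda>t. dl (W t - p)) (\<lambda>t. du (W t - p))"
    by (rule cs.clamped_solI[OF continuous_dl[OF cont] continuous_du[OF cont]
          coordinate_derivative(1)[OF der] coordinate_derivative(2)[OF der] bd1 bd(2)])
  show "W t = pos (dl (W t - p)) (cs.graph (dl (W t - p)))" if "0 \<le> t" for t
    using cs.graph_eq[OF sol that] pos_dl_du[of "W t"] by metis
qed

text \<open>The converse of \<open>orbit_on_graph\<close> on an attracting side: the clamped
  solution through a point of the graph stays in the box, hence is a true orbit and converges to
  p.\<close>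

lemma inward_orbit:
  assumes cs: "planar_center_stable (- l2) l1 m r L Q A B"
    and i: "planar_center_stable.inward (- l2) m r A \<sigma> e"
    and y0: "0 \<le> \<sigma> * y0" "\<bar>y0\<bar> \<le> r"
  obtains W where "W 0 = pos y0 (planar_center_stable.graph (- l2) l1 m r A B y0)"
    "\<And>t. 0 \<le> t \<Longrightarrow> (W has_vector_derivative fld (W t)) (at t within {0..})"
    "(W \<longlongrightarrow> p) at_top"
    "planar_center_stable.clamped_sol (- l2) l1 m r A B (\<lambda>t. dl (W t - p)) (\<lambda>t. du (W t - p))"
    "\<And>t. 0 \<le> t \<Longrightarrow> W t = pos (dl (W t - p)) (planar_center_stable.graph (- l2) l1 m r A B (dl (W t - p)))"
    "connects fld (pos y0 (planar_center_stable.graph (- l2) l1 m r A B y0)) p W"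
    "dl (W 0 - p) = y0"
proof -
  interpret cs: planar_center_stable "- l2" l1 m r L Q A B by (rule cs)
  obtain Y Z where YZ: "Y 0 = y0" "cs.clamped_sol Y Z"
    "\<And>t. 0 \<le> t \<Longrightarrow> (Y has_real_derivative - (- l2) * Y t + cs.cA (Y t) (Z t)) (at t within {0..})"
    "\<And>t. 0 \<le> t \<Longrightarrow> (Z has_real_derivative l1 * Z t + cs.cB (Y t) (Z t)) (at t within {0..})"
    by (rule cs.clamped_sol_exists[of y0]) blast
  have Y0: "0 \<le> \<sigma> * Y 0" "\<bar>Y 0\<bar> \<le> r" using YZ(1) y0 by auto
  define W where "W t = pos (Y t) (Z t)" for t
  have coord: "(\<lambda>t. dl (W t - p)) = Y" "(\<lambda>t. du (W t - p)) = Z" by (simp_all add: W_def dl_pos du_pos)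
  have gr: "Z t = cs.graph (Y t)" if "0 \<le> t" for t by (rule cs.graph_eq[OF YZ(2) that])
  have W0: "W 0 = pos y0 (cs.graph y0)" using gr[of 0] YZ(1) by (simp add: W_def)
  have der: "(W has_vector_derivative fld (W t)) (at t within {0..})" if t: "0 \<le> t" for t
    unfolding W_def using YZ(3,4)[OF t] cs.inward_inside(5,6)[OF i YZ(2) Y0 t]
    by (intro pos_derivative) auto
  have lim: "(W \<longlongrightarrow> p) at_top"
  proof -
    have "(W \<longlongrightarrow> p + (0 *\<^sub>R base1 + 0 *\<^sub>R base2)) at_top"
      unfolding W_def pos_base by (intro tendsto_intros cs.inward_tendsto[OF i YZ(2) Y0])
    then show ?thesis by simp
  qed
  have "connects fld (pos y0 (cs.graph y0)) p W"
    unfolding connects_def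
  proof (intro conjI allI impI W0 lim)
    show "continuous_on {0..} W"
      by (intro continuous_on_vector_derivative[of "{0..}" W "\<lambda>t. fld (W t)"] der) auto
    show "(W has_vector_derivative fld (W t)) (at t)" if "0 < t" for t
      using der[of t] that cs.at_within_halfline[OF that] by simp
  qed
  then show ?thesis
    using that[OF W0 der lim] YZ(2) gr unfolding coord
    by (metis (no_types, lifting) W_def YZ(1) coord(1))
qed

lemma stable_manifold:
  assumes strict: "a * d < b * c"
  shows "\<exists>\<delta> \<epsilon> M C cc. 0 < \<delta> \<and> \<delta> < \<epsilon> \<and>
     center_stable_manifold fld (ball p \<epsilon>) p M \<and>
     arc_tangent_both_ways M p {w. du (w - p) = 0} \<and>
     (\<forall>n::nat. C n > 0) \<and> cc > 0 \<and>
     (\<forall>w0. norm (p - w0) \<le> \<delta> \<longrightarrow>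
        (w0 \<in> M \<longrightarrow> (\<exists>W. connects fld w0 p W \<and> W ` {0..} \<subseteq> M \<and>
           derivs_bounded_by W p (\<lambda>n \<xi>. C n * norm (p - w0) * exp (- cc * \<xi>)) \<and>
           (\<forall>W'. connects fld w0 p W' \<longrightarrow> (\<forall>\<xi>\<ge>0. W' \<xi> = W \<xi>)))) \<and>
        (w0 \<notin> M \<longrightarrow> \<not> (\<exists>W. connects fld w0 p W \<and> (W ` {0..} \<subseteq> ball p \<epsilon> \<or>
           derivs_bounded_by W p (\<lambda>n \<xi>. C n * norm (p - w0) * exp (- cc * \<xi>))))))"
proof -
  have l2: "l2 < 0"
  proof -
    have "l1 * l2 < 0" using eigen(3) strict by simp
    then show ?thesis using eigen_sign(1) by (simp add: mult_less_0_iff)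
  qed
  obtain H where H: "1 \<le> H" "\<And>v. \<bar>dl v\<bar> \<le> H * norm v" "\<And>v. \<bar>du v\<bar> \<le> H * norm v"
    "\<And>y z. norm (pos y z - p) \<le> H * (\<bar>y\<bar> + \<bar>z\<bar>)" by (rule coordinate_norms) blast
  have H0: "0 < H" using H(1) by simp
  obtain K where K: "0 < K" "\<And>\<rho> y z y' z'. \<lbrakk>\<rho> \<le> 1; \<bar>y\<bar> \<le> \<rho>; \<bar>z\<bar> \<le> \<rho>; \<bar>y'\<bar> \<le> \<rho>; \<bar>z'\<bar> \<le> \<rho>\<rbrakk> \<Longrightarrow>
       \<bar>A y z - A y' z'\<bar> \<le> K * \<rho> * (\<bar>y - y'\<bar> + \<bar>z - z'\<bar>) \<and>
       \<bar>B y z - B y' z'\<bar> \<le> K * \<rho> * (\<bar>y - y'\<bar> + \<bar>z - z'\<bar>)"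
    by (rule nonlinearity_lipschitz) blast
  \<comment> \<open>The second entry gives the cone condition with slope 1. The third keeps |A y z|
    below half of the linear decay |l2| |y| on the cone, which leaves the rate \<nu> = - l2 /
    2.\<close>
  define r where "r = min 1 (min (l1 / (16 * K)) (- l2 / (4 * K)))"
  have r: "0 < r" "r \<le> 1" using K l2 eigen_sign(1) by (auto simp: r_def divide_neg_pos)
  have "K * r \<le> K * (l1 / (16 * K))" "K * r \<le> K * (- l2 / (4 * K))"
    using K(1) by (intro mult_left_mono; simp add: r_def)+
  then have rK: "K * r \<le> l1 * 1 / 16" "K * r \<le> - l2 / 4" using K(1) by simp_all
  have cs: "planar_center_stable (- l2) l1 1 r (K * r) (2 * K) A B"
    by (rule center_stable_setup[OF K _ _ r rK(1)]) simp_all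
  interpret cs: planar_center_stable "- l2" l1 1 r "K * r" "2 * K" A B by (rule cs)
  define \<nu> where "\<nu> = - l2 / 2"
  have \<nu>: "0 < \<nu>" using l2 by (simp add: \<nu>_def)
  have fast: "\<sigma> * (- (- l2) * y + A y z) \<le> - (\<nu> * \<bar>y\<bar>)"
    if \<sigma>: "\<sigma> = 1 \<or> \<sigma> = -1" and y: "0 \<le> \<sigma> * y" "\<bar>y\<bar> \<le> r" and z: "\<bar>z\<bar> \<le> 1 * \<bar>y\<bar>" for \<sigma> y z
  proof -
    have "\<bar>A y z\<bar> \<le> K * r * (\<bar>y\<bar> + \<bar>z\<bar>)" using K(2)[of r y z 0 0] r y z by (simp add: nonlinearity_zero)
    also have "\<dots> \<le> - l2 / 4 * (\<bar>y\<bar> + \<bar>y\<bar>)" using rK(2) z r K(1) l2 by (intro mult_mono) auto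
    also have "\<dots> = \<nu> * \<bar>y\<bar>" by (simp add: \<nu>_def)
    finally have "\<bar>A y z\<bar> \<le> \<nu> * \<bar>y\<bar>" .
    moreover have "\<sigma> * y = \<bar>y\<bar>" using \<sigma> y by auto
    then have "\<sigma> * (- (- l2) * y) = - (2 * (\<nu> * \<bar>y\<bar>))" by (simp add: \<nu>_def mult.left_commute)
    ultimately show ?thesis using \<sigma> by (auto simp: distrib_left)
  qed
  \<comment> \<open>In a box of size r \<le> 1 the linear rate \<nu> |y| dominates the quadratic
    rate \<nu> y^2 that \<open>inward\<close> asks for, and it does so on both sides.\<close>
  have inward: "cs.inward \<sigma> \<nu>" if "\<sigma> = 1 \<or> \<sigma> = -1" for \<sigma>
    unfolding cs.inward_def
  proof (intro conjI allI impI that \<nu>)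
    fix y z assume y: "0 \<le> \<sigma> * y" "\<bar>y\<bar> \<le> r" "\<bar>z\<bar> \<le> 1 * \<bar>y\<bar>"
    have "\<bar>y\<bar> * \<bar>y\<bar> \<le> \<bar>y\<bar> * 1" using y(2) r by (intro mult_left_mono) auto
    then have "y\<^sup>2 \<le> \<bar>y\<bar>" by (simp add: power2_eq_square)
    then have "\<nu> * y\<^sup>2 \<le> \<nu> * \<bar>y\<bar>" using \<nu> by (intro mult_left_mono) auto
    then show "\<sigma> * (- (- l2) * y + A y z) \<le> - (\<nu> * y\<^sup>2)" using fast[OF that y] by linarith
  qed
  have g1: "\<bar>cs.graph y\<bar> \<le> \<bar>y\<bar>" for y using cs.graph_cone0[of y] by simp
  have pos_small: "norm (pos y (cs.graph y) - p) \<le> 2 * H * \<bar>y\<bar>" for y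
  proof -
    have "H * (\<bar>y\<bar> + \<bar>cs.graph y\<bar>) \<le> H * (\<bar>y\<bar> + \<bar>y\<bar>)" using g1[of y] H0 by (intro mult_left_mono) auto
    then show ?thesis using H(4)[of y "cs.graph y"] by simp
  qed
  define \<epsilon> where "\<epsilon> = r / H"
  have \<epsilon>: "0 < \<epsilon>" "H * \<epsilon> \<le> 1 * r" using r H0 by (auto simp: \<epsilon>_def)
  \<comment> \<open>The graph is cut off at |y| < s0, so that the arc lies in the \<epsilon>-ball:
    its points are at distance at most 2 H |y| from p.\<close>
  define s0 where "s0 = \<epsilon> / (4 * H)"
  have s0: "0 < s0" "2 * H * s0 < \<epsilon>" "s0 < r"
  proof -
    show "0 < s0" using \<epsilon> H0 by (simp add: s0_def)
    have eq: "4 * H * s0 = \<epsilon>" using H0 by (simp add: s0_def)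
    then show "2 * H * s0 < \<epsilon>" using \<epsilon>(1) by linarith
    have "s0 \<le> H * s0" using H(1) \<open>0 < s0\<close> by simp
    also have "\<dots> < \<epsilon>" using eq \<epsilon>(1) by linarith
    also have "\<epsilon> \<le> H * \<epsilon>" using H(1) \<epsilon>(1) by simp
    finally show "s0 < r" using \<epsilon>(2) by simp
  qed
  define M where "M = {pos y (cs.graph y) | y. \<bar>y\<bar> < s0}"
  have M_ball: "M \<subseteq> ball p \<epsilon>"
  proof
    fix w assume "w \<in> M"
    then obtain y where y: "w = pos y (cs.graph y)" "\<bar>y\<bar> < s0" by (auto simp: M_def)
    have "2 * H * \<bar>y\<bar> \<le> 2 * H * s0" using y H0 by (intro mult_left_mono) auto
    then show "w \<in> ball p \<epsilon>" using pos_small[of y] s0(2) y(1) by (simp add: dist_norm norm_minus_commute)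
  qed
  have orbit: "\<exists>W. connects fld w0 p W \<and> W ` {0..} \<subseteq> M \<and>
      (\<forall>t\<ge>0. (W has_vector_derivative fld (W t)) (at t within {0..})) \<and>
      (\<forall>t\<ge>0. norm (W t - p) \<le> 2 * H * H * norm (p - w0) * exp (- \<nu> * t))"
    if w0: "w0 \<in> M" for w0
  proof -
    obtain y0 where y0: "w0 = pos y0 (cs.graph y0)" "\<bar>y0\<bar> < s0" using w0 by (auto simp: M_def)
    define \<sigma> :: real where "\<sigma> = (if 0 \<le> y0 then 1 else - 1)"
    have \<sigma>: "\<sigma> = 1 \<or> \<sigma> = -1" "0 \<le> \<sigma> * y0" "\<bar>y0\<bar> \<le> r" using y0 s0 by (auto simp: \<sigma>_def)
    obtain W where W: "W 0 = pos y0 (cs.graph y0)"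
      "\<And>t. 0 \<le> t \<Longrightarrow> (W has_vector_derivative fld (W t)) (at t within {0..})"
      "cs.clamped_sol (\<lambda>t. dl (W t - p)) (\<lambda>t. du (W t - p))"
      "\<And>t. 0 \<le> t \<Longrightarrow> W t = pos (dl (W t - p)) (cs.graph (dl (W t - p)))"
      "connects fld (pos y0 (cs.graph y0)) p W" "dl (W 0 - p) = y0"
      by (rule inward_orbit[OF cs inward[OF \<sigma>(1)] \<sigma>(2,3)]) blast
    have dec: "\<bar>dl (W t - p)\<bar> \<le> \<bar>y0\<bar> * exp (- \<nu> * t)" if "0 \<le> t" for t
      using cs.inward_decay_exp[OF inward[OF \<sigma>(1)] W(3) _ _ that fast[OF \<sigma>(1)]] W(6) \<sigma> by simp
    have y0n: "\<bar>y0\<bar> \<le> H * norm (p - w0)" using H(2)[of "w0 - p"] by (simp add: y0 dl_pos norm_minus_commute)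
    have "W t \<in> M" if t: "0 \<le> t" for t
    proof -
      have "\<bar>dl (W t - p)\<bar> \<le> \<bar>y0\<bar>" using cs.inward_inside(1)[OF inward[OF \<sigma>(1)] W(3) _ _ t] W(6) \<sigma> by simp
      then show ?thesis using W(4)[OF t] y0(2) unfolding M_def by force
    qed
    moreover have "norm (W t - p) \<le> 2 * H * H * norm (p - w0) * exp (- \<nu> * t)" if t: "0 \<le> t" for t
    proof -
      have "norm (W t - p) \<le> 2 * H * \<bar>dl (W t - p)\<bar>" using pos_small[of "dl (W t - p)"] W(4)[OF t] by simp
      also have "\<dots> \<le> 2 * H * (\<bar>y0\<bar> * exp (- \<nu> * t))" using dec[OF t] H0 by (intro mult_left_mono) auto
      also have "\<dots> \<le> 2 * H * ((H * norm (p - w0)) * exp (- \<nu> * t))"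
        using y0n H0 by (intro mult_left_mono mult_right_mono) auto
      finally show ?thesis by (simp add: mult.assoc)
    qed
    ultimately show ?thesis using W(2,5) y0(1) by blast
  qed
  obtain G where G: "G 0 = (\<lambda>w. w - p)" "\<And>n. polynomial_function (G n)"
    "\<And>n W t S. (W has_vector_derivative fld (W t)) (at t within S) \<Longrightarrow>
       ((\<lambda>s. G n (W s)) has_vector_derivative G (Suc n) (W t)) (at t within S)"
    by (rule polynomial_lie_derivatives[OF polynomial_function_fld, of "\<lambda>w. w - p"])
      (auto intro!: polynomial_function_diff polynomial_function_id polynomial_function_const)
  have Gp: "G n p = 0" for n
    by (cases n) (auto simp: G(1) lie_derivatives_at_equilibrium[where G=G and f=fld, OF fld_p G(3)])
  have "\<exists>L. L-lipschitz_on (ball p \<epsilon>) (G n)" for n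
    using polynomial_function_lipschitz[OF G(2), of "ball p \<epsilon>" n] by blast
  then obtain L where L: "\<And>n. (L n)-lipschitz_on (ball p \<epsilon>) (G n)" by metis
  have L0: "0 \<le> L n" for n using lipschitz_on_nonneg[OF L] .
  \<comment> \<open>L n bounds \<open>G n\<close> by the distance from p, and 2 H H bounds that
    distance by its initial value times the exponential. The summand 1 keeps C n positive even if L
    n = 0.\<close>
  define C where "C n = (L n + 1) * (2 * H * H)" for n
  have C: "0 < C n" for n using L0[of n] H0 by (simp add: C_def add_nonneg_pos)
  \<comment> \<open>The second entry puts the stable coordinate of a starting point below s0, hence
    inside the cut-off arc once it is on the graph. The third makes C 0 \<delta> < \<epsilon>, so
    that the decay bound of order 0 alone confines a solution to the ball.\<close>
  define \<delta> where "\<delta> = min (\<epsilon> / 2) (min (s0 / (2 * H)) (\<epsilon> / (2 * C 0)))"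
  have \<delta>: "0 < \<delta>" "\<delta> < \<epsilon>" "H * \<delta> < s0" "C 0 * \<delta> < \<epsilon>"
  proof -
    show "0 < \<delta>" "\<delta> < \<epsilon>" using \<epsilon> s0 H0 C[of 0] by (auto simp: \<delta>_def)
    have "\<delta> \<le> s0 / (2 * H)" "\<delta> \<le> \<epsilon> / (2 * C 0)" by (auto simp: \<delta>_def)
    then have "2 * (H * \<delta>) \<le> s0" "2 * (C 0 * \<delta>) \<le> \<epsilon>" using H0 C[of 0] by (auto simp: pos_le_divide_eq algebra_simps)
    then show "H * \<delta> < s0" "C 0 * \<delta> < \<epsilon>" using s0 \<epsilon> by linarith+
  qed
  have in_M: "w0 \<in> M" if w0: "norm (p - w0) \<le> \<delta>" and W: "connects fld w0 p W" "W ` {0..} \<subseteq> ball p \<epsilon>" for w0 W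
  proof -
    have W0: "W 0 = w0" and Wc: "continuous_on {0..} W"
      and Wd: "\<And>t. 0 < t \<Longrightarrow> (W has_vector_derivative fld (W t)) (at t)" using W(1) by (auto simp: connects_def)
    have Wb: "\<And>t. 0 \<le> t \<Longrightarrow> W t \<in> ball p \<epsilon>" using W(2) by auto
    have "w0 = pos (dl (w0 - p)) (cs.graph (dl (w0 - p)))"
      using orbit_on_graph(2)[OF cs H(2,3) H0 \<epsilon>(2) Wc Wd Wb, of 0] by (simp only: W0 order_refl)
    moreover have "\<bar>dl (w0 - p)\<bar> < s0"
    proof -
      have "\<bar>dl (w0 - p)\<bar> \<le> H * norm (p - w0)" using H(2)[of "w0 - p"] by (simp add: norm_minus_commute)
      also have "\<dots> \<le> H * \<delta>" using w0 H0 by (intro mult_left_mono) auto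
      finally show ?thesis using \<delta>(3) by linarith
    qed
    ultimately show ?thesis unfolding M_def by blast
  qed
  have "p \<in> M" unfolding M_def using s0(1) by (auto intro!: exI[of _ 0] simp: cs.graph_0 pos_base)
  have arc: "arc_tangent_both_ways M p {w. du (w - p) = 0}"
    unfolding arc_tangent_both_ways_def
  proof (intro exI conjI ballI)
    \<comment> \<open>The arc is parametrised by the stable coordinate rescaled to (-1, 1);
      \<open>dl\<close> then furnishes the continuous inverse.\<close>
    define crv where "crv s = pos (s0 * s) (cs.graph (s0 * s))" for s
    define crv' where "crv' s = s0 *\<^sub>R (base1 + cs.graph' (s0 * s) *\<^sub>R base2)" for s
    define inv where "inv w = dl (w - p) / s0" for w
    have s_in: "\<bar>s0 * s\<bar> < s0" if "s \<in> {-1<..<1}" for s :: real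
      using that s0(1) by (simp add: abs_mult abs_less_iff)
    have s_r: "s0 * s \<in> {-r<..<r}" if "s \<in> {-1<..<1}" for s :: real
      using s_in[OF that] s0(3) by (auto simp: abs_less_iff)
    have inv_crv: "inv (crv s) = s" for s using s0 by (simp add: inv_def crv_def dl_pos)
    have C1: "\<And>y. \<bar>y\<bar> < r \<Longrightarrow> (cs.graph has_real_derivative cs.graph' y) (at y)" "continuous_on {-r<..<r} cs.graph'"
      using cs.graph_C1[OF inward inward \<nu> fast] by auto
    show der: "(crv has_vector_derivative crv' s) (at s)" if "s \<in> {-1<..<1}" for s
    proof -
      have "((\<lambda>s. cs.graph (s0 * s)) has_real_derivative cs.graph' (s0 * s) * s0) (at s)"
        by (rule DERIV_chain2[OF C1(1)]) (use s_in[OF that] s0 in \<open>auto intro!: derivative_eq_intros\<close>)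
      moreover have "((\<lambda>s. s0 * s) has_real_derivative s0) (at s)" by (auto intro!: derivative_eq_intros)
      ultimately have "(crv has_vector_derivative (0 + (s0 *\<^sub>R base1 + (cs.graph' (s0 * s) * s0) *\<^sub>R base2))) (at s)"
        unfolding crv_def pos_base
        by (intro has_vector_derivative_add has_vector_derivative_const
            has_vector_derivative_scaleR[where g="\<lambda>_. base1" and g'=0, simplified]
            has_vector_derivative_scaleR[where g="\<lambda>_. base2" and g'=0, simplified])
      then show ?thesis by (simp add: crv'_def scaleR_add_right mult.commute)
    qed
    show "crv' s \<noteq> 0" for s
    proof
      assume "crv' s = 0"
      then have "dl (crv' s) = 0" using dl_linear[of 0 0 0 0] by simp
      moreover have "dl (crv' s) = s0"
        using dl_linear[of s0 base1 "s0 * cs.graph' (s0 * s)" base2] by (simp add: crv'_def scaleR_add_right dl_base)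
      ultimately show False using s0 by simp
    qed
    show "continuous_on {-1<..<1} crv'"
      unfolding crv'_def
      by (intro continuous_intros continuous_on_compose2[OF C1(2), of _ "\<lambda>s. s0 * s"])
        (use s_r in auto)
    show "homeomorphism {-1<..<1} M crv inv"
    proof (rule homeomorphismI)
      show "continuous_on {-1<..<1} crv"
        by (intro continuous_at_imp_continuous_on ballI has_vector_derivative_continuous[OF der])
      show "continuous_on M inv"
        unfolding inv_def by (intro continuous_intros continuous_dl) (use s0 in auto)
      show "crv ` {-1<..<1} \<subseteq> M" using s_in by (auto simp: crv_def M_def)
      show inv_M: "inv ` M \<subseteq> {-1<..<1}"
        using s0(1) by (auto simp: M_def inv_def dl_pos abs_less_iff field_simps)
      show "inv (crv x) = x" for x by (rule inv_crv)
      show "crv (inv y) = y" if "y \<in> M" for y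
        using that s0(1) by (auto simp: M_def inv_def crv_def dl_pos)
    qed
    show "crv 0 = p" by (simp add: crv_def cs.graph_0 pos_base)
    have "crv' 0 = s0 *\<^sub>R base1" by (simp add: crv'_def cs.graph'_def)
    moreover have "{p + t *\<^sub>R base1 | t. True} = {p + t *\<^sub>R s0 *\<^sub>R base1 | t. True}"
    proof (intro equalityI subsetI)
      fix x assume "x \<in> {p + t *\<^sub>R base1 | t. True}"
      then obtain t where "x = p + (t / s0) *\<^sub>R s0 *\<^sub>R base1" using s0(1) by auto
      then show "x \<in> {p + t *\<^sub>R s0 *\<^sub>R base1 | t. True}" by blast
    next
      fix x assume "x \<in> {p + t *\<^sub>R s0 *\<^sub>R base1 | t. True}"
      then obtain t where "x = p + (t * s0) *\<^sub>R base1" by auto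
      then show "x \<in> {p + t *\<^sub>R base1 | t. True}" by blast
    qed
    ultimately show "{w. du (w - p) = 0} = {p + t *\<^sub>R crv' 0 | t. True}" by (simp add: stable_line)
  qed
  show ?thesis
  proof (rule exI[of _ \<delta>], rule exI[of _ \<epsilon>], rule exI[of _ M], rule exI[of _ C], rule exI[of _ \<nu>],
      intro conjI allI impI)
    show "center_stable_manifold fld (ball p \<epsilon>) p M"
      unfolding center_stable_manifold_def
    proof (intro conjI exI[of _ lin] ballI M_ball fld_derivative)
      show "arc_tangent_both_ways M p ((+) p ` span {v. \<exists>l\<le>0. lin *v v = l *\<^sub>R v})"
        using arc unfolding center_stable_space stable_line .
      show "\<exists>W. connects fld w0 p W \<and> W ` {0..} \<subseteq> M" if "w0 \<in> M" for w0
        using orbit[OF that] by blast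
    qed
  next
    fix w0 assume w0: "norm (p - w0) \<le> \<delta>" "w0 \<in> M"
    obtain W where W: "connects fld w0 p W" "W ` {0..} \<subseteq> M"
      "\<And>t. t\<ge>0 \<Longrightarrow> (W has_vector_derivative fld (W t)) (at t within {0..})"
      "\<And>t. t\<ge>0 \<Longrightarrow> norm (W t - p) \<le> 2 * H * H * norm (p - w0) * exp (- \<nu> * t)"
      using orbit[OF w0(2)] by blast
    have "norm (G n (W \<xi>)) \<le> C n * norm (p - w0) * exp (- \<nu> * \<xi>)" if "0 \<le> \<xi>" for n \<xi>
    proof -
      have "W \<xi> \<in> ball p \<epsilon>" using W(2) M_ball that by (meson atLeast_iff image_subset_iff subsetD)
      then have "norm (G n (W \<xi>)) \<le> L n * norm (W \<xi> - p)"
        using lipschitz_onD[OF L, of "W \<xi>" p n] \<epsilon>(1) by (simp add: Gp dist_norm)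
      also have "\<dots> \<le> (L n + 1) * (2 * H * H * norm (p - w0) * exp (- \<nu> * \<xi>))"
        using W(4)[OF that] L0[of n] by (intro mult_mono) auto
      finally show ?thesis by (simp add: C_def mult.assoc)
    qed
    then have "derivs_bounded_by W p (\<lambda>n \<xi>. C n * norm (p - w0) * exp (- \<nu> * \<xi>))"
      unfolding derivs_bounded_by_def
      by (intro exI[of _ "\<lambda>n \<xi>. G n (W \<xi>)"]) (auto simp: G(1) intro!: G(3) W(3))
    then show "\<exists>W. connects fld w0 p W \<and> W ` {0..} \<subseteq> M \<and>
           derivs_bounded_by W p (\<lambda>n \<xi>. C n * norm (p - w0) * exp (- \<nu> * \<xi>)) \<and>
           (\<forall>W'. connects fld w0 p W' \<longrightarrow> (\<forall>\<xi>\<ge>0. W' \<xi> = W \<xi>))"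
      using W(1,2) connects_unique[OF polynomial_function_fld W(1)] by blast
  next
    fix w0 assume w0: "norm (p - w0) \<le> \<delta>" "w0 \<notin> M"
    show "\<not> (\<exists>W. connects fld w0 p W \<and> (W ` {0..} \<subseteq> ball p \<epsilon> \<or>
           derivs_bounded_by W p (\<lambda>n \<xi>. C n * norm (p - w0) * exp (- \<nu> * \<xi>))))"
    proof
      assume "\<exists>W. connects fld w0 p W \<and> (W ` {0..} \<subseteq> ball p \<epsilon> \<or>
           derivs_bounded_by W p (\<lambda>n \<xi>. C n * norm (p - w0) * exp (- \<nu> * \<xi>)))"
      then obtain W where W: "connects fld w0 p W" "W ` {0..} \<subseteq> ball p \<epsilon> \<or>
           derivs_bounded_by W p (\<lambda>n \<xi>. C n * norm (p - w0) * exp (- \<nu> * \<xi>))" by blast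
      \<comment> \<open>Both alternatives reduce to staying in the ball: the decay bound with n = 0
        implies it, by the choice of \<delta>.\<close>
      have "W \<xi> \<in> ball p \<epsilon>" if \<xi>: "0 \<le> \<xi>"
        and D: "derivs_bounded_by W p (\<lambda>n \<xi>. C n * norm (p - w0) * exp (- \<nu> * \<xi>))" for \<xi>
      proof -
        have "norm (W \<xi> - p) \<le> C 0 * norm (p - w0) * exp (- \<nu> * \<xi>)"
          using D \<xi> unfolding derivs_bounded_by_def by metis
        also have "\<dots> \<le> C 0 * norm (p - w0) * 1"
          using C[of 0] \<nu> \<xi> by (intro mult_left_mono) auto
        also have "\<dots> \<le> C 0 * \<delta>" using w0(1) C[of 0] by simp
        finally show ?thesis using \<delta>(4) by (simp add: dist_norm norm_minus_commute)
      qed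
      then have "W ` {0..} \<subseteq> ball p \<epsilon>" using W(2) by auto
      then show False using in_M[OF w0(1) W(1)] w0(2) by blast
    qed
  qed (use \<delta> arc C \<nu> in auto)
qed

end

section \<open>The transonic centre manifold\<close>

text \<open>The n-th derivative of a product, from the derivative sequences of the factors; the recursion
  replaces the binomial coefficients.\<close>

primrec leibniz :: "(nat \<Rightarrow> real \<Rightarrow> real) \<Rightarrow> (nat \<Rightarrow> real \<Rightarrow> real) \<Rightarrow> nat \<Rightarrow> real \<Rightarrow> real" where
  "leibniz f g 0 = (\<lambda>t. f 0 t * g 0 t)"
| "leibniz f g (Suc n) = (\<lambda>t. leibniz (\<lambda>i. f (Suc i)) g n t + leibniz f (\<lambda>i. g (Suc i)) n t)"

lemma leibniz_derivative:
  assumes "\<And>i. (f i has_real_derivative f (Suc i) t) (at t)" "\<And>i. (g i has_real_derivative g (Suc i) t) (at t)"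
  shows "(leibniz f g n has_real_derivative leibniz f g (Suc n) t) (at t)"
  using assms
proof (induction n arbitrary: f g)
  case 0
  show ?case using DERIV_mult'[OF 0(1)[of 0] 0(2)[of 0]] by (simp add: add.commute)
next
  case (Suc n)
  have "((\<lambda>t. leibniz (\<lambda>i. f (Suc i)) g n t + leibniz f (\<lambda>i. g (Suc i)) n t) has_real_derivative
      leibniz (\<lambda>i. f (Suc i)) g (Suc n) t + leibniz f (\<lambda>i. g (Suc i)) (Suc n) t) (at t)"
    by (intro DERIV_add Suc.IH Suc.prems)
  then show ?case by simp
qed

abbreviation decays :: "nat \<Rightarrow> (real \<Rightarrow> real) \<Rightarrow> bool" where
  "decays N f \<equiv> f \<in> O[at_top](\<lambda>t. 1 / t ^ N)"

lemma decays_mono: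
  assumes "decays M f" "N \<le> M" shows "decays N f"
proof (rule landau_o.big_trans[OF assms(1)])
  show "decays N (\<lambda>t. 1 / t ^ M)"
  proof (rule landau_o.big_mono)
    show "\<forall>\<^sub>F t::real in at_top. norm (1 / t ^ M) \<le> norm (1 / t ^ N)"
      using eventually_ge_at_top[of 1]
    proof eventually_elim
      case (elim t)
      then have "t ^ N \<le> t ^ M" using assms(2) by (intro power_increasing) auto
      then show ?case using elim by (simp add: frac_le)
    qed
  qed
qed

lemma decays_mult:
  assumes "decays M f" "decays N g" "K \<le> M + N" shows "decays K (\<lambda>t. f t * g t)"
proof (rule decays_mono[OF _ assms(3)])
  have "(\<lambda>t::real. 1 / t ^ M * (1 / t ^ N)) = (\<lambda>t. 1 / t ^ (M + N))" by (simp add: power_add fun_eq_iff)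
  then show "decays (M + N) (\<lambda>t. f t * g t)" using landau_o.big.mult[OF assms(1,2)] by metis
qed

lemma decaysI:
  assumes "\<And>t. T \<le> t \<Longrightarrow> \<bar>f t\<bar> \<le> c / t ^ N" "1 \<le> T"
  shows "decays N f"
proof (rule landau_o.bigI[of "\<bar>c\<bar> + 1"])
  show "\<forall>\<^sub>F t in at_top. norm (f t) \<le> (\<bar>c\<bar> + 1) * norm (1 / t ^ N)"
    using eventually_ge_at_top[of T]
  proof eventually_elim
    case (elim t)
    then have "c / t ^ N \<le> (\<bar>c\<bar> + 1) / t ^ N" using assms(2) by (intro divide_right_mono) auto
    then show ?case using assms(1)[OF elim] elim assms(2) by (simp add: abs_divide)
  qed
qed simp

lemma decays_lin2:
  assumes "decays N f" "decays N g" shows "decays N (\<lambda>t. x * f t + y * g t)"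
proof -
  have c: "decays 0 (\<lambda>t. x)" for x by (rule decaysI[of 1 _ "\<bar>x\<bar>"]) auto
  have "decays N (\<lambda>t. x * f t)" "decays N (\<lambda>t. y * g t)"
    by (rule decays_mult[OF c]; (rule assms)?; simp)+
  then show ?thesis by (rule sum_in_bigo)
qed

text \<open>The orders e and e' are arbitrary functions for two reasons: the induction shifts them
  along with the sequences, and later the highest derivative enters with one power less than the
  pattern of the lower ones.\<close>

lemma decays_leibniz:
  assumes "\<And>i. i \<le> n \<Longrightarrow> decays (e i) (f i)" "\<And>i. i \<le> n \<Longrightarrow> decays (e' i) (g i)"
    and "\<And>i. i \<le> n \<Longrightarrow> N \<le> e i + e' (n - i)"
  shows "decays N (leibniz f g n)"
  using assms
proof (induction n arbitrary: f g e e')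
  case 0
  have "decays (e 0) (f 0)" "decays (e' 0) (g 0)" "N \<le> e 0 + e' 0"
    using 0(1)[of 0] 0(2)[of 0] 0(3)[of 0] by auto
  then show ?case by (simp add: decays_mult)
next
  case (Suc n)
  have "decays N (leibniz (\<lambda>i. f (Suc i)) g n)"
  proof (rule Suc.IH[where e="\<lambda>i. e (Suc i)" and e'=e'])
    show "N \<le> e (Suc i) + e' (n - i)" if "i \<le> n" for i using Suc.prems(3)[of "Suc i"] that by simp
  qed (use Suc.prems in auto)
  moreover have "decays N (leibniz f (\<lambda>i. g (Suc i)) n)"
  proof (rule Suc.IH[where e=e and e'="\<lambda>i. e' (Suc i)"])
    show "N \<le> e i + e' (Suc (n - i))" if "i \<le> n" for i using Suc.prems(3)[of i] that by (simp add: Suc_diff_le)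
  qed (use Suc.prems in auto)
  ultimately show ?case by (simp add: sum_in_bigo)
qed

lemma decaysD:
  assumes "decays N f"
  obtains c T where "0 < c" "1 \<le> T" "\<And>t. T \<le> t \<Longrightarrow> \<bar>f t\<bar> \<le> c / t ^ N"
proof -
  obtain c where c: "0 < c" "\<forall>\<^sub>F t in at_top. norm (f t) \<le> c * norm (1 / t ^ N)"
    using landau_o.bigE[OF assms] .
  then obtain T where T: "\<And>t. T \<le> t \<Longrightarrow> norm (f t) \<le> c * norm (1 / t ^ N)"
    by (auto simp: eventually_at_top_linorder)
  show ?thesis
  proof (rule that[OF c(1), of "max 1 T"])
    show "\<bar>f t\<bar> \<le> c / t ^ N" if "max 1 T \<le> t" for t using T[of t] that by (simp add: abs_divide)
  qed simp
qed

text \<open>With t fixed, |g| is at most c / t^N on [t, \<infinity>), so both z and - z, reduced by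
  the constant c / (k t^N), grow at rate k there. Being bounded, they are nonpositive at time t. The
  a priori order M serves for boundedness.\<close>

lemma decays_unstable:
  assumes k: "0 < k" and der: "\<And>t. 0 < t \<Longrightarrow> (z has_real_derivative k * z t + g t) (at t)"
    and g: "decays N g" and z: "decays M z"
  shows "decays N z"
proof -
  obtain c T where c: "0 < c" "1 \<le> T" "\<And>t. T \<le> t \<Longrightarrow> \<bar>g t\<bar> \<le> c / t ^ N" by (rule decaysD[OF g]) blast
  obtain c' T' where c': "0 < c'" "1 \<le> T'" "\<And>t. T' \<le> t \<Longrightarrow> \<bar>z t\<bar> \<le> c' / t ^ M" by (rule decaysD[OF z]) blast
  show ?thesis
  proof (rule decaysI)
    fix t assume t: "max T T' \<le> t"
    have t0: "0 < t" using t c(2) by simp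
    have "\<zeta> * z t - c / k / t ^ N \<le> 0" if \<zeta>: "\<zeta> = 1 \<or> \<zeta> = -1" for \<zeta>
    proof (rule bounded_exp_growth_nonpos[where D="\<lambda>s. \<zeta> * z s - c / k / t ^ N" and a=t, OF k])
      have "continuous_on {t..} z"
        by (intro continuous_at_imp_continuous_on ballI DERIV_isCont[OF der]) (use t0 in auto)
      then show "continuous_on {t..} (\<lambda>s. \<zeta> * z s - c / k / t ^ N)" by (intro continuous_intros)
      fix s assume s: "t < s"
      show "((\<lambda>s. \<zeta> * z s - c / k / t ^ N) has_real_derivative \<zeta> * (k * z s + g s)) (at s)"
        using der[of s] s t0 by (auto intro!: derivative_eq_intros)
      have "\<bar>g s\<bar> \<le> c / s ^ N" using c(3)[of s] s t by simp
      also have "\<dots> \<le> c / t ^ N" using s t0 c(1) by (intro divide_left_mono power_mono mult_pos_pos) auto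
      finally have "- (c / t ^ N) \<le> \<zeta> * g s" using \<zeta> by auto
      then show "k * (\<zeta> * z s - c / k / t ^ N) \<le> \<zeta> * (k * z s + g s)"
        using k by (simp add: algebra_simps)
    next
      fix s assume s: "t \<le> s"
      have "1 \<le> s ^ M" using s t c'(2) by (intro one_le_power) auto
      then have "c' / s ^ M \<le> c'" using c'(1) by (simp add: divide_le_eq)
      then have "\<bar>z s\<bar> \<le> c'" using c'(3)[of s] s t by simp
      moreover have "0 \<le> c / k / t ^ N" using c k t0 by simp
      ultimately show "\<zeta> * z s - c / k / t ^ N \<le> c'" using \<zeta> by auto
    qed
    from this[of 1] this[of "-1"] show "\<bar>z t\<bar> \<le> c / k / t ^ N" by simp
  qed (use c in simp)
qed

text \<open>For large t one has 1 + t \<le> 2 t, whence the factor 2^n; the initial interval is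
  handled by compactness. The decay rates available later are one power better than the bound
  claimed here.\<close>

lemma decays_bound:
  assumes f: "decays (Suc n) f" and cont: "continuous_on {0..} f"
  obtains C where "0 < C" "\<And>t. 0 \<le> t \<Longrightarrow> \<bar>f t\<bar> \<le> C / (1 + t) ^ n"
proof -
  obtain c T where c: "0 < c" "1 \<le> T" "\<And>t. T \<le> t \<Longrightarrow> \<bar>f t\<bar> \<le> c / t ^ Suc n" by (rule decaysD[OF f]) blast
  have "compact (f ` {0..T})"
    by (rule compact_continuous_image[OF continuous_on_subset[OF cont]]) auto
  then obtain b where b: "\<And>t. t \<in> {0..T} \<Longrightarrow> \<bar>f t\<bar> \<le> b"
    using compact_imp_bounded by (force simp: bounded_iff)
  define C where "C = \<bar>b\<bar> * (1 + T) ^ n + c * 2 ^ n"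
  show ?thesis
  proof
    show "0 < C" using c by (auto simp: C_def intro!: add_nonneg_pos)
    fix t :: real assume t: "0 \<le> t"
    have "\<bar>f t\<bar> * (1 + t) ^ n \<le> C"
    proof (cases "t \<le> T")
      case True
      have "\<bar>f t\<bar> * (1 + t) ^ n \<le> \<bar>b\<bar> * (1 + T) ^ n"
        using b[of t] t True by (intro mult_mono power_mono) auto
      moreover have "0 \<le> c * 2 ^ n" using c by simp
      ultimately show ?thesis by (simp add: C_def)
    next
      case False
      then have t1: "1 \<le> t" using c(2) by simp
      have "\<bar>f t\<bar> * (1 + t) ^ n \<le> c / t ^ Suc n * (2 * t) ^ n"
        using c(3)[of t] False t1 c(1) by (intro mult_mono power_mono) auto
      also have "\<dots> = c * 2 ^ n / t" using t1 by (simp add: power_mult_distrib)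
      also have "\<dots> \<le> c * 2 ^ n" using t1 c(1) by (simp add: divide_le_eq)
      also have "\<dots> \<le> C" using c(2) by (simp add: C_def)
      finally show ?thesis .
    qed
    then show "\<bar>f t\<bar> \<le> C / (1 + t) ^ n" using t by (simp add: pos_le_divide_eq)
  qed
qed

section \<open>Time shifts and maximal trajectories\<close>

lemma solves_in_shift:
  assumes "solves_in f N I w" shows "solves_in f N ((+) c ` I) (\<lambda>t. w (t - c))"
  unfolding solves_in_def
proof (intro ballI conjI)
  fix t assume "t \<in> (+) c ` I"
  then have t: "t - c \<in> I" by auto
  have "((\<lambda>t. t - c) has_vector_derivative 1) (at t)"
    unfolding has_real_derivative_iff_has_vector_derivative[symmetric] by (auto intro!: derivative_eq_intros)
  moreover have "(w has_vector_derivative f (w (t - c))) (at (t - c))" using assms t by (auto simp: solves_in_def)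
  ultimately show "((\<lambda>t. w (t - c)) has_vector_derivative f (w (t - c))) (at t)"
    using vector_diff_chain_at[of "\<lambda>t. t - c" 1 t w "f (w (t - c))"] by (simp add: o_def)
  show "w (t - c) \<in> N" using assms t by (auto simp: solves_in_def)
qed

lemma solves_in_unique:
  assumes L: "L-lipschitz_on N f" and w: "solves_in f N I w" and v: "solves_in f N J v"
    and I: "is_interval I" and J: "is_interval J"
    and s: "s \<in> I" "s \<in> J" "w s = v s" and t: "t \<in> I" "t \<in> J"
  shows "w t = v t"
proof -
  have der: "(w has_vector_derivative f (w x)) (at x)" "(v has_vector_derivative f (v x)) (at x)" "w x \<in> N \<and> v x \<in> N"
    if "x \<in> {min s t..max s t}" for x
  proof -
    have "x \<in> I" "x \<in> J" using that s(1,2) t I J unfolding is_interval_1 by (metis atLeastAtMost_iff min_def max_def)+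
    then show "(w has_vector_derivative f (w x)) (at x)" "(v has_vector_derivative f (v x)) (at x)" "w x \<in> N \<and> v x \<in> N"
      using w v by (auto simp: solves_in_def)
  qed
  have cont: "continuous_on {min s t..max s t} w" "continuous_on {min s t..max s t} v"
    by (intro continuous_at_imp_continuous_on ballI has_vector_derivative_continuous[OF der(1)] has_vector_derivative_continuous[OF der(2)]; assumption)+
  show ?thesis
  proof (cases "s \<le> t")
    case True
    show ?thesis
      by (rule ode_unique_forward[OF L True]) (use True cont der s(3) in \<open>auto simp: min_def max_def\<close>)
  next
    case False
    then have ts: "t \<le> s" by simp
    show ?thesis
      by (rule ode_unique_backward[OF L ts]) (use ts False cont der s(3) in \<open>auto simp: min_def max_def\<close>)
  qed
qed

text \<open>The maximality clause of \<open>converging_trajectory\<close>, isolated so that shifts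
  and uniqueness can be stated for it.\<close>

definition maximal_in :: "(real^2 \<Rightarrow> real^2) \<Rightarrow> (real^2) set \<Rightarrow> real set \<Rightarrow> (real \<Rightarrow> real^2) \<Rightarrow> bool" where
  "maximal_in f N I w \<longleftrightarrow> (\<forall>I' w'. open I' \<and> is_interval I' \<and> I \<subseteq> I' \<and> solves_in f N I' w' \<and>
        (\<forall>\<xi>\<in>I. w' \<xi> = w \<xi>) \<longrightarrow> I' = I)"

lemma maximal_in_shift:
  assumes "maximal_in f N I w" shows "maximal_in f N ((+) c ` I) (\<lambda>t. w (t - c))"
  unfolding maximal_in_def
proof (intro allI impI, elim conjE)
  fix J v assume J: "open J" "is_interval J" "(+) c ` I \<subseteq> J" "solves_in f N J v" "\<forall>\<xi>\<in>(+) c ` I. v \<xi> = w (\<xi> - c)"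
  have "I \<subseteq> (+) (-c) ` J"
  proof
    fix x assume "x \<in> I"
    then have "c + x \<in> J" using J(3) by auto
    then show "x \<in> (+) (-c) ` J" by (intro image_eqI[of _ _ "c + x"]) auto
  qed
  moreover have "open ((+) (-c) ` J)" by (rule open_translation[OF J(1)])
  moreover have "is_interval ((+) (-c) ` J)" using J(2) by (rule is_interval_translation[THEN iffD2])
  moreover have "solves_in f N ((+) (-c) ` J) (\<lambda>t. v (t - - c))" by (rule solves_in_shift[OF J(4)])
  moreover have "\<forall>\<xi>\<in>I. v (\<xi> - - c) = w \<xi>" using J(5) by (auto simp: add.commute)
  ultimately have "(+) (-c) ` J = I" using assms unfolding maximal_in_def by blast
  then have "(+) c ` I = (+) c ` (+) (-c) ` J" by simp
  also have "\<dots> = J" by (simp add: image_image)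
  finally show "J = (+) c ` I" by simp
qed

text \<open>Two solutions that meet agree on the common interval, so they can be glued on the union
  of their intervals. Maximality of each forces the union to equal either interval.\<close>

lemma maximal_in_unique:
  assumes L: "L-lipschitz_on N f" and w: "solves_in f N I w" and v: "solves_in f N J v"
    and I: "open I" "is_interval I" "maximal_in f N I w" and J: "open J" "is_interval J" "maximal_in f N J v"
    and s: "s \<in> I" "s \<in> J" "w s = v s"
  shows "I = J" "w ` I = v ` J"
proof -
  have eq: "w t = v t" if "t \<in> I" "t \<in> J" for t
    by (rule solves_in_unique[OF L w v I(2) J(2) s that])
  define u where "u t = (if t \<in> I then w t else v t)" for t
  have uI: "u t = w t" if "t \<in> I" for t using that by (simp add: u_def)
  have uJ: "u t = v t" if "t \<in> J" for t using that eq by (simp add: u_def)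
  have "is_interval (I \<union> J)"
    using I(2) J(2) s(1,2) unfolding is_interval_connected_1
    by (intro connected_Un) auto
  moreover have "solves_in f N (I \<union> J) u"
    unfolding solves_in_def
  proof (intro ballI conjI)
    fix t assume "t \<in> I \<union> J"
    then consider "t \<in> I" | "t \<in> J" by blast
    then have "(u has_vector_derivative f (u t)) (at t) \<and> u t \<in> N"
    proof cases
      case 1
      then have "(w has_vector_derivative f (u t)) (at t)" "u t \<in> N" using w uI by (auto simp: solves_in_def)
      then show ?thesis using has_vector_derivative_transform_within_open[OF _ I(1) 1] uI by metis
    next
      case 2
      then have "(v has_vector_derivative f (u t)) (at t)" "u t \<in> N" using v uJ by (auto simp: solves_in_def)
      then show ?thesis using has_vector_derivative_transform_within_open[OF _ J(1) 2] uJ by metis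
    qed
    then show "(u has_vector_derivative f (u t)) (at t)" "u t \<in> N" by auto
  qed
  moreover have "open (I \<union> J)" using I J by blast
  ultimately have "I \<union> J = I" "I \<union> J = J"
    using I(3) J(3) uI uJ unfolding maximal_in_def by (meson Un_upper1 Un_upper2)+
  then show "I = J" by blast
  then show "w ` I = v ` J" using eq by auto
qed

section \<open>The quadratic part along the kernel and the derivatives of centre orbits\<close>

context saddle_field begin

definition "beta = ((l1 - a) * (q1 * b\<^sup>2) - b * (q2 * b\<^sup>2 + q3 * b * (l2 - a))) / (b * disc)"
definition "beta3 = - (q4 * b^3) / disc"

lemma A_axis: "A y 0 = beta * y\<^sup>2 + beta3 * y^3"
proof -
  have bd: "b \<noteq> 0" "disc \<noteq> 0" using b disc(2) by auto
  have "(l1 - a) * nl1 y 0 - b * nl2 y 0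
      = ((l1 - a) * (q1 * b\<^sup>2) - b * (q2 * b\<^sup>2 + q3 * b * (l2 - a))) * y\<^sup>2 + b * (- (q4 * b^3)) * y^3"
    by (simp add: nl1_def nl2_def power_mult_distrib) (simp add: algebra_simps power2_eq_square power3_eq_cube)
  then have "A y 0 = (((l1 - a) * (q1 * b\<^sup>2) - b * (q2 * b\<^sup>2 + q3 * b * (l2 - a))) * y\<^sup>2) / (b * disc)
      + (b * (- (q4 * b^3)) * y^3) / (b * disc)"
    by (simp only: A_def add_divide_distrib)
  then show ?thesis using bd by (simp add: beta_def beta3_def)
qed

text \<open>The left null vector is a multiple of \<open>dl\<close>, so the quotient in the
  definition is read off from \<open>dl_fld\<close> on the axis z = 0; its limit is b disc
  beta.\<close>

lemma saddle_knot_fld: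
  assumes eq: "a * d = b * c" and beta: "0 < beta"
  shows "saddle_knot fld p"
proof -
  have l2: "l2 = 0" using eigen(3) eigen_sign(1) eq by simp
  define l :: "real^2" where "l = vector [l1 - a, - b]"
  have l_dl: "l \<bullet> v = (b * disc) * dl v" for v
    using b disc(2) by (simp add: l_def dl_def inner_vec_def sum_2)
  have "l v* lin = 0"
  proof -
    have "(l1 - a) * a - b * c = (l1 - a) * (a + d - l1)" unfolding eigen(4)[symmetric] by (simp add: algebra_simps)
    also have "a + d - l1 = 0" using eigen(1) l2 by simp
    finally have 1: "(l1 - a) * a - b * c = 0" by simp
    have "(l1 - a) * b - b * d = b * (l1 - (a + d))" by (simp add: algebra_simps)
    also have "l1 - (a + d) = 0" using eigen(1) l2 by simp
    finally have 2: "(l1 - a) * b - b * d = 0" by simp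
    show ?thesis using 1 2
      by (simp add: vec_eq_iff forall_2 vector_matrix_mult_def sum_2 lin_def l_def algebra_simps)
  qed
  moreover have "l \<noteq> 0" using b by (auto simp: l_def vec_eq_iff forall_2)
  moreover have "base1 \<noteq> 0" using b by (auto simp: base1_def vec_eq_iff forall_2)
  moreover have "lin *v base1 = 0" using lin_base(1) l2 by simp
  moreover have "((\<lambda>t. (l \<bullet> fld (p + t *\<^sub>R base1)) / t\<^sup>2) \<longlongrightarrow> (b * disc) * beta) (at 0)"
  proof -
    have dlf: "dl (fld (p + t *\<^sub>R base1)) = beta * t\<^sup>2 + beta3 * t^3" for t
    proof -
      have "p + t *\<^sub>R base1 = pos t 0" by (simp add: pos_base)
      then show ?thesis by (simp only: dl_fld dl_pos du_pos) (simp add: l2 A_axis)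
    qed
    have "((\<lambda>t. (b * disc) * (beta + beta3 * t)) \<longlongrightarrow> (b * disc) * (beta + beta3 * 0)) (at (0::real))"
      by (intro tendsto_intros)
    then have lim: "((\<lambda>t. (b * disc) * (beta + beta3 * t)) \<longlongrightarrow> (b * disc) * beta) (at (0::real))" by simp
    show ?thesis
      by (rule Lim_transform_within_open[OF lim open_UNIV])
        (auto simp: l_dl dlf field_simps power2_eq_square power3_eq_cube)
  qed
  moreover have "(b * disc) * beta \<noteq> 0" using b disc(2) beta by simp
  moreover have "eigenvalues lin = {0, l1}" using eigenvalues_lin l2 by auto
  moreover have "l1 \<noteq> 0" using eigen_sign(1) by simp
  ultimately show ?thesis unfolding saddle_knot_def using fld_p fld_derivative by blast
qed

text \<open>Both components gain one power of \<open>1 / t\<close> per derivative. The centre component has no linear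
  term, so the Leibniz rule suffices. The unstable component is first bounded with one power
  missing and then improved by \<open>decays_unstable\<close>.\<close>

lemma center_orbit_decay:
  assumes l2: "l2 = 0"
    and der: "\<And>t. 0 \<le> t \<Longrightarrow> (W has_vector_derivative fld (W t)) (at t within {0..})"
    and G: "G 0 = (\<lambda>w. w - p)"
      "\<And>n W t S. (W has_vector_derivative fld (W t)) (at t within S) \<Longrightarrow>
       ((\<lambda>s. G n (W s)) has_vector_derivative G (Suc n) (W t)) (at t within S)"
    and base: "decays 1 (\<lambda>t. dl (W t - p))" "decays 1 (\<lambda>t. du (W t - p))"
  shows "decays (Suc n) (\<lambda>t. norm (G n (W t)))"
proof -
  define D where "D n t = G n (W t)" for n t
  have derD: "(D n has_vector_derivative D (Suc n) t) (at t)" if "0 < t" for n t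
  proof -
    have "(W has_vector_derivative fld (W t)) (at t)"
      using der[of t] that at_within_interior[of t "{0..}"] by simp
    then show ?thesis unfolding D_def by (rule G(2))
  qed
  define X where "X n t = D n t $ 1" for n t
  define T where "T n t = D n t $ 2" for n t
  have dX: "(X n has_real_derivative X (Suc n) t) (at t)" and dT: "(T n has_real_derivative T (Suc n) t) (at t)"
    if "0 < t" for n t
    using bounded_linear.has_vector_derivative[OF bounded_linear_vec_nth derD[OF that]]
    unfolding X_def T_def has_real_derivative_iff_has_vector_derivative by auto
  define N1 where "N1 n t = q1 * leibniz X X n t" for n t
  define N2 where "N2 n t = q2 * leibniz X X n t + q3 * leibniz X T n t + q4 * leibniz (leibniz X X) X n t" for n t
  have dXX: "(leibniz X X n has_real_derivative leibniz X X (Suc n) t) (at t)" if "0 < t" for n t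
    by (rule leibniz_derivative) (rule dX that)+
  have dN1: "(N1 n has_real_derivative N1 (Suc n) t) (at t)" if "0 < t" for n t
    unfolding N1_def by (intro DERIV_cmult dXX that)
  have dN2: "(N2 n has_real_derivative N2 (Suc n) t) (at t)" if "0 < t" for n t
    unfolding N2_def
    by (intro DERIV_add DERIV_cmult leibniz_derivative dX dT dXX that)
  \<comment> \<open>The system differentiated n times, N1 and N2 being the n-th derivatives of its
    nonlinear terms. The nonlinearity is thus visible as Leibniz sums of lower derivatives, which
    the polynomials \<open>G n\<close> alone would hide.\<close>
  have rec: "X (Suc n) t = a * X n t + b * T n t + N1 n t \<and> T (Suc n) t = c * X n t + d * T n t + N2 n t"
    if "0 < t" for n t
    using that
  proof (induction n arbitrary: t)
    case 0
    have "(W has_vector_derivative fld (W t)) (at t)"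
      using der[of t] 0 at_within_interior[of t "{0..}"] by simp
    then have "((\<lambda>s. W s - p) has_vector_derivative fld (W t)) (at t)"
      using has_vector_derivative_diff[OF _ has_vector_derivative_const[of p]] by force
    moreover have "D 0 = (\<lambda>s. W s - p)" by (simp add: D_def G(1) fun_eq_iff)
    ultimately have "D 1 t = fld (W t)" using derD[OF 0, of 0] vector_derivative_unique_at by fastforce
    then show ?case
      by (simp add: X_def T_def N1_def N2_def fld_def D_def[of 0] G(1) power2_eq_square power3_eq_cube)
  next
    case (Suc n)
    have 1: "((\<lambda>t. a * X n t + b * T n t + N1 n t) has_real_derivative
        a * X (Suc n) t + b * T (Suc n) t + N1 (Suc n) t) (at t)"
      and 2: "((\<lambda>t. c * X n t + d * T n t + N2 n t) has_real_derivative
        c * X (Suc n) t + d * T (Suc n) t + N2 (Suc n) t) (at t)"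
      by (intro DERIV_add DERIV_cmult dX dT dN1 dN2 Suc.prems)+
    have "(X (Suc n) has_real_derivative a * X (Suc n) t + b * T (Suc n) t + N1 (Suc n) t) (at t)"
      by (rule has_field_derivative_transform_within_open[OF 1, of "{0<..}"]) (use Suc in auto)
    moreover have "(T (Suc n) has_real_derivative c * X (Suc n) t + d * T (Suc n) t + N2 (Suc n) t) (at t)"
      by (rule has_field_derivative_transform_within_open[OF 2, of "{0<..}"]) (use Suc in auto)
    ultimately show ?case using DERIV_unique[OF dX[OF Suc.prems]] DERIV_unique[OF dT[OF Suc.prems]] by blast
  qed
  define y where "y n t = dl (D n t)" for n t
  define z where "z n t = du (D n t)" for n t
  define g where "g n t = (l1 - a) / (b * disc) * N1 n t + (- b) / (b * disc) * N2 n t" for n t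
  define h where "h n t = (a - l2) / (b * disc) * N1 n t + b / (b * disc) * N2 n t" for n t
  have Dn: "D (Suc n) t = lin *v D n t + vector [N1 n t, N2 n t]" if "0 < t" for n t
    using rec[OF that, of n] by (simp add: vec_eq_iff forall_2 lin_nth X_def T_def)
  have split: "D n t = y n t *\<^sub>R base1 + z n t *\<^sub>R base2" for n t
    using pos_dl_du[of "D n t + p"] by (simp add: y_def z_def pos_base)
  have lin_split: "dl (lin *v v) = l2 * dl v" "du (lin *v v) = l1 * du v" for v
  proof -
    have "v = dl v *\<^sub>R base1 + du v *\<^sub>R base2" using pos_dl_du[of "v + p"] by (simp add: pos_base)
    then have "lin *v v = lin *v (dl v *\<^sub>R base1 + du v *\<^sub>R base2)" by simp
    also have "\<dots> = (dl v * l2) *\<^sub>R base1 + (du v * l1) *\<^sub>R base2"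
      by (simp add: matrix_vector_right_distrib lin_base matrix_vector_mult_scaleR)
    finally show "dl (lin *v v) = l2 * dl v" "du (lin *v v) = l1 * du v"
      by (simp_all add: dl_linear du_linear dl_base du_base mult.commute)
  qed
  have yrec: "y (Suc n) t = g n t" and zrec: "z (Suc n) t = l1 * z n t + h n t" if "0 < t" for n t
  proof -
    define v :: "real^2" where "v = vector [N1 n t, N2 n t]"
    have "g n t = ((l1 - a) * N1 n t + (- b) * N2 n t) / (b * disc)"
      "h n t = ((a - l2) * N1 n t + b * N2 n t) / (b * disc)"
      by (simp_all only: g_def h_def add_divide_distrib times_divide_eq_left)
    then have "dl v = g n t" "du v = h n t" by (simp_all add: v_def dl_def du_def)
    moreover have "dl (lin *v D n t + v) = dl (lin *v D n t) + dl v" "du (lin *v D n t + v) = du (lin *v D n t) + du v"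
      using dl_linear[of 1 "lin *v D n t" 1 v] du_linear[of 1 "lin *v D n t" 1 v] by simp_all
    ultimately show "y (Suc n) t = g n t" "z (Suc n) t = l1 * z n t + h n t"
      unfolding y_def z_def Dn[OF that] v_def[symmetric] by (simp_all add: lin_split l2)
  qed
  have dz: "(z n has_real_derivative z (Suc n) t) (at t)" if "0 < t" for n t
    using bounded_linear.has_vector_derivative[OF bounded_linear_du derD[OF that]]
    by (simp add: z_def[abs_def] has_real_derivative_iff_has_vector_derivative)
  have XT: "X n = (\<lambda>t. b * y n t + b * z n t)" "T n = (\<lambda>t. (l2 - a) * y n t + (l1 - a) * z n t)" for n
  proof -
    have "X n t = b * y n t + b * z n t \<and> T n t = (l2 - a) * y n t + (l1 - a) * z n t" for t
      unfolding X_def T_def by (subst (1 2) split) (simp add: base1_def base2_def mult.commute)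
    then show "X n = (\<lambda>t. b * y n t + b * z n t)" "T n = (\<lambda>t. (l2 - a) * y n t + (l1 - a) * z n t)" by auto
  qed
  have XT_decays: "decays K (X n)" "decays K (T n)" if "decays K (y n)" "decays K (z n)" for K n
    unfolding XT by (rule decays_lin2; rule that)+
  \<comment> \<open>The third condition says that the quadratic sum of order i inherits the order e
    i; this is what allows one more factor X for the cubic term.\<close>
  have gh: "decays K (g n)" "decays K (h n)"
    if e: "\<And>i. i \<le> n \<Longrightarrow> decays (e i) (X i) \<and> decays (e i) (T i)" "\<And>i. i \<le> n \<Longrightarrow> K \<le> e i + e (n - i)"
      "\<And>i j. i \<le> n \<Longrightarrow> j \<le> i \<Longrightarrow> e i \<le> e j + e (i - j)" for K n e
  proof -
    have "decays (e i) (leibniz X X i)" if "i \<le> n" for i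
      by (rule decays_leibniz[where e=e and e'=e]) (use e that in auto)
    then have L: "decays K (leibniz X X n)" "decays K (leibniz X T n)" "decays K (leibniz (leibniz X X) X n)"
      using e by (auto intro!: decays_leibniz[where e=e and e'=e])
    have N: "decays K (N1 n)" "decays K (N2 n)"
      using decays_lin2[OF L(1) L(1), of q1 0] decays_lin2[OF decays_lin2[OF L(1,2), of q2 q3] L(3), of 1 q4]
      by (simp_all add: N1_def[abs_def] N2_def[abs_def])
    show "decays K (g n)" "decays K (h n)" unfolding g_def[abs_def] h_def[abs_def] by (rule decays_lin2; rule N)+
  qed
  have cong: "decays K u" if "decays K v" "\<And>t. 0 < t \<Longrightarrow> u t = v t" for K u v
  proof -
    have "\<forall>\<^sub>F t in at_top. v t = u t" using eventually_gt_at_top[of 0] by eventually_elim (use that in simp)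
    then show ?thesis using that(1) by (simp add: landau_o.big.in_cong)
  qed
  have main: "\<forall>i\<le>n. decays (Suc i) (y i) \<and> decays (Suc i) (z i)" for n
  proof (induction n)
    case 0
    have "y 0 = (\<lambda>t. dl (W t - p))" "z 0 = (\<lambda>t. du (W t - p))" by (simp_all add: y_def z_def D_def G(1) fun_eq_iff)
    then show ?case using base by simp
  next
    case (Suc n)
    have e: "decays (Suc i) (X i) \<and> decays (Suc i) (T i)" if "i \<le> n" for i
      using Suc.IH that XT_decays by blast
    have gS: "decays (Suc (Suc n)) (g n)" "decays (Suc (Suc n)) (h n)"
      by (rule gh[where e=Suc]; use e in auto)+
    have y: "decays (Suc (Suc n)) (y (Suc n))" by (rule cong[OF gS(1) yrec])
    have h: "decays (Suc n) (h n)" by (rule decays_mono[OF gS(2)]) simp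
    have "decays (Suc n) (\<lambda>t. l1 * z n t + 1 * h n t)"
      by (rule decays_lin2) (use Suc.IH h in auto)
    then have "decays (Suc n) (\<lambda>t. l1 * z n t + h n t)" by (simp only: mult_1_left)
    then have z: "decays (Suc n) (z (Suc n))" by (rule cong[OF _ zrec])
    \<comment> \<open>The derivative of order n + 1 is so far known with n + 1 powers, one short.
      That is enough for the nonlinear terms: in every product it meets an undifferentiated factor,
      which contributes the missing power.\<close>
    define e' where "e' i = (if i \<le> n then Suc i else Suc n)" for i
    have e': "decays (e' i) (X i) \<and> decays (e' i) (T i)" if "i \<le> Suc n" for i
    proof (cases "i \<le> n")
      case False
      then have "i = Suc n" using that by simp
      moreover have "decays (Suc n) (y (Suc n))" using y by (rule decays_mono) simp
      ultimately show ?thesis using XT_decays[OF _ z] by (simp add: e'_def)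
    qed (use e in \<open>simp add: e'_def\<close>)
    have h': "decays (Suc (Suc n)) (h (Suc n))"
      by (rule gh[where e=e']) (use e' in \<open>auto simp: e'_def\<close>)
    have "(z (Suc n) has_real_derivative l1 * z (Suc n) t + h (Suc n) t) (at t)" if "0 < t" for t
      using dz[OF that, of "Suc n"] zrec[OF that, of "Suc n"] by simp
    then have "decays (Suc (Suc n)) (z (Suc n))"
      by (rule decays_unstable[OF eigen_sign(1) _ h' z])
    then show ?case using Suc.IH y by (auto simp: le_Suc_eq)
  qed
  have "decays (Suc n) (\<lambda>t. norm base1 * \<bar>y n t\<bar> + norm base2 * \<bar>z n t\<bar>)"
    using main[of n] by (intro decays_lin2) auto
  then show ?thesis
  proof (rule landau_o.big_trans[rotated], intro landau_o.bigI[of 1] always_eventually allI)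
    fix t
    have "norm (D n t) \<le> norm (y n t *\<^sub>R base1) + norm (z n t *\<^sub>R base2)" by (subst split) (rule norm_triangle_ineq)
    then show "norm (norm (G n (W t))) \<le> 1 * norm (norm base1 * \<bar>y n t\<bar> + norm base2 * \<bar>z n t\<bar>)"
      by (simp add: D_def mult.commute)
  qed simp
qed

end

lemma last_exit:
  fixes W :: "real \<Rightarrow> 'a::metric_space"
  assumes cont: "continuous_on {0..} W" and out: "W 0 \<notin> ball p \<epsilon>" and lim: "(W \<longlongrightarrow> p) at_top" and \<epsilon>: "0 < \<epsilon>"
  obtains a where "0 \<le> a" "W a \<notin> ball p \<epsilon>" "\<And>t. a < t \<Longrightarrow> W t \<in> ball p \<epsilon>"
proof -
  have "eventually (\<lambda>t. dist (W t) p < \<epsilon>) at_top" using lim \<epsilon> by (rule tendstoD)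
  then obtain T where T: "\<And>t. T \<le> t \<Longrightarrow> W t \<in> ball p \<epsilon>" by (auto simp: eventually_at_top_linorder dist_commute)
  define S where "S = {t \<in> {0..T}. W t \<in> - ball p \<epsilon>}"
  have "closedin (top_of_set {0..T}) ({0..T} \<inter> W -` (- ball p \<epsilon>))"
    by (rule continuous_closedin_preimage) (use cont in \<open>auto intro: continuous_on_subset\<close>)
  then have "compact ({0..T} \<inter> W -` (- ball p \<epsilon>))" by (rule closedin_compact[OF compact_Icc])
  moreover have "{0..T} \<inter> W -` (- ball p \<epsilon>) = S" by (auto simp: S_def)
  ultimately have "compact S" by simp
  moreover have "0 \<in> S" using out T[of 0] by (auto simp: S_def) (meson linorder_le_cases)
  ultimately obtain a where a: "a \<in> S" "\<And>t. t \<in> S \<Longrightarrow> t \<le> a" using compact_attains_sup[of S] by blast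
  show ?thesis
  proof (rule that[of a])
    show "0 \<le> a" "W a \<notin> ball p \<epsilon>" using a(1) by (auto simp: S_def)
    show "W t \<in> ball p \<epsilon>" if "a < t" for t
    proof (rule ccontr)
      assume n: "W t \<notin> ball p \<epsilon>"
      then have "t < T" using T[of t] by (meson not_le)
      then have "t \<in> S" using n that \<open>0 \<le> a\<close> by (auto simp: S_def)
      then show False using a(2)[of t] that by simp
    qed
  qed
qed

lemma converging_trajectoryE:
  assumes "converging_trajectory f N p \<Gamma>"
  obtains I w where "open I" "is_interval I" "\<not> bdd_above I" "solves_in f N I w" "maximal_in f N I w"
    "(w \<longlongrightarrow> p) at_top" "\<Gamma> = w ` I"
  using assms unfolding converging_trajectory_def maximal_in_def[symmetric]
  by (elim exE conjE) (rule that; assumption)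

text \<open>Starting the orbit outside of the ball makes backward continuation unnecessary: the orbit cut
  off at its last exit is maximal.\<close>

lemma maximal_in_after_exit:
  assumes cont: "continuous_on {0..} W" and a: "0 \<le> a" "W a \<notin> N"
  shows "maximal_in f N {a<..} W"
  unfolding maximal_in_def
proof (intro allI impI, elim conjE)
  fix I' w' assume I': "open I'" "is_interval I'" "{a<..} \<subseteq> I'" "solves_in f N I' w'" "\<forall>\<xi>\<in>{a<..}. w' \<xi> = W \<xi>"
  have "x \<in> {a<..}" if x: "x \<in> I'" for x
  proof (rule ccontr)
    assume "x \<notin> {a<..}"
    then have "a \<in> I'" using I'(2,3) x unfolding is_interval_1 by (metis greaterThan_iff lt_ex gt_ex linorder_not_less subsetD less_imp_le)
    then have w': "(w' has_vector_derivative f (w' a)) (at a)" "w' a \<in> N" using I'(4) by (auto simp: solves_in_def)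
    have "(w' \<longlongrightarrow> w' a) (at a within {a<..})"
      using has_vector_derivative_continuous[OF w'(1)] by (auto simp: continuous_within intro: tendsto_mono[OF at_le])
    moreover have "(W \<longlongrightarrow> W a) (at a within {a<..})"
      using cont a(1) by (auto simp: continuous_on_def intro: tendsto_within_subset)
    then have "(w' \<longlongrightarrow> W a) (at a within {a<..})"
      by (rule Lim_transform_eventually) (use I'(5) in \<open>auto simp: eventually_at_filter\<close>)
    moreover have "at a within {a<..} \<noteq> bot" by (simp add: trivial_limit_at_right_real)
    ultimately have "w' a = W a" using tendsto_unique by blast
    then show False using w'(2) a(2) by simp
  qed
  then show "I' = {a<..}" using I'(3) by blast
qed

section \<open>The converging transonic trajectory and its uniqueness\<close>

context saddle_field begin

lemma center_manifold:
  assumes eq: "a * d = b * c" and beta: "0 < beta"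
  shows "\<exists>\<delta> \<epsilon> \<Gamma> C. 0 < \<delta> \<and> \<delta> < \<epsilon> \<and>
     (\<forall>\<Gamma>'. converging_trajectory fld (ball p \<epsilon>) p \<Gamma>' \<and> tangent_at \<Gamma>' p {w. du (w - p) = 0} \<longleftrightarrow> \<Gamma>' = \<Gamma>) \<and>
     (\<forall>n::nat. C n > 0) \<and>
     (\<forall>w0\<in>\<Gamma>. \<exists>W. connects fld w0 p W \<and>
        derivs_bounded_by W p (\<lambda>n \<xi>. C n * norm (p - w0) ^ n / (1 + norm (p - w0) * \<xi>) ^ n) \<and>
        (\<forall>W'. connects fld w0 p W' \<longrightarrow> (\<forall>\<xi>\<ge>0. W' \<xi> = W \<xi>)))"
proof -
  have l2: "l2 = 0" using eigen(3) eigen_sign(1) eq by simp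
  obtain H where H: "1 \<le> H" "\<And>v. \<bar>dl v\<bar> \<le> H * norm v" "\<And>v. \<bar>du v\<bar> \<le> H * norm v"
    "\<And>y z. norm (pos y z - p) \<le> H * (\<bar>y\<bar> + \<bar>z\<bar>)" by (rule coordinate_norms) blast
  have H0: "0 < H" using H(1) by simp
  obtain K where K: "0 < K" "\<And>\<rho> y z y' z'. \<lbrakk>\<rho> \<le> 1; \<bar>y\<bar> \<le> \<rho>; \<bar>z\<bar> \<le> \<rho>; \<bar>y'\<bar> \<le> \<rho>; \<bar>z'\<bar> \<le> \<rho>\<rbrakk> \<Longrightarrow>
       \<bar>A y z - A y' z'\<bar> \<le> K * \<rho> * (\<bar>y - y'\<bar> + \<bar>z - z'\<bar>) \<and>
       \<bar>B y z - B y' z'\<bar> \<le> K * \<rho> * (\<bar>y - y'\<bar> + \<bar>z - z'\<bar>)"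
    by (rule nonlinearity_lipschitz) blast
  \<comment> \<open>On the cone, A y z differs from A y 0 by at most K m y^2. This slope keeps the
    difference below a quarter of beta y^2.\<close>
  define m where "m = min 1 (beta / (4 * K))"
  have m: "0 < m" "m \<le> 1" using beta K(1) by (auto simp: m_def)
  have "K * m \<le> K * (beta / (4 * K))" using K(1) by (intro mult_left_mono) (auto simp: m_def)
  then have Km: "K * m \<le> beta / 4" using K(1) by simp
  \<comment> \<open>The second entry is the cone condition for this m; the third bounds the cubic
    term beta3 y^3 by a quarter of beta y^2.\<close>
  define r where "r = min 1 (min (l1 * m / (16 * K)) (beta / (4 * (\<bar>beta3\<bar> + 1))))"
  have r: "0 < r" "r \<le> 1" using K(1) m beta eigen_sign(1) by (auto simp: r_def intro!: divide_pos_pos mult_pos_pos)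
  have "K * r \<le> K * (l1 * m / (16 * K))" using K(1) by (intro mult_left_mono) (auto simp: r_def)
  then have rK: "K * r \<le> l1 * m / 16" using K(1) by simp
  have "(\<bar>beta3\<bar> + 1) * r \<le> (\<bar>beta3\<bar> + 1) * (beta / (4 * (\<bar>beta3\<bar> + 1)))" by (intro mult_left_mono) (auto simp: r_def)
  also have "\<dots> = beta / 4"
  proof -
    have "x * (beta / (4 * x)) = beta / 4" if "x \<noteq> 0" for x using that by simp
    from this[of "\<bar>beta3\<bar> + 1"] show ?thesis by linarith
  qed
  finally have "(\<bar>beta3\<bar> + 1) * r \<le> beta / 4" .
  then have r3: "\<bar>beta3\<bar> * r \<le> beta / 4" using r(1) by (simp add: distrib_right)
  have cs: "planar_center_stable (- l2) l1 m r (K * r) (2 * K) A B"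
    by (rule center_stable_setup[OF K m r rK])
  interpret cs: planar_center_stable "- l2" l1 m r "K * r" "2 * K" A B by (rule cs)
  have A_near: "\<bar>A y z - beta * y\<^sup>2\<bar> \<le> beta / 2 * y\<^sup>2" if y: "\<bar>y\<bar> \<le> r" and z: "\<bar>z\<bar> \<le> m * \<bar>y\<bar>" for y z
  proof -
    have zy: "\<bar>z\<bar> \<le> \<bar>y\<bar>" using z m by (meson abs_ge_zero less_imp_le mult_left_le_one_le order_trans)
    have "\<bar>A y z - A y 0\<bar> \<le> K * \<bar>y\<bar> * (\<bar>y - y\<bar> + \<bar>z - 0\<bar>)" using K(2)[of "\<bar>y\<bar>" y z y 0] y r zy by auto
    also have "\<dots> \<le> K * \<bar>y\<bar> * (m * \<bar>y\<bar>)" using z K(1) by (intro mult_left_mono) auto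
    also have "\<dots> = (K * m) * y\<^sup>2" by (simp add: power2_eq_square)
    also have "\<dots> \<le> beta / 4 * y\<^sup>2" using Km by (intro mult_right_mono) auto
    finally have 1: "\<bar>A y z - A y 0\<bar> \<le> beta / 4 * y\<^sup>2" .
    have "\<bar>A y 0 - beta * y\<^sup>2\<bar> = \<bar>beta3\<bar> * \<bar>y\<bar> * y\<^sup>2" by (simp add: A_axis abs_mult power3_eq_cube power2_eq_square)
    also have "\<dots> \<le> \<bar>beta3\<bar> * r * y\<^sup>2" using y by (intro mult_right_mono mult_left_mono) auto
    also have "\<dots> \<le> beta / 4 * y\<^sup>2" using r3 by (intro mult_right_mono) auto
    finally have 2: "\<bar>A y 0 - beta * y\<^sup>2\<bar> \<le> beta / 4 * y\<^sup>2" .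
    have "\<bar>A y z - beta * y\<^sup>2\<bar> \<le> \<bar>A y z - A y 0\<bar> + \<bar>A y 0 - beta * y\<^sup>2\<bar>" by linarith
    also have "\<dots> \<le> beta / 4 * y\<^sup>2 + beta / 4 * y\<^sup>2" using 1 2 by (rule add_mono)
    finally show ?thesis by linarith
  qed
  have A_low: "beta / 2 * y\<^sup>2 \<le> A y z" and A_up: "A y z \<le> 2 * beta * y\<^sup>2" if "\<bar>y\<bar> \<le> r" "\<bar>z\<bar> \<le> m * \<bar>y\<bar>" for y z
  proof -
    have "0 \<le> beta * y\<^sup>2" using beta by simp
    then show "beta / 2 * y\<^sup>2 \<le> A y z" using A_near[OF that] by linarith
    show "A y z \<le> 2 * beta * y\<^sup>2" using A_near[OF that] \<open>0 \<le> beta * y\<^sup>2\<close> by linarith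
  qed
  \<comment> \<open>With l2 = 0 the speed of y is A, which is at least beta y^2 / 2 on the cone;
    hence y increases, and only the side y < 0 moves towards the equilibrium.\<close>
  have inward: "cs.inward (-1) (beta / 2)"
    unfolding cs.inward_def using A_low beta l2 by auto
  define \<epsilon> where "\<epsilon> = m * r / H"
  have \<epsilon>: "0 < \<epsilon>" "H * \<epsilon> \<le> m * r" using m r H0 by (auto simp: \<epsilon>_def)
  \<comment> \<open>The reference orbit starts at the edge y = - r of the box, which lies outside of
    the \<epsilon>-ball. All of \<Gamma> is the part of this orbit after its last entry into the
    ball.\<close>
  obtain W0 where W0: "W0 0 = pos (- r) (cs.graph (- r))"
    "\<And>t. 0 \<le> t \<Longrightarrow> (W0 has_vector_derivative fld (W0 t)) (at t within {0..})"
    "(W0 \<longlongrightarrow> p) at_top"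
    "cs.clamped_sol (\<lambda>t. dl (W0 t - p)) (\<lambda>t. du (W0 t - p))"
    "\<And>t. 0 \<le> t \<Longrightarrow> W0 t = pos (dl (W0 t - p)) (cs.graph (dl (W0 t - p)))"
    "connects fld (pos (- r) (cs.graph (- r))) p W0" "dl (W0 0 - p) = - r"
    by (rule inward_orbit[OF cs inward, of "- r"]) (use r in auto)
  define Y where "Y t = dl (W0 t - p)" for t
  have Y0: "Y 0 = - r" using W0(7) by (simp add: Y_def)
  have sol: "cs.clamped_sol Y (\<lambda>t. du (W0 t - p))" using W0(4) by (simp add: Y_def[abs_def])
  have in0: "0 \<le> - 1 * Y 0" "\<bar>Y 0\<bar> \<le> r" "0 < - 1 * Y 0" using Y0 r by auto
  have Yneg: "Y t < 0" if "0 \<le> t" for t using cs.clamped_sol_pos[OF sol _ in0(3) that] by simp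
  have cont0: "continuous_on {0..} W0" using W0(6) by (simp add: connects_def)
  have contY: "continuous_on {0..} Y" using sol by (simp add: cs.clamped_sol_def)
  have out: "W0 0 \<notin> ball p \<epsilon>"
  proof -
    have "r \<le> H * norm (W0 0 - p)" using H(2)[of "W0 0 - p"] Y0 r by (simp add: Y_def)
    then have "r / H \<le> norm (W0 0 - p)" using H0 by (simp add: pos_divide_le_eq mult.commute)
    moreover have "\<epsilon> \<le> r / H" unfolding \<epsilon>_def using m r H0 by (intro divide_right_mono) (auto simp: mult_left_le_one_le)
    ultimately show ?thesis by (simp add: dist_norm norm_minus_commute)
  qed
  obtain T0 where T0: "0 \<le> T0" "W0 T0 \<notin> ball p \<epsilon>" "\<And>t. T0 < t \<Longrightarrow> W0 t \<in> ball p \<epsilon>"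
    by (rule last_exit[OF cont0 out W0(3) \<epsilon>(1)]) blast
  have der0: "(W0 has_vector_derivative fld (W0 t)) (at t)" if "0 < t" for t
    using W0(2)[of t] that at_within_interior[of t "{0..}"] by simp
  define \<Gamma> where "\<Gamma> = W0 ` {T0<..}"
  have solves0: "solves_in fld (ball p \<epsilon>) {T0<..} W0" using der0 T0 by (auto simp: solves_in_def)
  have max0: "maximal_in fld (ball p \<epsilon>) {T0<..} W0" by (rule maximal_in_after_exit[OF cont0 T0(1,2)])
  have conv: "converging_trajectory fld (ball p \<epsilon>) p \<Gamma>"
    unfolding converging_trajectory_def
  proof (rule exI[of _ "{T0<..}"], rule exI[of _ W0], intro conjI)
    show "\<not> bdd_above {T0<..}"
    proof
      assume "bdd_above {T0<..}"
      then obtain u where "\<And>x. T0 < x \<Longrightarrow> x \<le> u" by (auto simp: bdd_above_def)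
      from this[of "\<bar>T0\<bar> + \<bar>u\<bar> + 1"] show False by linarith
    qed
    show "is_interval {T0<..}" by (rule is_interval_oi)
    show "\<forall>I' w'. open I' \<and> is_interval I' \<and> {T0<..} \<subseteq> I' \<and> solves_in fld (ball p \<epsilon>) I' w' \<and>
        (\<forall>\<xi>\<in>{T0<..}. w' \<xi> = W0 \<xi>) \<longrightarrow> I' = {T0<..}"
      using max0 unfolding maximal_in_def .
  qed (use solves0 W0(3) \<Gamma>_def in auto)
  define Kp where "Kp = 2 * (2 * K) / l1"
  have Kp: "0 \<le> Kp" using K(1) eigen_sign(1) by (simp add: Kp_def)
  have tangent: "tangent_at \<Gamma> p {w. du (w - p) = 0}"
    unfolding tangent_at_def
  proof
    have ne: "W0 t \<noteq> p" if "0 \<le> t" for t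
    proof
      assume "W0 t = p"
      then have "Y t = dl (pos 0 0 - p)" by (simp add: Y_def pos_base)
      then show False using Yneg[OF that] by (simp only: dl_pos)
    qed
    show "p islimpt \<Gamma>"
      unfolding islimpt_approachable
    proof (intro allI impI)
      fix e :: real assume "0 < e"
      then have "eventually (\<lambda>t. dist (W0 t) p < e \<and> T0 < t) at_top"
        using tendstoD[OF W0(3)] eventually_gt_at_top by (auto intro: eventually_conj)
      then obtain t where "dist (W0 t) p < e" "T0 < t" by (auto dest!: eventually_happens)
      then show "\<exists>x'\<in>\<Gamma>. x' \<noteq> p \<and> dist x' p < e" using ne[of t] T0(1) by (auto simp: \<Gamma>_def)
    qed
    \<comment> \<open>The distance from the kernel line is at most |z| times the norm of
      \<open>base2\<close>, hence of second order in the distance from p by the parabola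
      estimate.\<close>
    define Q where "Q = Kp * norm base2 * H * H"
    have "norm (infdist w {w. du (w - p) = 0} / dist w p) \<le> Q * dist w p" if w: "w \<in> \<Gamma>" for w
    proof -
      obtain t where t: "T0 < t" "w = W0 t" using w by (auto simp: \<Gamma>_def)
      then have t0: "0 \<le> t" using T0 by simp
      define z where "z = du (W0 t - p)"
      have w_eq: "w = p + (Y t *\<^sub>R base1 + z *\<^sub>R base2)"
        using pos_dl_du[of w] t by (simp add: pos_base Y_def z_def)
      have "infdist w {w. du (w - p) = 0} \<le> dist w (p + Y t *\<^sub>R base1)"
        by (rule infdist_le) (use stable_line in blast)
      also have "\<dots> = \<bar>z\<bar> * norm base2" by (simp add: w_eq dist_norm)
      also have "\<dots> \<le> (Kp * (Y t)\<^sup>2) * norm base2"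
        using cs.inward_parabola[OF inward sol in0(1,2) t0] by (intro mult_right_mono) (auto simp: z_def Kp_def)
      also have "\<dots> \<le> (Kp * (H * dist w p)\<^sup>2) * norm base2"
      proof -
        have "\<bar>Y t\<bar> \<le> \<bar>H * dist w p\<bar>" using H(2)[of "W0 t - p"] t H0 by (simp add: Y_def dist_norm)
        then have "(Y t)\<^sup>2 \<le> (H * dist w p)\<^sup>2" by (simp only: abs_le_square_iff)
        then show ?thesis using Kp by (intro mult_right_mono mult_left_mono) auto
      qed
      also have "\<dots> = Q * dist w p * dist w p" by (simp add: Q_def power2_eq_square)
      finally have "infdist w {w. du (w - p) = 0} \<le> Q * dist w p * dist w p" .
      moreover have "0 < dist w p" using ne[OF t0] t by simp
      ultimately show ?thesis by (simp add: infdist_nonneg pos_divide_le_eq)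
    qed
    then have "\<forall>\<^sub>F w in at p within \<Gamma>. norm (infdist w {w. du (w - p) = 0} / dist w p) \<le> Q * dist w p"
      by (auto simp: eventually_at_filter)
    moreover have "((\<lambda>w. Q * dist w p) \<longlongrightarrow> 0) (at p within \<Gamma>)"
    proof -
      have "((\<lambda>w. Q * dist w p) \<longlongrightarrow> Q * dist p p) (at p within \<Gamma>)" by (intro tendsto_intros)
      then show ?thesis by simp
    qed
    ultimately show "((\<lambda>w. infdist w {w. du (w - p) = 0} / dist w p) \<longlongrightarrow> 0) (at p within \<Gamma>)"
      by (rule Lim_null_comparison)
  qed
  obtain Lf where Lf: "Lf-lipschitz_on (ball p \<epsilon>) fld"
    using polynomial_function_lipschitz[OF polynomial_function_fld, of "ball p \<epsilon>"] by auto
  \<comment> \<open>A competitor stays in the ball, so it lies on the graph, where the coordinate y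
    determines the point. It suffices to find a value of y that both trajectories take; after a time
    shift, two maximal solutions then meet. The limit point condition excludes the constant
    trajectory.\<close>
  have unique: "\<Gamma>' = \<Gamma>"
    if cv: "converging_trajectory fld (ball p \<epsilon>) p \<Gamma>'" and lp: "p islimpt \<Gamma>'" for \<Gamma>'
  proof -
    obtain I w where I: "open I" "is_interval I" "\<not> bdd_above I" and w: "solves_in fld (ball p \<epsilon>) I w"
      and mx: "maximal_in fld (ball p \<epsilon>) I w" and wlim: "(w \<longlongrightarrow> p) at_top" and G': "\<Gamma>' = w ` I"
      by (rule converging_trajectoryE[OF cv]) (rule that; assumption)
    have up: "t \<in> I" if "s \<in> I" "s \<le> t" for s t
    proof -
      obtain e where "e \<in> I" "t < e" using I(3) unfolding bdd_above_def by (meson not_le)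
      then show ?thesis using I(2) that unfolding is_interval_1 by (meson less_imp_le)
    qed
    have orb: "cs.clamped_sol (\<lambda>t. dl (w (s + t) - p)) (\<lambda>t. du (w (s + t) - p))"
      "\<And>t. 0 \<le> t \<Longrightarrow> w (s + t) = pos (dl (w (s + t) - p)) (cs.graph (dl (w (s + t) - p)))"
      "\<And>t. 0 \<le> t \<Longrightarrow> \<bar>dl (w (s + t) - p)\<bar> \<le> r" if s: "s \<in> I" for s
    proof -
      have d: "((\<lambda>t. w (s + t)) has_vector_derivative fld (w (s + t))) (at t)" "w (s + t) \<in> ball p \<epsilon>" if "0 \<le> t" for t
      proof -
        have "solves_in fld (ball p \<epsilon>) ((+) (- s) ` I) (\<lambda>t. w (t - - s))" by (rule solves_in_shift[OF w])
        moreover have "t \<in> (+) (- s) ` I" using up[OF s, of "s + t"] that by (intro image_eqI[of _ _ "s + t"]) auto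
        ultimately show "((\<lambda>t. w (s + t)) has_vector_derivative fld (w (s + t))) (at t)" "w (s + t) \<in> ball p \<epsilon>"
          unfolding solves_in_def by (auto simp: add.commute)
      qed
      have c: "continuous_on {0..} (\<lambda>t. w (s + t))"
        by (intro continuous_at_imp_continuous_on ballI has_vector_derivative_continuous[OF d(1)]) simp
      note og = orbit_on_graph[OF cs H(2,3) H0 \<epsilon>(2) c d(1)[OF less_imp_le] d(2)]
      show "cs.clamped_sol (\<lambda>t. dl (w (s + t) - p)) (\<lambda>t. du (w (s + t) - p))"
        "\<And>t. 0 \<le> t \<Longrightarrow> w (s + t) = pos (dl (w (s + t) - p)) (cs.graph (dl (w (s + t) - p)))"
        "\<And>t. 0 \<le> t \<Longrightarrow> \<bar>dl (w (s + t) - p)\<bar> \<le> r"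
        by (rule og; assumption)+
    qed
    obtain s where s: "s \<in> I" "w s \<noteq> p"
    proof -
      have "\<not> \<Gamma>' \<subseteq> {p}" using lp by (meson finite.emptyI finite.insertI islimpt_finite islimpt_subset)
      then show ?thesis using that G' by auto
    qed
    define y where "y t = dl (w (s + t) - p)" for t
    have ysol: "cs.clamped_sol y (\<lambda>t. du (w (s + t) - p))" using orb(1)[OF s(1)] by (simp add: y_def[abs_def])
    have ylim: "(y \<longlongrightarrow> 0) at_top"
    proof -
      have "filterlim (\<lambda>t. s + t) at_top at_top" by (rule filterlim_tendsto_add_at_top[OF tendsto_const filterlim_ident])
      then have "((\<lambda>t. w (s + t) - p) \<longlongrightarrow> p - p) at_top"
        by (intro tendsto_diff tendsto_const filterlim_compose[OF wlim])
      from bounded_linear.tendsto[OF bounded_linear_dl this] show ?thesis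
        using linear_0[OF bounded_linear.linear[OF bounded_linear_dl]] by (simp add: y_def[abs_def])
    qed
    \<comment> \<open>On the side y > 0 the coordinate would increase and could not tend to
      0.\<close>
    have y0: "y 0 < 0"
    proof (rule ccontr)
      assume "\<not> y 0 < 0"
      moreover have "y 0 \<noteq> 0"
      proof
        assume "y 0 = 0"
        then have "w s = pos 0 (cs.graph 0)" using orb(2)[OF s(1), of 0] by (simp add: y_def)
        then show False using s(2) by (simp add: cs.graph_0 pos_base)
      qed
      ultimately have ypos: "0 < 1 * y 0" by simp
      have "y 0 \<le> y t" if t: "0 \<le> t" for t
      proof (rule DERIV_nonneg_imp_increasing_open[OF t])
        show "continuous_on {0..t} y" using ysol by (auto simp: cs.clamped_sol_def intro: continuous_on_subset)
        fix x assume x: "0 < x" "x < t"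
        let ?z = "du (w (s + x) - p)"
        have yb: "\<bar>y x\<bar> \<le> r" "\<bar>?z\<bar> \<le> m * \<bar>y x\<bar>"
          using orb(3)[OF s(1), of x] cs.clamped_sol_cone0[OF ysol, of x] x by (auto simp: y_def)
        have "m * \<bar>y x\<bar> \<le> m * r" using yb m by (intro mult_left_mono) auto
        then have "cs.cA (y x) ?z = A (y x) ?z" using yb by (intro cs.c_inside) auto
        moreover have "(y has_real_derivative - (- l2) * y x + cs.cA (y x) ?z) (at x)"
          using ysol x unfolding cs.clamped_sol_def by blast
        ultimately have "(y has_real_derivative A (y x) ?z) (at x)" by (simp add: l2)
        moreover have "0 \<le> beta / 2 * (y x)\<^sup>2" using beta by simp
        then have "0 \<le> A (y x) ?z" using A_low[OF yb] by linarith
        ultimately show "\<exists>d. (y has_real_derivative d) (at x) \<and> 0 \<le> d" by blast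
      qed
      then have "y 0 \<le> 0" by (intro tendsto_lowerbound[OF ylim]) (auto simp: eventually_at_top_linorder)
      then show False using ypos by simp
    qed
    \<comment> \<open>A common value is found by intermediate values: wait until y exceeds Y (T0 +
      1), then until Y exceeds that value of y. Starting at T0 + 1 keeps the meeting time inside the
      open interval, which T0 itself is not in.\<close>
    have Y1: "Y (T0 + 1) < 0" using Yneg T0(1) by simp
    have "eventually (\<lambda>t. Y (T0 + 1) < y t \<and> 0 \<le> t) at_top"
      using order_tendstoD(1)[OF ylim Y1] eventually_ge_at_top by (rule eventually_conj)
    then obtain \<tau> where \<tau>: "Y (T0 + 1) < y \<tau>" "0 \<le> \<tau>" by (auto dest!: eventually_happens)
    have "y \<tau> < 0" using cs.clamped_sol_pos[OF ysol, of "-1" \<tau>] y0 \<tau>(2) by simp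
    then have "eventually (\<lambda>t. y \<tau> < Y t \<and> T0 + 1 \<le> t) at_top"
      using order_tendstoD(1)[OF cs.inward_tendsto(1)[OF inward sol in0(1,2)]] eventually_ge_at_top by (auto intro: eventually_conj)
    then obtain T1 where T1: "y \<tau> < Y T1" "T0 + 1 \<le> T1" by (auto dest!: eventually_happens)
    have "continuous_on {T0 + 1..T1} Y" by (rule continuous_on_subset[OF contY]) (use T0(1) in auto)
    then obtain t2 where t2: "T0 + 1 \<le> t2" "t2 \<le> T1" "Y t2 = y \<tau>"
      using IVT'[of Y "T0 + 1" "y \<tau>" T1] \<tau>(1) T1 by auto
    have s\<tau>: "s + \<tau> \<in> I" using up[OF s(1)] \<tau>(2) by simp
    have meet: "W0 t2 = w (s + \<tau>)"
      using W0(5)[of t2] orb(2)[OF s(1) \<tau>(2)] t2 T0(1) by (simp add: Y_def y_def)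
    define e where "e = t2 - (s + \<tau>)"
    note shifted = solves_in_shift[OF w, of e] maximal_in_shift[OF mx, of e]
    have sI: "open ((+) e ` I)" "is_interval ((+) e ` I)"
      using open_translation[OF I(1)] I(2) by (auto simp: is_interval_translation)
    have "W0 ` {T0<..} = (\<lambda>t. w (t - e)) ` (+) e ` I"
    proof -
      have "t2 \<in> (+) e ` I" using s\<tau> by (intro image_eqI[of _ _ "s + \<tau>"]) (auto simp: e_def)
      moreover have "W0 t2 = w (t2 - e)" using meet by (simp add: e_def)
      ultimately show ?thesis
        using maximal_in_unique(2)[OF Lf solves0 shifted(1) _ _ max0 sI shifted(2), of t2] t2(1) is_interval_oi[of T0] by simp
    qed
    then show ?thesis by (simp add: G' \<Gamma>_def image_image)
  qed
  obtain G where G: "G 0 = (\<lambda>w. w - p)" "\<And>n. polynomial_function (G n)"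
    "\<And>n W t S. (W has_vector_derivative fld (W t)) (at t within S) \<Longrightarrow>
       ((\<lambda>s. G n (W s)) has_vector_derivative G (Suc n) (W t)) (at t within S)"
    by (rule polynomial_lie_derivatives[OF polynomial_function_fld, of "\<lambda>w. w - p"])
      (auto intro!: polynomial_function_diff polynomial_function_id polynomial_function_const)
  have decY: "\<bar>Y t\<bar> \<le> (2 / beta) / t ^ 1" if t: "1 \<le> t" for t
  proof -
    have "\<bar>Y t\<bar> * (1 + beta / 2 * \<bar>Y 0\<bar> * t) \<le> \<bar>Y 0\<bar>"
      by (rule cs.inward_decay[OF inward sol in0(1,2)]) (use t in simp)
    moreover have "\<bar>Y t\<bar> * (1 + beta / 2 * \<bar>Y 0\<bar> * t) = \<bar>Y t\<bar> + \<bar>Y 0\<bar> * (\<bar>Y t\<bar> * (beta / 2 * t))"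
      by (simp add: algebra_simps)
    ultimately have "\<bar>Y 0\<bar> * (\<bar>Y t\<bar> * (beta / 2 * t)) \<le> \<bar>Y 0\<bar> * 1" by linarith
    moreover have "0 < \<bar>Y 0\<bar>" using Y0 r(1) by simp
    ultimately have "\<bar>Y t\<bar> * (beta / 2 * t) \<le> 1" by (simp only: mult_le_cancel_left_pos)
    then show ?thesis using t beta by (simp add: field_simps)
  qed
  have d1: "decays 1 Y" by (rule decaysI[of 1, OF decY]) auto
  have d2: "decays 1 (\<lambda>t. du (W0 t - p))"
  proof (rule decaysI[of 1])
    fix t :: real assume t: "1 \<le> t"
    have "\<bar>du (W0 t - p)\<bar> \<le> m * \<bar>Y t\<bar>" using cs.clamped_sol_cone0[OF sol, of t] t by simp
    also have "\<dots> \<le> \<bar>Y t\<bar>" using m by (simp add: mult_left_le_one_le)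
    finally show "\<bar>du (W0 t - p)\<bar> \<le> (2 / beta) / t ^ 1" using decY[OF t] by linarith
  qed simp
  have decG: "decays (Suc n) (\<lambda>t. norm (G n (W0 t)))" for n
    by (rule center_orbit_decay[OF l2 W0(2) G(1,3) d1[unfolded Y_def[abs_def]] d2])
  have "\<exists>C>0. \<forall>t\<ge>0. norm (G n (W0 t)) \<le> C / (1 + t) ^ n" for n
  proof -
    have "continuous_on {0..} (\<lambda>t. norm (G n (W0 t)))"
      by (intro continuous_on_norm continuous_on_vector_derivative[OF G(3)] W0(2)) auto
    then obtain C where "0 < C" "\<And>t. 0 \<le> t \<Longrightarrow> \<bar>norm (G n (W0 t))\<bar> \<le> C / (1 + t) ^ n"
      by (rule decays_bound[OF decG]) (rule that; assumption)
    then show ?thesis by (intro exI[of _ C]) auto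
  qed
  then obtain C0 where C0: "\<And>n. 0 < C0 n" "\<And>n t. 0 \<le> t \<Longrightarrow> norm (G n (W0 t)) \<le> C0 n / (1 + t) ^ n" by metis
  \<comment> \<open>The constant in the lower bound e / (1 + s) for the distance from p at time s:
    \<open>inward_decay_lower\<close> with rate 2 beta and |Y 0| = r, passed to the norm by
    H.\<close>
  define e where "e = r / (1 + 2 * beta * r) / H"
  have e: "0 < e" "e \<le> 1"
  proof -
    define q where "q = 1 + 2 * beta * r"
    have q: "1 \<le> q" using beta r by (simp add: q_def)
    have e_q: "e = r / (q * H)" by (simp add: e_def q_def)
    have "1 * 1 \<le> q * H" using q H(1) by (intro mult_mono) auto
    then show "0 < e" "e \<le> 1" using r by (simp_all add: e_q)
  qed
  have lower: "e / (1 + s) \<le> norm (p - W0 s)" if s: "0 \<le> s" for s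
  proof -
    have "r \<le> \<bar>Y s\<bar> * (1 + 2 * beta * r * s)"
      using cs.inward_decay_lower[OF inward sol in0(1,2) s, of "2 * beta"] A_up Y0 r(1) l2 by simp
    also have "\<dots> \<le> \<bar>Y s\<bar> * ((1 + 2 * beta * r) * (1 + s))"
      using s beta r by (intro mult_left_mono) (auto simp: algebra_simps)
    finally have "r \<le> \<bar>Y s\<bar> * ((1 + 2 * beta * r) * (1 + s))" .
    moreover have "\<bar>Y s\<bar> \<le> H * norm (p - W0 s)" using H(2)[of "W0 s - p"] by (simp add: Y_def norm_minus_commute)
    moreover have P: "0 < (1 + 2 * beta * r) * (1 + s)" using s beta r by (intro mult_pos_pos) (auto intro: add_pos_nonneg)
    ultimately have "r \<le> H * norm (p - W0 s) * ((1 + 2 * beta * r) * (1 + s))"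
      using mult_right_mono[OF _ less_imp_le[OF P]] order_trans by blast
    then have "r / (H * ((1 + 2 * beta * r) * (1 + s))) \<le> norm (p - W0 s)"
      using P H0 by (simp add: pos_divide_le_eq mult_ac)
    then show ?thesis by (simp add: e_def mult_ac)
  qed
  \<comment> \<open>C0 bounds the derivatives of the one reference orbit in terms of its own time;
    dividing by e^n converts that time into the distance of the starting point from p.\<close>
  define C where "C n = C0 n / e ^ n" for n
  have C: "0 < C n" for n using C0(1) e(1) by (simp add: C_def)
  show ?thesis
  \<comment> \<open>The estimates hold for every start on \<Gamma>, so \<delta> only has to lie
    between 0 and \<epsilon>.\<close>
  proof (rule exI[of _ "\<epsilon> / 2"], rule exI[of _ \<epsilon>], rule exI[of _ \<Gamma>], rule exI[of _ C], intro conjI allI ballI)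
    show "converging_trajectory fld (ball p \<epsilon>) p \<Gamma>' \<and> tangent_at \<Gamma>' p {w. du (w - p) = 0} \<longleftrightarrow> \<Gamma>' = \<Gamma>" for \<Gamma>'
      using unique conv tangent unfolding tangent_at_def by blast
    fix w0 assume "w0 \<in> \<Gamma>"
    then obtain s where s: "T0 < s" "w0 = W0 s" by (auto simp: \<Gamma>_def)
    define W where "W t = W0 (s + t)" for t
    have s0: "0 < s" using s T0(1) by simp
    have derW: "(W has_vector_derivative fld (W t)) (at t)" if "0 \<le> t" for t
    proof -
      have "((\<lambda>t. s + t) has_vector_derivative 1) (at t)"
        unfolding has_real_derivative_iff_has_vector_derivative[symmetric] by (auto intro!: derivative_eq_intros)
      from vector_diff_chain_at[OF this, of W0 "fld (W0 (s + t))"] der0[of "s + t"] s0 that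
      show ?thesis by (simp add: W_def[abs_def] o_def)
    qed
    have con: "connects fld w0 p W"
      unfolding connects_def
    proof (intro conjI allI impI)
      show "continuous_on {0..} W"
        by (intro continuous_at_imp_continuous_on ballI has_vector_derivative_continuous[OF derW]) simp
      have "filterlim (\<lambda>t. s + t) at_top at_top" by (rule filterlim_tendsto_add_at_top[OF tendsto_const filterlim_ident])
      then show "(W \<longlongrightarrow> p) at_top" unfolding W_def by (rule filterlim_compose[OF W0(3)])
    qed (use s derW in \<open>auto simp: W_def\<close>)
    define \<eta> where "\<eta> = norm (p - w0)"
    have \<eta>: "e / (1 + s) \<le> \<eta>" "0 < \<eta>"
    proof -
      show "e / (1 + s) \<le> \<eta>" using lower[of s] s0 s by (simp add: \<eta>_def)
      moreover have "0 < e / (1 + s)" using e(1) s0 by simp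
      ultimately show "0 < \<eta>" by linarith
    qed
    have bound: "norm (G n (W \<xi>)) \<le> C n * \<eta> ^ n / (1 + \<eta> * \<xi>) ^ n" if \<xi>: "0 \<le> \<xi>" for n \<xi>
    proof -
      \<comment> \<open>The conversion of time into distance: e (1 + \<eta> \<xi>) \<le> \<eta> (1 +
        s + \<xi>), by the lower bound for \<eta> in the first term and e \<le> 1 in the second.
        Decay in the time s + \<xi> of the reference orbit thus becomes decay in \<eta> \<xi>,
        uniformly in s.\<close>
      have "e \<le> \<eta> * (1 + s)" using \<eta>(1) s0 by (simp add: pos_divide_le_eq)
      moreover have "e * (\<eta> * \<xi>) \<le> 1 * (\<eta> * \<xi>)" using e \<eta>(2) \<xi> by (intro mult_right_mono) auto
      ultimately have "e * (1 + \<eta> * \<xi>) \<le> \<eta> * (1 + (s + \<xi>))" by (simp add: algebra_simps)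
      moreover have "0 < 1 + \<eta> * \<xi>" "0 < 1 + (s + \<xi>)" using \<eta>(2) \<xi> s0 by (auto intro: add_pos_nonneg)
      ultimately have "e / (1 + (s + \<xi>)) \<le> \<eta> / (1 + \<eta> * \<xi>)" by (simp add: frac_le_eq divide_le_0_iff field_simps)
      then have "(e / (1 + (s + \<xi>))) ^ n \<le> (\<eta> / (1 + \<eta> * \<xi>)) ^ n"
        using e s0 \<xi> by (intro power_mono) auto
      then have le: "e ^ n / (1 + (s + \<xi>)) ^ n \<le> \<eta> ^ n / (1 + \<eta> * \<xi>) ^ n" by (simp add: power_divide)
      have "norm (G n (W \<xi>)) \<le> C0 n / (1 + (s + \<xi>)) ^ n" using C0(2)[of "s + \<xi>" n] s0 \<xi> by (simp add: W_def)
      also have "\<dots> = C n * (e ^ n / (1 + (s + \<xi>)) ^ n)" using e(1) by (simp add: C_def)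
      also have "\<dots> \<le> C n * (\<eta> ^ n / (1 + \<eta> * \<xi>) ^ n)" using le C[of n] by (intro mult_left_mono) auto
      finally show ?thesis by simp
    qed
    have "derivs_bounded_by W p (\<lambda>n \<xi>. C n * \<eta> ^ n / (1 + \<eta> * \<xi>) ^ n)"
      unfolding derivs_bounded_by_def
    proof (intro exI[of _ "\<lambda>n \<xi>. G n (W \<xi>)"] conjI allI impI bound)
      show "((\<lambda>\<xi>. G n (W \<xi>)) has_vector_derivative G (Suc n) (W \<xi>)) (at \<xi> within {0..})" if "0 \<le> \<xi>" for n \<xi>
        by (rule G(3)[OF has_vector_derivative_at_within[OF derW[OF that]]])
    qed (simp_all add: G(1))
    then show "\<exists>W. connects fld w0 p W \<and>
        derivs_bounded_by W p (\<lambda>n \<xi>. C n * norm (p - w0) ^ n / (1 + norm (p - w0) * \<xi>) ^ n) \<and>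
        (\<forall>W'. connects fld w0 p W' \<longrightarrow> (\<forall>\<xi>\<ge>0. W' \<xi> = W \<xi>))"
      using con connects_unique[OF polynomial_function_fld con] unfolding \<eta>_def by blast
  qed (use \<epsilon> C in auto)
qed

end

section \<open>The supersonic case and the boundary layer problem\<close>

text \<open>The terms are grouped, and the cubic one is added with a negative coefficient, so that
  the components match those of \<open>saddle_field.fld\<close> literally.\<close>

lemma red_field_nth:
  "red_field R \<gamma> \<mu> \<kappa> up \<theta>p w $ 1 = (up\<^sup>2 - R * \<theta>p) / (\<mu> * up) * (w$1 - up) + R / \<mu> * (w$2 - \<theta>p)
     + 1 / \<mu> * (w$1 - up)\<^sup>2"
  "red_field R \<gamma> \<mu> \<kappa> up \<theta>p w $ 2 = R * \<theta>p / \<kappa> * (w$1 - up) + R * up / (\<kappa> * (\<gamma> - 1)) * (w$2 - \<theta>p)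
     + ((R * \<theta>p / (\<kappa> * up) - up / (2 * \<kappa>)) * (w$1 - up)\<^sup>2
        + R / (\<kappa> * (\<gamma> - 1)) * (w$1 - up) * (w$2 - \<theta>p) + - (1 / (2 * \<kappa>)) * (w$1 - up)^3)"
  unfolding red_field_def red_J_def red_F_def
  by (simp_all add: matrix_vector_mult_def sum_2)

lemma polynomial_function_red_field: "polynomial_function (red_field R \<gamma> \<mu> \<kappa> up \<theta>p)"
proof -
  have nth: "real_polynomial_function (\<lambda>w::real^2. w $ i)" for i
    by (rule real_polynomial_function.intros(1)) (rule bounded_linear_vec_nth)
  note poly = real_polynomial_function.intros(2-4) real_polynomial_function_diff real_polynomial_function_power nth
  have "real_polynomial_function (\<lambda>w. red_field R \<gamma> \<mu> \<kappa> up \<theta>p w $ 1)"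
    "real_polynomial_function (\<lambda>w. red_field R \<gamma> \<mu> \<kappa> up \<theta>p w $ 2)"
    unfolding red_field_nth by (intro poly)+
  then have "real_polynomial_function (\<lambda>w. red_field R \<gamma> \<mu> \<kappa> up \<theta>p w $ i)" for i
    using exhaust_2[of i] by auto
  then show ?thesis unfolding polynomial_function_iff_Basis_inner
    by (auto simp: Basis_vec_def inner_axis)
qed

text \<open>Half the derivative of c x^2 + b y^2 along the field. These weights symmetrise the
  linear part: its quadratic form is a c x^2 + 2 b c x y + b d y^2, positive definite because b c <
  a d, and the higher terms are small compared with it near 0.\<close>

lemma supersonic_quadratic_form:
  fixes a b c d q1 q2 q3 q4 :: real
  assumes pos: "0 < a" "0 < b" "0 < c" "0 < d" and det: "b * c < a * d"
  obtains \<rho> where "0 < \<rho>" "\<And>x y. \<bar>x\<bar> \<le> \<rho> \<Longrightarrow> \<bar>y\<bar> \<le> \<rho> \<Longrightarrow>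
    0 \<le> c * x * (a * x + b * y + q1 * x\<^sup>2) + b * y * (c * x + d * y + (q2 * x\<^sup>2 + q3 * x * y + q4 * x^3))"
proof -
  \<comment> \<open>The weight in the Young inequality for the mixed term. P1 is positive for \<eta>
    < a / b and P2 for \<eta> > c / d, and b c < a d leaves room between the two.\<close>
  define \<eta> where "\<eta> = (a / b + c / d) / 2"
  have cd: "c / d < a / b" using pos det by (simp add: divide_less_eq less_divide_eq field_simps)
  have mid: "u < (v + u) / 2 \<and> (v + u) / 2 < v" if "u < v" for u v :: real using that by auto
  have "c / d < \<eta>" "\<eta> < a / b" using mid[OF cd] by (simp_all only: \<eta>_def)
  moreover have "0 < \<eta>" using pos by (simp add: \<eta>_def add_pos_pos)
  ultimately have \<eta>: "0 < \<eta>" "c / d < \<eta>" "\<eta> < a / b" by auto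
  define P1 where "P1 = c * (a - b * \<eta>)"
  define P2 where "P2 = b * (d - c / \<eta>)"
  have "b * \<eta> < a" "c / \<eta> < d" using \<eta> pos by (simp_all add: field_simps)
  then have P: "0 < P1" "0 < P2" using pos by (simp_all add: P1_def P2_def)
  have form: "P1 * x\<^sup>2 + P2 * y\<^sup>2 \<le> c * x * (a * x + b * y) + b * y * (c * x + d * y)" for x y
  proof -
    have "0 \<le> (\<eta> * x + y)\<^sup>2 / \<eta>" using \<eta> by simp
    also have "\<dots> = \<eta> * x\<^sup>2 + 2 * x * y + y\<^sup>2 / \<eta>" using \<eta> by (simp add: power2_eq_square field_simps)
    finally have "0 \<le> b * c * (\<eta> * x\<^sup>2 + 2 * x * y + y\<^sup>2 / \<eta>)" using pos by simp
    then show ?thesis by (simp add: P1_def P2_def algebra_simps power2_eq_square)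
  qed
  define N where "N = c * \<bar>q1\<bar> + b * (\<bar>q2\<bar> + \<bar>q3\<bar> + \<bar>q4\<bar>)"
  have N: "0 \<le> N" using pos by (simp add: N_def)
  define \<rho> where "\<rho> = min 1 (min P1 P2 / (N + 1))"
  have \<rho>: "0 < \<rho>" "\<rho> \<le> 1" using P N by (auto simp: \<rho>_def)
  have "\<rho> * (N + 1) \<le> min P1 P2 / (N + 1) * (N + 1)" using N by (intro mult_right_mono) (auto simp: \<rho>_def)
  then have "\<rho> * (N + 1) \<le> min P1 P2" using N by simp
  then have \<rho>N: "\<rho> * N \<le> P1" "\<rho> * N \<le> P2" using \<rho> by (auto simp: distrib_left)
  show ?thesis
  proof (rule that[OF \<rho>(1)])
    fix x y :: real assume xy: "\<bar>x\<bar> \<le> \<rho>" "\<bar>y\<bar> \<le> \<rho>"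
    define s where "s = x\<^sup>2 + y\<^sup>2"
    have "2 * (\<bar>x\<bar> * \<bar>y\<bar>) \<le> s" using sum_squares_bound[of "\<bar>x\<bar>" "\<bar>y\<bar>"] by (simp add: s_def)
    moreover have "0 \<le> \<bar>x\<bar> * \<bar>y\<bar>" by simp
    ultimately have "\<bar>x\<bar> * \<bar>y\<bar> \<le> s" by linarith
    then have s: "0 \<le> s" "x\<^sup>2 \<le> s" "\<bar>x\<bar> * \<bar>y\<bar> \<le> s" by (auto simp: s_def)
    have 1: "\<bar>c * x * (q1 * x\<^sup>2)\<bar> \<le> \<rho> * s * (c * \<bar>q1\<bar>)"
    proof -
      have "\<bar>x\<bar> * x\<^sup>2 \<le> \<rho> * s" using xy s \<rho> by (intro mult_mono) auto
      then have "(c * \<bar>q1\<bar>) * (\<bar>x\<bar> * x\<^sup>2) \<le> (c * \<bar>q1\<bar>) * (\<rho> * s)" using pos by (intro mult_left_mono) auto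
      then show ?thesis using pos by (simp add: abs_mult mult_ac)
    qed
    have yb: "\<bar>b * y * (q * w)\<bar> \<le> \<rho> * s * (b * \<bar>q\<bar>)" if "\<bar>w\<bar> \<le> s" for q w
    proof -
      have "\<bar>y\<bar> * \<bar>w\<bar> \<le> \<rho> * s" using xy that \<rho> by (intro mult_mono) auto
      then have "(b * \<bar>q\<bar>) * (\<bar>y\<bar> * \<bar>w\<bar>) \<le> (b * \<bar>q\<bar>) * (\<rho> * s)" using pos by (intro mult_left_mono) auto
      then show ?thesis using pos by (simp add: abs_mult mult_ac)
    qed
    have x3: "\<bar>x^3\<bar> \<le> s"
    proof -
      have "\<bar>x\<bar> * x\<^sup>2 \<le> 1 * s" using xy s \<rho> by (intro mult_mono) auto
      then show ?thesis by (simp add: power3_eq_cube power2_eq_square abs_mult)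
    qed
    have xyb: "\<bar>x * y\<bar> \<le> s" using s by (simp add: abs_mult)
    have x2: "\<bar>x\<^sup>2\<bar> \<le> s" using s by simp
    let ?nl = "c * x * (q1 * x\<^sup>2) + (b * y * (q2 * x\<^sup>2) + b * y * (q3 * (x * y)) + b * y * (q4 * x^3))"
    have "\<bar>?nl\<bar> \<le> \<rho> * s * (c * \<bar>q1\<bar>) + (\<rho> * s * (b * \<bar>q2\<bar>) + \<rho> * s * (b * \<bar>q3\<bar>) + \<rho> * s * (b * \<bar>q4\<bar>))"
      using 1 yb[OF x2, of q2] yb[OF xyb, of q3] yb[OF x3, of q4] by linarith
    also have "\<dots> = \<rho> * N * s" by (simp add: N_def algebra_simps)
    also have "\<dots> \<le> P1 * x\<^sup>2 + P2 * y\<^sup>2"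
      using mult_right_mono[OF \<rho>N(1), of "x\<^sup>2"] mult_right_mono[OF \<rho>N(2), of "y\<^sup>2"] by (simp add: s_def distrib_left)
    finally have "0 \<le> c * x * (a * x + b * y) + b * y * (c * x + d * y) + ?nl" using form[of x y] by linarith
    then show "0 \<le> c * x * (a * x + b * y + q1 * x\<^sup>2) + b * y * (c * x + d * y + (q2 * x\<^sup>2 + q3 * x * y + q4 * x^3))"
      by (simp add: distrib_left mult.assoc)
  qed
qed

text \<open>The weighted energy is nondecreasing once the orbit is close to p, yet tends to 0, so
  the orbit sits at p from some finite time on. Backward uniqueness carries this to time 0. No
  smallness of the starting distance enters.\<close>

lemma repelling_no_connection:
  fixes f :: "real^2 \<Rightarrow> real^2"
  assumes pos: "0 < a" "0 < b" "0 < c" "0 < d" and det: "b * c < a * d"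
    and f1: "\<And>w. f w $ 1 = a * (w$1 - p$1) + b * (w$2 - p$2) + q1 * (w$1 - p$1)\<^sup>2"
    and f2: "\<And>w. f w $ 2 = c * (w$1 - p$1) + d * (w$2 - p$2)
       + (q2 * (w$1 - p$1)\<^sup>2 + q3 * (w$1 - p$1) * (w$2 - p$2) + q4 * (w$1 - p$1)^3)"
    and poly: "polynomial_function f" and W: "connects f w0 p W"
  shows "w0 = p"
proof -
  obtain \<rho> where \<rho>: "0 < \<rho>" "\<And>x y. \<bar>x\<bar> \<le> \<rho> \<Longrightarrow> \<bar>y\<bar> \<le> \<rho> \<Longrightarrow>
    0 \<le> c * x * (a * x + b * y + q1 * x\<^sup>2) + b * y * (c * x + d * y + (q2 * x\<^sup>2 + q3 * x * y + q4 * x^3))"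
    using supersonic_quadratic_form[OF pos det] by blast
  have cont: "continuous_on {0..} W" and W0: "W 0 = w0" and lim: "(W \<longlongrightarrow> p) at_top"
    and der: "\<And>t. 0 < t \<Longrightarrow> (W has_vector_derivative f (W t)) (at t)" using W by (auto simp: connects_def)
  define x where "x t = W t $ 1 - p $ 1" for t
  define y where "y t = W t $ 2 - p $ 2" for t
  define E where "E t = c * (x t)\<^sup>2 + b * (y t)\<^sup>2" for t
  have dn: "((\<lambda>t. W t $ i - p $ i) has_real_derivative f (W t) $ i) (at t)" if "0 < t" for t i
    using has_vector_derivative_diff[OF bounded_linear.has_vector_derivative[OF bounded_linear_vec_nth der[OF that]]
        has_vector_derivative_const[of "p $ i"]]
    by (simp add: has_real_derivative_iff_has_vector_derivative)
  have dE: "(E has_real_derivative 2 * (c * x t * f (W t) $ 1 + b * y t * f (W t) $ 2)) (at t)" if "0 < t" for t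
  proof -
    have "(x has_real_derivative f (W t) $ 1) (at t)" "(y has_real_derivative f (W t) $ 2) (at t)"
      using dn[OF that, of 1] dn[OF that, of 2] by (simp_all add: x_def[abs_def] y_def[abs_def])
    then show ?thesis unfolding E_def by (auto intro!: derivative_eq_intros simp: algebra_simps)
  qed
  have "eventually (\<lambda>t. dist (W t) p < \<rho> \<and> 0 < t) at_top"
    using tendstoD[OF lim \<rho>(1)] eventually_gt_at_top by (rule eventually_conj)
  then obtain T where T: "\<And>t. T \<le> t \<Longrightarrow> dist (W t) p < \<rho> \<and> 0 < t" by (auto simp: eventually_at_top_linorder)
  have T0: "0 < T" using T[of T] by simp
  have mono: "E T \<le> E t" if t: "T \<le> t" for t
  proof (rule DERIV_nonneg_imp_nondecreasing[OF t])
    fix s assume s: "T \<le> s" "s \<le> t"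
    have "\<bar>x s\<bar> \<le> \<rho>" "\<bar>y s\<bar> \<le> \<rho>"
      using T[OF s(1)] component_bounds2[of "W s - p"] by (auto simp: x_def y_def dist_norm)
    from \<rho>(2)[OF this] have "0 \<le> 2 * (c * x s * f (W s) $ 1 + b * y s * f (W s) $ 2)"
      unfolding f1 f2 x_def y_def by simp
    then show "\<exists>d. (E has_real_derivative d) (at s) \<and> 0 \<le> d" using dE[of s] T[OF s(1)] by blast
  qed
  have "(E \<longlongrightarrow> c * (p$1 - p$1)\<^sup>2 + b * (p$2 - p$2)\<^sup>2) at_top"
    unfolding E_def x_def y_def by (intro tendsto_intros tendsto_vec_nth lim)
  then have "(E \<longlongrightarrow> 0) at_top" by simp
  then have "E T \<le> 0" by (rule tendsto_lowerbound) (auto simp: eventually_at_top_linorder intro: mono)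
  moreover have nn: "0 \<le> c * (x T)\<^sup>2" "0 \<le> b * (y T)\<^sup>2" using pos by auto
  ultimately have "c * (x T)\<^sup>2 + b * (y T)\<^sup>2 = 0" unfolding E_def by linarith
  then have "c * (x T)\<^sup>2 = 0 \<and> b * (y T)\<^sup>2 = 0" by (simp only: add_nonneg_eq_0_iff[OF nn])
  then have WT: "W T = p" using pos by (simp add: x_def y_def vec_eq_iff forall_2)
  have fp: "f p = 0" by (simp add: vec_eq_iff forall_2 f1 f2)
  have c: "continuous_on {0..T} W" using cont by (rule continuous_on_subset) auto
  have "bounded (insert p (W ` {0..T}))"
    using compact_continuous_image[OF c] by (simp add: compact_imp_bounded)
  then obtain L where L: "L-lipschitz_on (insert p (W ` {0..T})) f"
    using polynomial_function_lipschitz[OF poly] by blast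
  have "W 0 = (\<lambda>t. p) 0"
    by (rule ode_unique_backward[OF L less_imp_le[OF T0] c]) (use der fp WT in auto)
  then show ?thesis using W0 by simp
qed

section \<open>From the boundary layer problem to the planar system\<close>

text \<open>The mean value theorem on intervals of length one. It fixes the constants of
  integration, since \<open>bl_solution\<close> prescribes limits of the functions and not of their
  derivatives.\<close>

lemma tendsto_derivative_zero:
  fixes f :: "real \<Rightarrow> real"
  assumes f: "(f \<longlongrightarrow> l) at_top" and f': "(f' \<longlongrightarrow> k) at_top"
    and der: "\<And>t. 0 < t \<Longrightarrow> (f has_real_derivative f' t) (at t)"
  shows "k = 0"
proof -
  have shift: "filterlim (\<lambda>t::real. t + 1) at_top at_top"
    using filterlim_tendsto_add_at_top[OF tendsto_const[of "1::real"] filterlim_ident] by (simp add: add.commute)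
  have "((\<lambda>t. f (t + 1) - f t) \<longlongrightarrow> l - l) at_top"
    by (intro tendsto_diff f filterlim_compose[OF f shift])
  moreover have "((\<lambda>t. f (t + 1) - f t) \<longlongrightarrow> k) at_top"
  proof (rule tendstoI)
    fix e :: real assume "0 < e"
    then obtain T where T: "\<And>t. T \<le> t \<Longrightarrow> dist (f' t) k < e"
      using tendstoD[OF f'] by (auto simp: eventually_at_top_linorder)
    show "\<forall>\<^sub>F t in at_top. dist (f (t + 1) - f t) k < e"
      using eventually_ge_at_top[of "max 1 T"]
    proof eventually_elim
      case (elim t)
      have "\<exists>z>t. z < t + 1 \<and> f (t + 1) - f t = (t + 1 - t) * f' z"
        by (rule MVT2) (use elim der in auto)
      then obtain z where "t < z" "f (t + 1) - f t = f' z" by auto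
      then show ?case using T[of z] elim by simp
    qed
  qed
  ultimately show ?thesis using tendsto_unique by force
qed

lemma derivative_zero_imp_constant:
  fixes h :: "real \<Rightarrow> real"
  assumes der: "\<And>t. 0 < t \<Longrightarrow> (h has_real_derivative 0) (at t)"
  shows "\<exists>k. \<forall>t>0. h t = k"
proof (intro exI[of _ "h 1"] allI impI)
  fix t :: real assume t: "0 < t"
  have c: "continuous_on {a..b} h" if "0 < a" for a b
    by (intro continuous_at_imp_continuous_on ballI DERIV_isCont[OF der]) (use that in auto)
  show "h t = h 1"
  proof (cases t "1::real" rule: linorder_cases)
    case less
    then show ?thesis using DERIV_isconst_end[OF less c[OF t]] der t by simp
  next
    case greater
    then show ?thesis using DERIV_isconst_end[OF greater c[OF zero_less_one]] der by simp
  qed simp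
qed

text \<open>The continuity equation makes U - (u_- / v_-) V constant, and the boundary values make
  it 0. Passing to the limit, the sign of u_+ is that of u_-, which is the obstruction for u_+ \<le>
  0.\<close>

lemma bl_velocity:
  assumes bl: "bl_solution R \<gamma> \<mu> \<kappa> (vm, um, \<theta>m) (vp, up, \<theta>p) V U \<Theta>" and vm: "0 < vm"
  shows "\<And>\<xi>. 0 \<le> \<xi> \<Longrightarrow> U \<xi> = um / vm * V \<xi>" "up = um / vm * vp"
proof -
  define g where "g \<xi> = U \<xi> - um / vm * V \<xi>" for \<xi>
  have cont: "continuous_on {0..} g" unfolding g_def
    using bl unfolding bl_solution_def Let_def by (intro continuous_intros) auto
  have der: "(g has_real_derivative 0) (at \<xi>)" if \<xi>: "0 < \<xi>" for \<xi>
  proof -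
    have dV: "(V has_real_derivative deriv V \<xi>) (at \<xi>)" and dU: "(U has_real_derivative deriv U \<xi>) (at \<xi>)"
      and "- (- um / vm) * deriv V \<xi> - deriv U \<xi> = 0"
      using bl \<xi> unfolding bl_solution_def Let_def by (auto simp: DERIV_deriv_iff_real_differentiable)
    then have "deriv U \<xi> - um / vm * deriv V \<xi> = 0" by simp
    then show ?thesis using DERIV_diff[OF dU DERIV_cmult[OF dV, of "um / vm"]] unfolding g_def by (simp only:)
  qed
  have g0: "g 0 = 0" using bl vm unfolding bl_solution_def Let_def g_def by auto
  show eq: "U \<xi> = um / vm * V \<xi>" if "0 \<le> \<xi>" for \<xi>
  proof (cases "\<xi> = 0")
    case False
    then have "0 < \<xi>" using that by simp
    then have "g \<xi> = g 0"
      by (rule DERIV_isconst_end) (use cont der in \<open>auto intro: continuous_on_subset\<close>)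
    then show ?thesis using g0 by (simp add: g_def)
  qed (use g0 in \<open>simp add: g_def\<close>)
  have "(U \<longlongrightarrow> up) at_top" "(V \<longlongrightarrow> vp) at_top" using bl unfolding bl_solution_def Let_def by auto
  moreover from this(2) have "((\<lambda>\<xi>. um / vm * V \<xi>) \<longlongrightarrow> um / vm * vp) at_top" by (intro tendsto_intros)
  then have "(U \<longlongrightarrow> um / vm * vp) at_top"
    by (rule Lim_transform_eventually) (auto simp: eventually_at_top_linorder eq intro!: exI[of _ 0])
  ultimately show "up = um / vm * vp" using tendsto_unique by force
qed

lemma pt_eq: "pt x y = x *\<^sub>R pt 1 0 + y *\<^sub>R pt 0 1"
  by (simp add: vec_eq_iff forall_2)

lemma pt_nth: "pt x y $ 1 = x" "pt x y $ 2 = y"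
  by simp_all

lemma bl_imp_red_solution:
  assumes bl: "bl_solution R \<gamma> \<mu> \<kappa> (vm, um, \<theta>m) (vp, up, \<theta>p) V U \<Theta>"
    and pos: "0 < R" "1 < \<gamma>" "0 < \<mu>" "0 < \<kappa>" "0 < vm" "0 < um" "0 < vp" "0 < up"
  shows "red_solution R \<gamma> \<mu> \<kappa> (um, \<theta>m) (up, \<theta>p) (\<lambda>\<xi>. pt (U \<xi>) (\<Theta> \<xi>))"
proof -
  define s where "s = um / vm"
  have s: "0 < s" "up = s * vp" using pos bl_velocity(2)[OF bl pos(5)] by (auto simp: s_def)
  have UV: "U \<xi> = s * V \<xi>" if "0 \<le> \<xi>" for \<xi> using bl_velocity(1)[OF bl pos(5) that] by (simp add: s_def)
  define P where "P \<xi> = R * \<Theta> \<xi> / V \<xi>" for \<xi>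
  define u' where "u' = deriv U"
  define \<theta>' where "\<theta>' = deriv \<Theta>"
  have Vpos: "0 < V \<xi>" if "0 \<le> \<xi>" for \<xi> using bl that unfolding bl_solution_def Let_def by auto
  have diff: "V differentiable (at \<xi>)" "U differentiable (at \<xi>)" "\<Theta> differentiable (at \<xi>)"
    "u' differentiable (at \<xi>)" "\<theta>' differentiable (at \<xi>)" if "0 < \<xi>" for \<xi>
    using bl that unfolding bl_solution_def Let_def u'_def \<theta>'_def by auto
  have dU: "(U has_real_derivative u' \<xi>) (at \<xi>)" and d\<Theta>: "(\<Theta> has_real_derivative \<theta>' \<xi>) (at \<xi>)" if "0 < \<xi>" for \<xi>
    using diff[OF that] by (auto simp: u'_def \<theta>'_def DERIV_deriv_iff_real_differentiable)
  have Pd: "P differentiable (at \<xi>)" if "0 < \<xi>" for \<xi>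
    unfolding P_def[abs_def] using Vpos[of \<xi>] that by (intro differentiable_divide differentiable_mult diff) auto
  have momentum: "s * u' \<xi> + deriv P \<xi> = \<mu> * deriv (\<lambda>t. u' t / V t) \<xi>" if "0 < \<xi>" for \<xi>
    using bl that unfolding bl_solution_def Let_def u'_def P_def[abs_def] s_def by auto
  have energy: "s * deriv (\<lambda>t. R / (\<gamma> - 1) * \<Theta> t + (U t)\<^sup>2 / 2) \<xi> + deriv (\<lambda>t. P t * U t) \<xi>
      = \<kappa> * deriv (\<lambda>t. \<theta>' t / V t) \<xi> + \<mu> * deriv (\<lambda>t. U t * u' t / V t) \<xi>" if "0 < \<xi>" for \<xi>
    using bl that unfolding bl_solution_def Let_def u'_def \<theta>'_def P_def[abs_def] s_def by auto
  have lim: "(U \<longlongrightarrow> up) at_top" "(\<Theta> \<longlongrightarrow> \<theta>p) at_top" "(V \<longlongrightarrow> vp) at_top"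
    using bl unfolding bl_solution_def Let_def by auto
  have Plim: "(P \<longlongrightarrow> R * \<theta>p / vp) at_top"
    unfolding P_def[abs_def] using pos by (intro tendsto_intros lim) auto
  have "((\<lambda>t. s * U t + P t - \<mu> * (u' t / V t)) has_real_derivative 0) (at \<xi>)" if \<xi>: "0 < \<xi>" for \<xi>
  proof -
    have "(\<lambda>t. u' t / V t) differentiable (at \<xi>)"
      using Vpos[of \<xi>] \<xi> by (intro differentiable_divide diff) auto
    then have "((\<lambda>t. s * U t + P t - \<mu> * (u' t / V t)) has_real_derivative s * u' \<xi> + deriv P \<xi> - \<mu> * deriv (\<lambda>t. u' t / V t) \<xi>) (at \<xi>)"
      using Pd[OF \<xi>] by (intro DERIV_diff DERIV_add DERIV_cmult dU \<xi>) (auto simp: DERIV_deriv_iff_real_differentiable)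
    then show ?thesis using momentum[OF \<xi>] by simp
  qed
  then obtain c1 where c1: "\<And>t. 0 < t \<Longrightarrow> s * U t + P t - \<mu> * (u' t / V t) = c1"
    using derivative_zero_imp_constant[of "\<lambda>t. s * U t + P t - \<mu> * (u' t / V t)"] by blast
  have uV: "u' t / V t = (s * U t + P t - c1) / \<mu>" if "0 < t" for t
    using c1[OF that] pos by (simp add: field_simps)
  have u'_eq: "u' t = V t / \<mu> * (s * U t + P t - c1)" if "0 < t" for t
    using uV[OF that] Vpos[of t] that pos by (simp add: field_simps)
  \<comment> \<open>The expression for u' converges, so its limit has to be 0; this determines c1
    from the state at infinity. The constant c2 is found in the same way below.\<close>
  have "((\<lambda>t. V t / \<mu> * (s * U t + P t - c1)) \<longlongrightarrow> vp / \<mu> * (s * up + R * \<theta>p / vp - c1)) at_top"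
    using pos by (intro tendsto_intros lim Plim) auto
  then have "vp / \<mu> * (s * up + R * \<theta>p / vp - c1) = 0"
    by (rule tendsto_derivative_zero[OF lim(1)]) (use dU u'_eq in metis)
  then have c1_eq: "c1 = s * up + R * \<theta>p / vp" using pos by simp
  have "((\<lambda>t. s * (R / (\<gamma> - 1) * \<Theta> t + (U t)\<^sup>2 / 2) + P t * U t - \<kappa> * (\<theta>' t / V t) - \<mu> * (U t * u' t / V t))
      has_real_derivative 0) (at \<xi>)" if \<xi>: "0 < \<xi>" for \<xi>
  proof -
    have sq: "(\<lambda>t. (U t)\<^sup>2 / 2) differentiable (at \<xi>)"
      using DERIV_cdivide[OF DERIV_power[OF dU[OF \<xi>], of 2], of 2] real_differentiable_def by blast
    have d: "(\<lambda>t. R / (\<gamma> - 1) * \<Theta> t + (U t)\<^sup>2 / 2) differentiable (at \<xi>)" "(\<lambda>t. P t * U t) differentiable (at \<xi>)"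
      "(\<lambda>t. \<theta>' t / V t) differentiable (at \<xi>)" "(\<lambda>t. U t * u' t / V t) differentiable (at \<xi>)"
      using Vpos[of \<xi>] \<xi> Pd[OF \<xi>] sq pos(2)
      by (auto intro!: differentiable_divide differentiable_mult differentiable_add diff differentiable_const)
    have "((\<lambda>t. s * (R / (\<gamma> - 1) * \<Theta> t + (U t)\<^sup>2 / 2) + P t * U t - \<kappa> * (\<theta>' t / V t) - \<mu> * (U t * u' t / V t))
      has_real_derivative s * deriv (\<lambda>t. R / (\<gamma> - 1) * \<Theta> t + (U t)\<^sup>2 / 2) \<xi> + deriv (\<lambda>t. P t * U t) \<xi>
       - \<kappa> * deriv (\<lambda>t. \<theta>' t / V t) \<xi> - \<mu> * deriv (\<lambda>t. U t * u' t / V t) \<xi>) (at \<xi>)"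
      by (intro DERIV_diff DERIV_add DERIV_cmult) (use d in \<open>simp_all add: DERIV_deriv_iff_real_differentiable\<close>)
    then show ?thesis using energy[OF \<xi>] by simp
  qed
  then obtain c2 where c2: "\<And>t. 0 < t \<Longrightarrow>
      s * (R / (\<gamma> - 1) * \<Theta> t + (U t)\<^sup>2 / 2) + P t * U t - \<kappa> * (\<theta>' t / V t) - \<mu> * (U t * u' t / V t) = c2"
    using derivative_zero_imp_constant[of "\<lambda>t. s * (R / (\<gamma> - 1) * \<Theta> t + (U t)\<^sup>2 / 2) + P t * U t - \<kappa> * (\<theta>' t / V t) - \<mu> * (U t * u' t / V t)"]
    by blast
  define g where "g = R / (\<gamma> - 1)"
  have \<theta>'_eq: "\<theta>' t = V t / \<kappa> * (s * g * \<Theta> t - s * (U t)\<^sup>2 / 2 + c1 * U t - c2)" if t: "0 < t" for t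
  proof -
    \<comment> \<open>U times the integrated momentum equation replaces the viscous work in the
      energy balance, whereupon the pressure work P U cancels as well.\<close>
    have "\<mu> * (U t * u' t / V t) = U t * (\<mu> * (u' t / V t))" by simp
    also have "\<mu> * (u' t / V t) = s * U t + P t - c1" using c1[OF t] by simp
    finally have "\<mu> * (U t * u' t / V t) = s * (U t)\<^sup>2 + P t * U t - c1 * U t" by (simp add: algebra_simps power2_eq_square)
    then have "\<kappa> * (\<theta>' t / V t) = s * g * \<Theta> t - s * (U t)\<^sup>2 / 2 + c1 * U t - c2"
      using c2[OF t] by (simp add: g_def[symmetric] distrib_left)
    then have "V t / \<kappa> * (\<kappa> * (\<theta>' t / V t)) = V t / \<kappa> * (s * g * \<Theta> t - s * (U t)\<^sup>2 / 2 + c1 * U t - c2)" by simp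
    then show ?thesis using Vpos[of t] t pos by simp
  qed
  have "((\<lambda>t. V t / \<kappa> * (s * g * \<Theta> t - s * (U t)\<^sup>2 / 2 + c1 * U t - c2)) \<longlongrightarrow>
      vp / \<kappa> * (s * g * \<theta>p - s * up\<^sup>2 / 2 + c1 * up - c2)) at_top"
    using pos by (intro tendsto_intros lim) auto
  then have "vp / \<kappa> * (s * g * \<theta>p - s * up\<^sup>2 / 2 + c1 * up - c2) = 0"
    by (rule tendsto_derivative_zero[OF lim(2)]) (use d\<Theta> \<theta>'_eq in metis)
  then have c2_eq: "c2 = s * g * \<theta>p - s * up\<^sup>2 / 2 + c1 * up" using pos by simp
  \<comment> \<open>Substituting V = U / s makes the flux s cancel throughout, so the left end state
    enters the planar system only as an initial value.\<close>
  have comp: "red_field R \<gamma> \<mu> \<kappa> up \<theta>p (pt (U t) (\<Theta> t)) = pt (u' t) (\<theta>' t)" if t: "0 < t" for t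
  proof -
    define x where "x = U t - up"
    define y where "y = \<Theta> t - \<theta>p"
    have Ux: "U t = up + x" "\<Theta> t = \<theta>p + y" by (auto simp: x_def y_def)
    have V: "V t = U t / s" "vp = up / s" using UV[of t] t s by simp_all
    have c1s: "c1 = s * (up + R * \<theta>p / up)" unfolding c1_eq V(2) using s(1) pos by (simp add: field_simps)
    have U0: "U t \<noteq> 0" using UV[of t] Vpos[of t] t s by simp
    have "u' t = U t / s / \<mu> * (s * U t + R * \<Theta> t / (U t / s) - s * (up + R * \<theta>p / up))"
      using u'_eq[OF t] by (simp add: P_def V(1) c1s)
    also have "s * U t + R * \<Theta> t / (U t / s) - s * (up + R * \<theta>p / up)
        = s * (U t + R * \<Theta> t / U t - (up + R * \<theta>p / up))" by (simp add: right_diff_distrib distrib_left)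
    also have "U t / s / \<mu> * (s * (U t + R * \<Theta> t / U t - (up + R * \<theta>p / up)))
        = U t / \<mu> * (U t + R * \<Theta> t / U t - (up + R * \<theta>p / up))" using s(1) by simp
    also have "\<dots> = (U t * (U t + R * \<Theta> t / U t - (up + R * \<theta>p / up))) / \<mu>" by simp
    also have "U t * (U t + R * \<Theta> t / U t - (up + R * \<theta>p / up)) = U t * (U t - up) + R * \<Theta> t - R * \<theta>p / up * U t"
      using U0 by (simp add: distrib_left right_diff_distrib)
    also have "(U t * (U t - up) + R * \<Theta> t - R * \<theta>p / up * U t) / \<mu>
        = (up\<^sup>2 - R * \<theta>p) / (\<mu> * up) * x + R / \<mu> * y + 1 / \<mu> * x\<^sup>2"
      unfolding Ux using pos by (simp add: field_simps power2_eq_square)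
    finally have 1: "u' t = (up\<^sup>2 - R * \<theta>p) / (\<mu> * up) * x + R / \<mu> * y + 1 / \<mu> * x\<^sup>2" .
    have "\<theta>' t = U t / s / \<kappa> * (s * g * \<Theta> t - s * (U t)\<^sup>2 / 2 + c1 * U t - (s * g * \<theta>p - s * up\<^sup>2 / 2 + c1 * up))"
      using \<theta>'_eq[OF t] by (simp add: V(1) c2_eq)
    also have "s * g * \<Theta> t - s * (U t)\<^sup>2 / 2 + c1 * U t - (s * g * \<theta>p - s * up\<^sup>2 / 2 + c1 * up)
        = s * (g * y - ((U t)\<^sup>2 - up\<^sup>2) / 2 + (up + R * \<theta>p / up) * x)"
    proof -
      define q where "q = up + R * \<theta>p / up"
      show ?thesis unfolding c1s q_def[symmetric] y_def x_def by (simp add: algebra_simps diff_divide_distrib)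
    qed
    also have "U t / s / \<kappa> * (s * (g * y - ((U t)\<^sup>2 - up\<^sup>2) / 2 + (up + R * \<theta>p / up) * x))
        = U t / \<kappa> * (g * y - ((U t)\<^sup>2 - up\<^sup>2) / 2 + (up + R * \<theta>p / up) * x)" using s(1) by simp
    also have "((U t)\<^sup>2 - up\<^sup>2) / 2 = up * x + x\<^sup>2 / 2" unfolding Ux by (simp add: power2_eq_square algebra_simps)
    also have "U t / \<kappa> * (g * y - (up * x + x\<^sup>2 / 2) + (up + R * \<theta>p / up) * x)
        = (up + x) / \<kappa> * (g * y - x\<^sup>2 / 2 + R * \<theta>p / up * x)" by (simp add: Ux algebra_simps)
    also have "\<dots> = R * \<theta>p / \<kappa> * x + g * up / \<kappa> * y
       + ((R * \<theta>p / (\<kappa> * up) - up / (2 * \<kappa>)) * x\<^sup>2 + g / \<kappa> * x * y + - (1 / (2 * \<kappa>)) * x^3)"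
      using pos by (simp add: field_simps power2_eq_square power3_eq_cube)
    finally have 2: "\<theta>' t = R * \<theta>p / \<kappa> * x + R * up / (\<kappa> * (\<gamma> - 1)) * y
       + ((R * \<theta>p / (\<kappa> * up) - up / (2 * \<kappa>)) * x\<^sup>2 + R / (\<kappa> * (\<gamma> - 1)) * x * y + - (1 / (2 * \<kappa>)) * x^3)"
      by (simp add: g_def mult.commute)
    show ?thesis unfolding vec_eq_iff forall_2 red_field_nth pt_nth x_def[symmetric] y_def[symmetric]
      using 1[symmetric] 2[symmetric] by (rule conjI)
  qed
  show ?thesis
    unfolding connects_def fst_conv snd_conv
  proof (intro conjI allI impI)
    show "continuous_on {0..} (\<lambda>\<xi>. pt (U \<xi>) (\<Theta> \<xi>))"
      unfolding pt_eq[of "U _"] using bl unfolding bl_solution_def Let_def by (intro continuous_intros) auto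
    show "pt (U 0) (\<Theta> 0) = pt um \<theta>m" using bl unfolding bl_solution_def Let_def by auto
    show "((\<lambda>\<xi>. pt (U \<xi>) (\<Theta> \<xi>)) \<longlongrightarrow> pt up \<theta>p) at_top"
      unfolding pt_eq[of "U _"] pt_eq[of up] by (intro tendsto_intros lim)
    fix \<xi> :: real assume \<xi>: "0 < \<xi>"
    have "((\<lambda>\<xi>. U \<xi> *\<^sub>R pt 1 0 + \<Theta> \<xi> *\<^sub>R pt 0 1) has_vector_derivative u' \<xi> *\<^sub>R pt 1 0 + \<theta>' \<xi> *\<^sub>R pt 0 1) (at \<xi>)"
      using dU[OF \<xi>] d\<Theta>[OF \<xi>]
      by (intro has_vector_derivative_add
          has_vector_derivative_scaleR[where g="\<lambda>_. pt 1 0" and g'=0, simplified]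
          has_vector_derivative_scaleR[where g="\<lambda>_. pt 0 1" and g'=0, simplified])
        (auto simp: has_real_derivative_iff_has_vector_derivative)
    then show "((\<lambda>\<xi>. pt (U \<xi>) (\<Theta> \<xi>)) has_vector_derivative red_field R \<gamma> \<mu> \<kappa> up \<theta>p (pt (U \<xi>) (\<Theta> \<xi>))) (at \<xi>)"
      unfolding comp[OF \<xi>] pt_eq[symmetric] .
  qed
qed

theorem lemma2p1:
  fixes R \<gamma> \<mu> \<kappa> vp up \<theta>p :: real
  assumes "R > 0" "\<gamma> > 1" "\<mu> > 0" "\<kappa> > 0" "vp > 0" "\<theta>p > 0"
  shows
   "(up \<le> 0 \<longrightarrow>
      (\<forall>vm um \<theta>m. vm > 0 \<and> um > 0 \<and> \<theta>m > 0 \<longrightarrow>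
         \<not> (\<exists>V U \<Theta>. bl_solution R \<gamma> \<mu> \<kappa> (vm, um, \<theta>m) (vp, up, \<theta>p) V U \<Theta>))) \<and>
    (up > 0 \<longrightarrow>
      (\<exists>\<delta> \<epsilon>. 0 < \<delta> \<and> \<delta> < \<epsilon> \<and>
        (mach R \<gamma> up \<theta>p > 1 \<longrightarrow>
          (\<forall>vm um \<theta>m. vm > 0 \<and> um > 0 \<and> \<theta>m > 0 \<and>
             0 < norm (pt (up - um) (\<theta>p - \<theta>m)) \<and> norm (pt (up - um) (\<theta>p - \<theta>m)) \<le> \<delta> \<longrightarrow>
             \<not> (\<exists>V U \<Theta>. bl_solution R \<gamma> \<mu> \<kappa> (vm, um, \<theta>m) (vp, up, \<theta>p) V U \<Theta>) \<and>
             \<not> (\<exists>W. red_solution R \<gamma> \<mu> \<kappa> (um, \<theta>m) (up, \<theta>p) W))) \<and>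
        (mach R \<gamma> up \<theta>p = 1 \<longrightarrow>
          saddle_knot (red_field R \<gamma> \<mu> \<kappa> up \<theta>p) (pt up \<theta>p) \<and>
          (\<exists>\<Gamma> C.
             (\<forall>\<Gamma>'. converging_trajectory (red_field R \<gamma> \<mu> \<kappa> up \<theta>p) (ball (pt up \<theta>p) \<epsilon>) (pt up \<theta>p) \<Gamma>' \<and>
                   tangent_at \<Gamma>' (pt up \<theta>p)
                     {w. (\<gamma> - 1) * up * (w$1 - up) + R * \<gamma> * (w$2 - \<theta>p) = 0}
                   \<longleftrightarrow> \<Gamma>' = \<Gamma>) \<and>
             (\<forall>n. C n > 0) \<and>
             (\<forall>um \<theta>m. um > 0 \<and> \<theta>m > 0 \<and> pt um \<theta>m \<in> \<Gamma> \<and>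
                0 < norm (pt (up - um) (\<theta>p - \<theta>m)) \<and> norm (pt (up - um) (\<theta>p - \<theta>m)) \<le> \<delta> \<longrightarrow>
                (\<exists>W. red_solution R \<gamma> \<mu> \<kappa> (um, \<theta>m) (up, \<theta>p) W \<and>
                   derivs_bounded_by W (pt up \<theta>p)
                     (\<lambda>n \<xi>. C n * norm (pt (up - um) (\<theta>p - \<theta>m)) ^ n /
                            (1 + norm (pt (up - um) (\<theta>p - \<theta>m)) * \<xi>) ^ n) \<and>
                   (\<forall>W'. red_solution R \<gamma> \<mu> \<kappa> (um, \<theta>m) (up, \<theta>p) W' \<longrightarrow>
                      (\<forall>\<xi>\<ge>0. W' \<xi> = W \<xi>)))))) \<and>
        (mach R \<gamma> up \<theta>p < 1 \<longrightarrow>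
          saddle_point (red_field R \<gamma> \<mu> \<kappa> up \<theta>p) (pt up \<theta>p) \<and>
          (\<exists>l1 l2 c2 a2 M C c.
             eigenvalues (red_J R \<gamma> \<mu> \<kappa> up \<theta>p) = {l1, l2} \<and> l1 > 0 \<and> l2 < 0 \<and>
             {y. y > 0 \<and>
                 y\<^sup>2 + (((mach R \<gamma> up \<theta>p)\<^sup>2 * \<gamma> - 1) / ((mach R \<gamma> up \<theta>p)\<^sup>2 * R * \<gamma>)
                        - \<mu> / (\<kappa> * (\<gamma> - 1))) * y
                    - \<mu> / ((mach R \<gamma> up \<theta>p)\<^sup>2 * R * \<gamma> * \<kappa>) = 0} = {c2} \<and>
             a2 = - R / (\<mu> * (l1 - l2)) \<and>
             center_stable_manifold (red_field R \<gamma> \<mu> \<kappa> up \<theta>p) (ball (pt up \<theta>p) \<epsilon>) (pt up \<theta>p) M \<and>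
             arc_tangent_both_ways M (pt up \<theta>p)
               {w. (1 + a2 * c2 * up) * (w$1 - up) - a2 * (w$2 - \<theta>p) = 0} \<and>
             (\<forall>n. C n > 0) \<and> c > 0 \<and>
             (\<forall>um \<theta>m. um > 0 \<and> \<theta>m > 0 \<and>
                0 < norm (pt (up - um) (\<theta>p - \<theta>m)) \<and> norm (pt (up - um) (\<theta>p - \<theta>m)) \<le> \<delta> \<longrightarrow>
                (pt um \<theta>m \<in> M \<longrightarrow>
                  (\<exists>W. red_solution R \<gamma> \<mu> \<kappa> (um, \<theta>m) (up, \<theta>p) W \<and> W ` {0..} \<subseteq> M \<and>
                     derivs_bounded_by W (pt up \<theta>p)
                       (\<lambda>n \<xi>. C n * norm (pt (up - um) (\<theta>p - \<theta>m)) * exp (- c * \<xi>)) \<and>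
                     (\<forall>W'. red_solution R \<gamma> \<mu> \<kappa> (um, \<theta>m) (up, \<theta>p) W' \<longrightarrow>
                        (\<forall>\<xi>\<ge>0. W' \<xi> = W \<xi>)))) \<and>
                (pt um \<theta>m \<notin> M \<longrightarrow>
                  \<not> (\<exists>W. red_solution R \<gamma> \<mu> \<kappa> (um, \<theta>m) (up, \<theta>p) W \<and>
                        (W ` {0..} \<subseteq> ball (pt up \<theta>p) \<epsilon> \<or>
                         derivs_bounded_by W (pt up \<theta>p)
                           (\<lambda>n \<xi>. C n * norm (pt (up - um) (\<theta>p - \<theta>m)) * exp (- c * \<xi>))))))))))"
proof -
  \<comment> \<open>The patterns name the existential statement for up > 0 and its subsonic part;
    \<delta> and \<epsilon> are chosen separately in each Mach regime.\<close>
  let "_ \<and> (_ \<longrightarrow> ?ex)" = ?thesis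
  let "\<exists>\<delta> \<epsilon>. _ \<and> _ \<and> _ \<and> _ \<and> (_ \<longrightarrow> _ \<and> ?sub \<delta> \<epsilon>)" = ?ex
  define p where "p = pt up \<theta>p"
  define a where "a = (up\<^sup>2 - R * \<theta>p) / (\<mu> * up)"
  define b where "b = R / \<mu>"
  define c where "c = R * \<theta>p / \<kappa>"
  define d where "d = R * up / (\<kappa> * (\<gamma> - 1))"
  define q1 where "q1 = 1 / \<mu>"
  define q2 where "q2 = R * \<theta>p / (\<kappa> * up) - up / (2 * \<kappa>)"
  define q3 where "q3 = R / (\<kappa> * (\<gamma> - 1))"
  define q4 where "q4 = - (1 / (2 * \<kappa>))"
  define f where "f = red_field R \<gamma> \<mu> \<kappa> up \<theta>p"
  note q_defs = a_def b_def c_def d_def q1_def q2_def q3_def q4_def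
  have dist_eq: "norm (pt (up - um) (\<theta>p - \<theta>m)) = norm (p - pt um \<theta>m)" for um \<theta>m
  proof -
    have "pt (up - um) (\<theta>p - \<theta>m) = p - pt um \<theta>m" by (simp add: p_def vec_eq_iff forall_2)
    then show ?thesis by simp
  qed
  have pnth: "p $ 1 = up" "p $ 2 = \<theta>p" by (simp_all add: p_def)
  have f1: "f w $ 1 = a * (w$1 - p$1) + b * (w$2 - p$2) + q1 * (w$1 - p$1)\<^sup>2" for w
    unfolding f_def red_field_nth pnth q_defs ..
  have f2: "f w $ 2 = c * (w$1 - p$1) + d * (w$2 - p$2)
       + (q2 * (w$1 - p$1)\<^sup>2 + q3 * (w$1 - p$1) * (w$2 - p$2) + q4 * (w$1 - p$1)^3)" for w
    unfolding f_def red_field_nth pnth q_defs ..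
  have poly: "polynomial_function f" unfolding f_def by (rule polynomial_function_red_field)
  have g: "0 < \<gamma> - 1" using assms(2) by simp
  have bc: "0 < b" "0 < c" using assms by (simp_all add: b_def c_def)
  have sound: "0 < R * \<gamma> * \<theta>p" using assms by (intro mult_pos_pos) auto
  show ?thesis
  proof (intro conjI impI)
    assume "up \<le> 0"
    then show "\<forall>vm um \<theta>m. vm > 0 \<and> um > 0 \<and> \<theta>m > 0 \<longrightarrow>
         \<not> (\<exists>V U \<Theta>. bl_solution R \<gamma> \<mu> \<kappa> (vm, um, \<theta>m) (vp, up, \<theta>p) V U \<Theta>)"
    proof (intro allI impI notI, elim exE conjE)
      fix vm um \<theta>m V U \<Theta>
      assume *: "0 < vm" "0 < um" "bl_solution R \<gamma> \<mu> \<kappa> (vm, um, \<theta>m) (vp, up, \<theta>p) V U \<Theta>"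
      have "0 < um / vm * vp" using * assms(5) by simp
      then show False using bl_velocity(2)[OF *(3,1)] \<open>up \<le> 0\<close> by simp
    qed
  next
    assume up: "up > 0"
    have mach: "mach R \<gamma> up \<theta>p > 1 \<longleftrightarrow> R * \<gamma> * \<theta>p < up\<^sup>2" "mach R \<gamma> up \<theta>p = 1 \<longleftrightarrow> R * \<gamma> * \<theta>p = up\<^sup>2"
      "mach R \<gamma> up \<theta>p < 1 \<longleftrightarrow> up\<^sup>2 < R * \<gamma> * \<theta>p" "(mach R \<gamma> up \<theta>p)\<^sup>2 = up\<^sup>2 / (R * \<gamma> * \<theta>p)"
    proof -
      have m0: "0 \<le> mach R \<gamma> up \<theta>p" using sound by (simp add: mach_def)
      show sq: "(mach R \<gamma> up \<theta>p)\<^sup>2 = up\<^sup>2 / (R * \<gamma> * \<theta>p)"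
        using sound by (simp add: mach_def power_divide)
      have "mach R \<gamma> up \<theta>p > 1 \<longleftrightarrow> (mach R \<gamma> up \<theta>p)\<^sup>2 > 1" "mach R \<gamma> up \<theta>p = 1 \<longleftrightarrow> (mach R \<gamma> up \<theta>p)\<^sup>2 = 1"
        "mach R \<gamma> up \<theta>p < 1 \<longleftrightarrow> (mach R \<gamma> up \<theta>p)\<^sup>2 < 1"
        using m0 by (auto simp: power2_eq_1_iff abs_square_less_1 one_less_power) (smt (verit) power2_eq_1_iff one_power2 power2_less_imp_less)+
      then show "mach R \<gamma> up \<theta>p > 1 \<longleftrightarrow> R * \<gamma> * \<theta>p < up\<^sup>2" "mach R \<gamma> up \<theta>p = 1 \<longleftrightarrow> R * \<gamma> * \<theta>p = up\<^sup>2"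
        "mach R \<gamma> up \<theta>p < 1 \<longleftrightarrow> up\<^sup>2 < R * \<gamma> * \<theta>p"
        unfolding sq using sound by (auto simp: less_divide_eq divide_less_eq)
    qed
    have d: "0 < d" using assms g up by (simp add: d_def)
    \<comment> \<open>The determinant of J has the sign of up^2 - R \<gamma> \<theta>p, that is of
      the Mach number minus one. This is where the three cases come from.\<close>
    have detJ: "a * d - b * c = R / (\<mu> * \<kappa> * (\<gamma> - 1)) * (up\<^sup>2 - R * \<gamma> * \<theta>p)"
    proof -
      have "a * d = R / (\<mu> * \<kappa> * (\<gamma> - 1)) * (up\<^sup>2 - R * \<theta>p)" using up by (simp add: a_def d_def mult_ac)
      moreover have "b * c = R / (\<mu> * \<kappa> * (\<gamma> - 1)) * ((\<gamma> - 1) * (R * \<theta>p))" using g by (simp add: b_def c_def)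
      ultimately have "a * d - b * c = R / (\<mu> * \<kappa> * (\<gamma> - 1)) * ((up\<^sup>2 - R * \<theta>p) - (\<gamma> - 1) * (R * \<theta>p))"
        by (simp only: right_diff_distrib)
      then show ?thesis by (simp add: algebra_simps)
    qed
    have coef: "0 < R / (\<mu> * \<kappa> * (\<gamma> - 1))" using assms g by simp
    have sad: "saddle_field a b c d" if "up\<^sup>2 \<le> R * \<gamma> * \<theta>p"
    proof
      have "a * d - b * c \<le> 0" unfolding detJ using coef that by (intro mult_nonneg_nonpos) auto
      then show "a * d \<le> b * c" by simp
    qed (use bc d in auto)
    have fld_f: "saddle_field.fld a b c d q1 q2 q3 q4 p = f" if "up\<^sup>2 \<le> R * \<gamma> * \<theta>p"
      by (rule ext) (simp add: saddle_field.fld_def[OF sad[OF that]] vec_eq_iff forall_2 f1 f2)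
    consider (super) "mach R \<gamma> up \<theta>p > 1" | (trans) "mach R \<gamma> up \<theta>p = 1" | (sub) "mach R \<gamma> up \<theta>p < 1"
      by linarith
    then show ?ex
    proof cases
      case super
      then have "R * \<gamma> * \<theta>p < up\<^sup>2" using mach by simp
      then have "0 < a * d - b * c" unfolding detJ by (intro mult_pos_pos coef) simp
      then have det0: "b * c < a * d" by simp
      have "R * \<theta>p < R * \<gamma> * \<theta>p" using assms by simp
      then have "0 < up\<^sup>2 - R * \<theta>p" using \<open>R * \<gamma> * \<theta>p < up\<^sup>2\<close> by linarith
      then have a: "0 < a" using up assms by (simp add: a_def divide_pos_pos)
      have no: "\<not> (\<exists>W. red_solution R \<gamma> \<mu> \<kappa> (um, \<theta>m) (up, \<theta>p) W)"
        if "0 < norm (pt (up - um) (\<theta>p - \<theta>m))" for um \<theta>m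
        using repelling_no_connection[OF a bc d det0 f1 f2 poly, of "pt um \<theta>m"] that
        unfolding dist_eq by (auto simp: f_def p_def)
      have nobl: "\<not> (\<exists>V U \<Theta>. bl_solution R \<gamma> \<mu> \<kappa> (vm, um, \<theta>m) (vp, up, \<theta>p) V U \<Theta>)"
        if "0 < norm (pt (up - um) (\<theta>p - \<theta>m))" "0 < vm" "0 < um" for vm um \<theta>m
        using no[OF that(1)] bl_imp_red_solution assms up that by blast
      \<comment> \<open>Nonexistence holds at every positive distance between the end states, so any
        pair 0 < \<delta> < \<epsilon> serves.\<close>
      show ?thesis
        by (rule exI[of _ 1], rule exI[of _ 2]) (use super no nobl in auto)
    next
      case trans
      then have eq: "up\<^sup>2 = R * \<gamma> * \<theta>p" using mach by simp
      interpret saddle_field a b c d q1 q2 q3 q4 p by (rule sad) (simp add: eq)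
      have fld: "fld = f" using fld_f eq by simp
      have adbc: "a * d = b * c" using detJ eq by simp
      have l2: "l2 = 0" using eigen(3) eigen_sign(1) adbc by simp
      then have l1: "l1 - a = d" "l2 - a = - a" using eigen(1) by auto
      \<comment> \<open>The only part of beta whose sign is not evident. At Mach number one the two
        terms nearly cancel and leave this positive remainder, which makes beta positive.\<close>
      have q2b: "q3 * a - q2 * b = R * up / (2 * \<kappa> * \<mu>)"
      proof -
        have "up\<^sup>2 - R * \<theta>p = (\<gamma> - 1) * (R * \<theta>p)" using eq by (simp add: algebra_simps)
        then have "q3 * a = R * (R * \<theta>p) / (\<kappa> * \<mu> * up)" using g by (simp add: q3_def a_def)
        moreover have "q2 * b = R * (R * \<theta>p) / (\<kappa> * \<mu> * up) - R * up / (2 * \<kappa> * \<mu>)"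
          unfolding q2_def b_def left_diff_distrib by (simp add: mult_ac)
        ultimately show ?thesis by simp
      qed
      have "beta = (b\<^sup>2 * (d * q1) + b\<^sup>2 * (q3 * a - q2 * b)) / (b * disc)"
        unfolding beta_def l1 by (simp add: algebra_simps power2_eq_square)
      moreover have "0 < b\<^sup>2 * (d * q1) + b\<^sup>2 * (q3 * a - q2 * b)"
        unfolding q2b using bc d assms up by (intro add_pos_pos mult_pos_pos) (auto simp: q1_def)
      ultimately have beta: "0 < beta" using bc disc(2) by simp
      have line: "{w. (\<gamma> - 1) * up * (w$1 - up) + R * \<gamma> * (w$2 - \<theta>p) = 0} = {w. du (w - p) = 0}"
      proof -
        \<comment> \<open>For l2 = 0 the form \<open>du\<close> is a multiple of a x + b y, and the
          factor \<gamma> \<mu> clears its denominators at Mach number one.\<close>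
        have "(\<gamma> - 1) * up * x + R * \<gamma> * y = (\<gamma> * \<mu>) * (a * x + b * y)" for x y
        proof -
          have "up\<^sup>2 - R * \<theta>p = (\<gamma> - 1) * (R * \<theta>p)" using eq by (simp add: algebra_simps)
          then have "\<gamma> * \<mu> * a = (\<gamma> - 1) * (up\<^sup>2 / up)" unfolding eq a_def using assms by simp
          then have "\<gamma> * \<mu> * a = (\<gamma> - 1) * up" using up by (simp add: power2_eq_square)
          moreover have "\<gamma> * \<mu> * b = R * \<gamma>" using assms by (simp add: b_def)
          ultimately show ?thesis by (simp only: distrib_left mult.assoc[symmetric])
        qed
        moreover have "du (w - p) = (a * (w$1 - up) + b * (w$2 - \<theta>p)) / (b * disc)" for w
          by (simp add: du_def l2 pnth)
        ultimately show ?thesis using bc disc(2) assms by auto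
      qed
      obtain \<delta> \<epsilon> \<Gamma> C where CM: "0 < \<delta>" "\<delta> < \<epsilon>"
        "\<forall>\<Gamma>'. converging_trajectory f (ball p \<epsilon>) p \<Gamma>' \<and> tangent_at \<Gamma>' p {w. du (w - p) = 0} \<longleftrightarrow> \<Gamma>' = \<Gamma>"
        "\<forall>n::nat. C n > 0"
        "\<forall>w0\<in>\<Gamma>. \<exists>W. connects f w0 p W \<and>
           derivs_bounded_by W p (\<lambda>n \<xi>. C n * norm (p - w0) ^ n / (1 + norm (p - w0) * \<xi>) ^ n) \<and>
           (\<forall>W'. connects f w0 p W' \<longrightarrow> (\<forall>\<xi>\<ge>0. W' \<xi> = W \<xi>))"
        using center_manifold[OF adbc beta] unfolding fld by (elim exE conjE) (rule that; assumption)
      have knot: "saddle_knot f p" using saddle_knot_fld[OF adbc beta] by (simp add: fld)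
      show ?thesis
        unfolding dist_eq fst_conv snd_conv line p_def[symmetric] f_def[symmetric]
        by (rule exI[of _ \<delta>], rule exI[of _ \<epsilon>])
          (use trans CM(1,2) knot CM(3-5) in \<open>auto intro!: exI[of _ \<Gamma>] exI[of _ C]\<close>)
    next
      case sub
      then have lt: "up\<^sup>2 < R * \<gamma> * \<theta>p" using mach by simp
      interpret saddle_field a b c d q1 q2 q3 q4 p by (rule sad) (use lt in simp)
      have fld: "fld = f" using fld_f lt by simp
      have "a * d - b * c < 0" unfolding detJ using coef lt by (intro mult_pos_neg) auto
      then have strict: "a * d < b * c" by simp
      have l2: "l2 < 0"
      proof -
        have "l1 * l2 < 0" using eigen(3) strict by simp
        then show ?thesis using eigen_sign(1) by (simp add: mult_less_0_iff)
      qed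
      have J: "red_J R \<gamma> \<mu> \<kappa> up \<theta>p = lin"
        unfolding red_J_def lin_def unfolding q_defs ..
      \<comment> \<open>The substitution y = k (l - a) turns the quadratic for c2 into the
        characteristic equation of J. Its roots are k (l1 - a) > 0 and k (l2 - a) < 0, so the
        positive one is unique.\<close>
      define k where "k = \<mu> / (R * up)"
      have k: "0 < k" using assms up by (simp add: k_def)
      define c2 where "c2 = k * (l1 - a)"
      have quad: "{y. y > 0 \<and>
                 y\<^sup>2 + (((mach R \<gamma> up \<theta>p)\<^sup>2 * \<gamma> - 1) / ((mach R \<gamma> up \<theta>p)\<^sup>2 * R * \<gamma>)
                        - \<mu> / (\<kappa> * (\<gamma> - 1))) * y
                    - \<mu> / ((mach R \<gamma> up \<theta>p)\<^sup>2 * R * \<gamma> * \<kappa>) = 0} = {c2}"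
      proof -
        have M: "(mach R \<gamma> up \<theta>p)\<^sup>2 * R * \<gamma> = up\<^sup>2 / \<theta>p" "(mach R \<gamma> up \<theta>p)\<^sup>2 * \<gamma> - 1 = up\<^sup>2 / (R * \<theta>p) - 1"
          unfolding mach(4) using assms by simp_all
        have c1: "((mach R \<gamma> up \<theta>p)\<^sup>2 * \<gamma> - 1) / ((mach R \<gamma> up \<theta>p)\<^sup>2 * R * \<gamma>) - \<mu> / (\<kappa> * (\<gamma> - 1)) = k * (a - d)"
        proof -
          have "((mach R \<gamma> up \<theta>p)\<^sup>2 * \<gamma> - 1) / ((mach R \<gamma> up \<theta>p)\<^sup>2 * R * \<gamma>) = k * a"
            unfolding M k_def a_def using assms up by (simp add: field_simps power2_eq_square)
          moreover have "\<mu> / (\<kappa> * (\<gamma> - 1)) = k * d" unfolding k_def d_def using assms up by simp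
          ultimately show ?thesis by (simp add: right_diff_distrib)
        qed
        have c0: "\<mu> / ((mach R \<gamma> up \<theta>p)\<^sup>2 * R * \<gamma> * \<kappa>) = k\<^sup>2 * (b * c)"
          unfolding M k_def b_def c_def using assms up by (simp add: field_simps power2_eq_square)
        have roots: "y\<^sup>2 + k * (a - d) * y - k\<^sup>2 * (b * c) = (y - c2) * (y - k * (l2 - a))" for y
        proof -
          have 1: "(l1 - a) + (l2 - a) = d - a" using eigen(1) by simp
          have "(l1 - a) * (l2 - a) = - (b * c)"
          proof -
            have "l2 - a = - (l1 - d)" using eigen(1) by simp
            then show ?thesis using eigen(4) by (simp only: mult_minus_right)
          qed
          then have P: "k\<^sup>2 * (b * c) = - (c2 * (k * (l2 - a)))" by (simp add: c2_def power2_eq_square mult_ac)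
          have S: "k * (a - d) = - (c2 + k * (l2 - a))"
            unfolding c2_def distrib_left[symmetric] 1 by (simp add: algebra_simps)
          define v where "v = k * (l2 - a)"
          show ?thesis unfolding P S v_def[symmetric] by (simp add: algebra_simps power2_eq_square)
        qed
        have "0 < c2" using k eigen_sign(3) by (simp add: c2_def)
        moreover have "k * (l2 - a) < 0" using k eigen_sign(4) by (simp add: mult_pos_neg)
        ultimately show ?thesis unfolding c1 c0 roots by auto
      qed
      define a2 where "a2 = - R / (\<mu> * (l1 - l2))"
      \<comment> \<open>Here a2 = - b / disc and 1 + a2 c2 up = (a - l2) / disc, so the stated form
        is b times \<open>du\<close>, whose zero set is the stable eigendirection.\<close>
      have line: "{w. (1 + a2 * c2 * up) * (w$1 - up) - a2 * (w$2 - \<theta>p) = 0} = {w. du (w - p) = 0}"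
      proof -
        have "a2 = - R / (\<mu> * disc)" by (simp only: a2_def eigen(2))
        also have "\<dots> = - (R / \<mu>) / disc" by simp
        finally have a2: "a2 = - b / disc" by (simp only: b_def)
        have "a2 * c2 * up = - ((l1 - a) / disc)"
          using assms up by (simp add: a2 c2_def k_def b_def)
        then have "1 + a2 * c2 * up = (disc - (l1 - a)) / disc" using disc(2) by (simp add: diff_divide_distrib)
        also have "disc - (l1 - a) = a - l2" using eigen(2) by simp
        finally have 1: "1 + a2 * c2 * up = (a - l2) / disc" .
        have "(1 + a2 * c2 * up) * (w$1 - up) - a2 * (w$2 - \<theta>p) = b * du (w - p)" for w
        proof -
          have "b * du (w - p) = ((a - l2) * (w$1 - up) + b * (w$2 - \<theta>p)) / disc"
            using bc by (simp add: du_def pnth)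
          then show ?thesis unfolding 1 unfolding a2 by (simp add: add_divide_distrib)
        qed
        then show ?thesis using bc by simp
      qed
      obtain \<delta> \<epsilon> M C cc where SM: "0 < \<delta>" "\<delta> < \<epsilon>" "center_stable_manifold f (ball p \<epsilon>) p M"
        "arc_tangent_both_ways M p {w. du (w - p) = 0}" "\<forall>n::nat. C n > 0" "cc > 0"
        "\<forall>w0. norm (p - w0) \<le> \<delta> \<longrightarrow>
          (w0 \<in> M \<longrightarrow> (\<exists>W. connects f w0 p W \<and> W ` {0..} \<subseteq> M \<and>
             derivs_bounded_by W p (\<lambda>n \<xi>. C n * norm (p - w0) * exp (- cc * \<xi>)) \<and>
             (\<forall>W'. connects f w0 p W' \<longrightarrow> (\<forall>\<xi>\<ge>0. W' \<xi> = W \<xi>)))) \<and>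
          (w0 \<notin> M \<longrightarrow> \<not> (\<exists>W. connects f w0 p W \<and> (W ` {0..} \<subseteq> ball p \<epsilon> \<or>
             derivs_bounded_by W p (\<lambda>n \<xi>. C n * norm (p - w0) * exp (- cc * \<xi>)))))"
        using stable_manifold[OF strict] unfolding fld by (elim exE conjE) (rule that; assumption)
      have saddle: "saddle_point f p"
        unfolding saddle_point_def
        using fld_p fld_derivative eigenvalues_lin l2 eigen_sign(1) unfolding fld by blast
      show ?thesis
      proof (rule exI[of _ \<delta>], rule exI[of _ \<epsilon>], intro conjI impI SM(1,2) saddle[unfolded f_def p_def])
        show "?sub \<delta> \<epsilon>"
          unfolding dist_eq fst_conv snd_conv p_def[symmetric] f_def[symmetric] J
          by (rule exI[of _ l1], rule exI[of _ l2], rule exI[of _ c2], rule exI[of _ a2],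
              rule exI[of _ M], rule exI[of _ C], rule exI[of _ cc])
            (unfold quad line, use eigenvalues_lin eigen_sign(1) l2 a2_def SM(3-7) in auto)
      qed (use sub in auto)
    qed
  qed
qed

end
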